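(* Let $r\ge 0$ and $m\ge 1$ be integers, let $\mathbf U=\mathbf U_q(\mathfrak{sl}_{2r+2})\otimes_{\mathbb Q(q)}\mathbb Q(p,q)$, let $\mathbf U^{\imath}\subset\mathbf U$ be the coideal subalgebra defined in the context, let $\mathbb V$ be the natural representation of $\mathbf U$, and let $\mathcal H_m$ be the two-parameter Hecke algebra of type $B_m$. The left action $\Phi$ of $\mathbf U^{\imath}$ and the right action $\Psi$ of $\mathcal H_m$ on $\mathbb V^{\otimes m}$ commute and form double centralizers; that is, $$\Phi(\mathbf U^{\imath})=\operatorname{End}_{\mathcal H_m}(\mathbb V^{\otimes m}),\qquad \operatorname{End}_{\mathbf U^{\imath}}(\mathbb V^{\otimes m})^{\mathrm{op}}=\Psi(\mathcal H_m).$$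
   Context: $p,q$ are independent indeterminates; everything is over $\mathbb Q(p,q)$. Quantum group. Let $\mathbb I=\{-r,-r+1,\dots,r\}$, $\alpha_i=\varepsilon_{i-\frac12}-\varepsilon_{i+\frac12}$ for $i\in\mathbb I$ (simple roots of type $A_{2r+1}$), where the $\varepsilon_a$ are orthonormal for $(\cdot,\cdot)$. $\mathbf U$ is generated by $E_i,F_i,K_i^{\pm1}$ ($i\in\mathbb I$) with the standard relations: the $K_i$ commute, $K_iE_jK_i^{-1}=q^{(\alpha_i,\alpha_j)}E_j$, $K_iF_jK_i^{-1}=q^{-(\alpha_i,\alpha_j)}F_j$, $E_iF_j-F_jE_i=\delta_{ij}\frac{K_i-K_i^{-1}}{q-q^{-1}}$, and the quantum Serre relations. The comultiplication is $\Delta(E_i)=1\otimes E_i+E_i\otimes K_i^{-1}$, $\Delta(F_i)=F_i\otimes1+K_i\otimes F_i$, $\Delta(K_i)=K_i\otimes K_i$. Coideal subalgebra. $\mathbf U^{\imath}$ is the $\mathbb Q(p,q)$-subalgebra of $\mathbf U$ generated by, for $1\le i\le r$, $k_i^{\pm1}$ with $k_i=K_iK_{-i}^{-1}$, $e_i=E_i+F_{-i}K_i^{-1}$, $f_i=E_{-i}+K_{-i}^{-1}F_i$, and $t=E_0+qF_0K_0^{-1}+\frac{p-p^{-1}}{q-q^{-1}}K_0^{-1}$. Natural representation. Let $I=\{-r-\frac12,-r+\frac12,\dots,r+\frac12\}$. $\mathbb V=\bigoplus_{a\in I}\mathbb Q(p,q)u_a$ with $E_iu_{i+\frac12}=u_{i-\frac12}$,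 $F_iu_{i-\frac12}=u_{i+\frac12}$, all other $E_iu_a,F_iu_a$ zero, $K_iu_a=q^{(\alpha_i,\varepsilon_a)}u_a$. $\mathbb V^{\otimes m}$ is a $\mathbf U$-module via iterated $\Delta$, hence a $\mathbf U^{\imath}$-module by restriction; $\Phi:\mathbf U^{\imath}\to\operatorname{End}(\mathbb V^{\otimes m})$ denotes this action. Hecke algebra. $\mathcal H_m$ is the $\mathbb Q(p,q)$-algebra generated by $H_0,H_1,\dots,H_{m-1}$ with relations, where $q_0=p$ and $q_i=q$ for $i\ge1$: $(H_i-q_i^{-1})(H_i+q_i)=0$ for $i\ge0$; $H_iH_{i+1}H_i=H_{i+1}H_iH_{i+1}$ for $i\ge1$; $H_0H_1H_0H_1=H_1H_0H_1H_0$; $H_iH_j=H_jH_i$ for $|i-j|>1$. Action of $\mathcal H_m$. For $f=(f(1),\dots,f(m))\in I^m$ put $M_f=u_{f(1)}\otimes\cdots\otimes u_{f(m)}$. The Weyl group $W_{B_m}=\langle s_0,\dots,s_{m-1}\rangle$ acts on the right on $I^m$: for $j\ge1$, $f\cdot s_j$ swaps the entries $f(j),f(j+1)$, and $f\cdot s_0$ replaces $f(1)$ by $-f(1)$. The right action $\Psi$ of $\mathcal H_m$ on $\mathbb V^{\otimes m}$ is: for $i\ge1$, $M_fH_i=q^{-1}M_f$ if $f(i)=f(i+1)$; $M_fH_i=M_{f\cdot s_i}$ if $f(i)<f(i+1)$; $M_fH_i=M_{f\cdot s_i}+(q^{-1}-q)M_f$ if $f(i)>f(i+1)$; and $M_fH_0=M_{f\cdot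 s_0}$ if $f(1)>0$; $M_fH_0=M_{f\cdot s_0}+(p^{-1}-p)M_f$ if $f(1)<0$. *)

theory Defs
  imports
    "HOL-Computational_Algebra.Polynomial"
    "HOL-Computational_Algebra.Fraction_Field"
    "HOL-Library.Poly_Mapping"
    "HOL-Library.FuncSet"
    "HOL-Algebra.QuotRing"
    "HOL-Algebra.Generated_Rings"
begin

section \<open>The ground field\<close>

text \<open>\<open>\<rat>(p,q)\<close> is the fraction field of \<open>\<rat>[q][p]\<close>: the inner polynomial
  variable is \<open>q\<close>, the outer one is \<open>p\<close>.\<close>

type_synonym Qpq = "rat poly poly fract"

definition qq :: Qpq where "qq = Fraction_Field.Fract [:[:0, 1:]:] 1"

definition pp :: Qpq where "pp = Fraction_Field.Fract [:0, 1:] 1"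

section \<open>Free vector spaces\<close>

text \<open>\<open>'b \<Rightarrow>\<^sub>0 Qpq\<close> is the vector space over \<open>\<rat>(p,q)\<close> with basis \<open>'b\<close>.\<close>

definition scale :: "Qpq \<Rightarrow> ('b \<Rightarrow>\<^sub>0 Qpq) \<Rightarrow> ('b \<Rightarrow>\<^sub>0 Qpq)" where
  "scale c v = Poly_Mapping.map (\<lambda>x. c * x) v"

definition basis_vec :: "'b \<Rightarrow> ('b \<Rightarrow>\<^sub>0 Qpq)" where
  "basis_vec b = Poly_Mapping.single b 1"

definition lin_extend :: "('b \<Rightarrow> ('c \<Rightarrow>\<^sub>0 Qpq)) \<Rightarrow> ('b \<Rightarrow>\<^sub>0 Qpq) \<Rightarrow> ('c \<Rightarrow>\<^sub>0 Qpq)" where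
  "lin_extend T v = (\<Sum>b\<in>Poly_Mapping.keys v. scale (Poly_Mapping.lookup v b) (T b))"

section \<open>Algebras presented by generators and relations\<close>

text \<open>The free monoid, written additively so that the convolution product of
  \<^theory>\<open>HOL-Library.Poly_Mapping\<close> makes \<open>'g free_monoid \<Rightarrow>\<^sub>0 Qpq\<close> the free associative
  algebra on \<open>'g\<close>.\<close>

datatype 'g free_monoid = Word (letters: "'g list")

instantiation free_monoid :: (type) monoid_add
begin

definition "0 = Word []"

definition "u + v = Word (letters u @ letters v)"

instance
  by standard (simp_all add: zero_free_monoid_def plus_free_monoid_def)

end

type_synonym 'g free_alg = "'g free_monoid \<Rightarrow>\<^sub>0 Qpq"

definition gen :: "'g \<Rightarrow> 'g free_alg" where
  "gen g = basis_vec (Word [g])"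

definition scalar :: "Qpq \<Rightarrow> 'g free_alg" where
  "scalar c = Poly_Mapping.single 0 c"

definition free_algebra :: "'g set \<Rightarrow> 'g free_alg ring" where
  "free_algebra X =
    \<lparr>carrier = {x. \<forall>w \<in> Poly_Mapping.keys x. set (letters w) \<subseteq> X},
     mult = (*), one = 1, zero = 0, add = (+)\<rparr>"

text \<open>A pair \<open>(x, y)\<close> of \<open>R\<close> stands for the relation \<open>x = y\<close>. Ideals of
  \<^theory>\<open>HOL-Algebra.Ideal\<close> are two-sided.\<close>

definition relation_ideal :: "'g set \<Rightarrow> ('g free_alg \<times> 'g free_alg) set \<Rightarrow> 'g free_alg set" where
  "relation_ideal X R = Idl\<^bsub>free_algebra X\<^esub> {x - y | x y. (x, y) \<in> R}"

definition presented_algebra ::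
  "'g set \<Rightarrow> ('g free_alg \<times> 'g free_alg) set \<Rightarrow> 'g free_alg set ring" where
  "presented_algebra X R = free_algebra X Quot relation_ideal X R"

definition presented_class ::
  "'g set \<Rightarrow> ('g free_alg \<times> 'g free_alg) set \<Rightarrow> 'g free_alg \<Rightarrow> 'g free_alg set" where
  "presented_class X R x = relation_ideal X R +>\<^bsub>free_algebra X\<^esub> x"

text \<open>Linear operators attached to the generators extend to a left action
  \<open>(g\<^sub>1 \<dots> g\<^sub>n) v = g\<^sub>1 (\<dots> (g\<^sub>n v))\<close> and to a right action
  \<open>v (g\<^sub>1 \<dots> g\<^sub>n) = ((v g\<^sub>1) \<dots>) g\<^sub>n\<close> of the free algebra.\<close>

definition left_action ::
  "('g \<Rightarrow> ('b \<Rightarrow>\<^sub>0 Qpq) \<Rightarrow> ('b \<Rightarrow>\<^sub>0 Qpq)) \<Rightarrow> 'g free_alg \<Rightarrow> ('b \<Rightarrow>\<^sub>0 Qpq) \<Rightarrow> ('b \<Rightarrow>\<^sub>0 Qpq)" where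
  "left_action \<rho> x v = lin_extend (\<lambda>w. foldr \<rho> (letters w) v) x"

definition right_action ::
  "('g \<Rightarrow> ('b \<Rightarrow>\<^sub>0 Qpq) \<Rightarrow> ('b \<Rightarrow>\<^sub>0 Qpq)) \<Rightarrow> 'g free_alg \<Rightarrow> ('b \<Rightarrow>\<^sub>0 Qpq) \<Rightarrow> ('b \<Rightarrow>\<^sub>0 Qpq)" where
  "right_action \<rho> x v = lin_extend (\<lambda>w. fold \<rho> (letters w) v) x"

section \<open>The quantum group\<close>

definition node_set :: "nat \<Rightarrow> int set" where
  "node_set r = {- int r..int r}"

definition index_set :: "nat \<Rightarrow> rat set" where
  "index_set r = (\<lambda>i. of_int i - 1/2) ` {- int r..int r + 1}"

text \<open>Weights are given by their integer coordinates with respect to the orthonormal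
  \<open>\<epsilon>\<^sub>a\<close>.\<close>

definition eps :: "rat \<Rightarrow> rat \<Rightarrow> int" where
  "eps a = (\<lambda>b. if b = a then 1 else 0)"

definition alpha :: "int \<Rightarrow> rat \<Rightarrow> int" where
  "alpha i = (\<lambda>b. eps (of_int i - 1/2) b - eps (of_int i + 1/2) b)"

definition weight_form :: "nat \<Rightarrow> (rat \<Rightarrow> int) \<Rightarrow> (rat \<Rightarrow> int) \<Rightarrow> int" where
  "weight_form r x y = (\<Sum>a\<in>index_set r. x a * y a)"

datatype qgen = Egen int | Fgen int | Kgen int | Kinvgen int

abbreviation (input) "EE i \<equiv> gen (Egen i)"
abbreviation (input) "FF i \<equiv> gen (Fgen i)"
abbreviation (input) "KK i \<equiv> gen (Kgen i)"
abbreviation (input) "KKinv i \<equiv> gen (Kinvgen i)"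

definition U_gens :: "nat \<Rightarrow> qgen set" where
  "U_gens r = Egen ` node_set r \<union> Fgen ` node_set r \<union> Kgen ` node_set r \<union> Kinvgen ` node_set r"

inductive_set U_rels :: "nat \<Rightarrow> (qgen free_alg \<times> qgen free_alg) set" for r :: nat where
  K_Kinv: "i \<in> node_set r \<Longrightarrow> (KK i * KKinv i, 1) \<in> U_rels r"
| Kinv_K: "i \<in> node_set r \<Longrightarrow> (KKinv i * KK i, 1) \<in> U_rels r"
| K_K: "\<lbrakk>i \<in> node_set r; j \<in> node_set r\<rbrakk> \<Longrightarrow> (KK i * KK j, KK j * KK i) \<in> U_rels r"
| K_E: "\<lbrakk>i \<in> node_set r; j \<in> node_set r\<rbrakk> \<Longrightarrow>
    (KK i * EE j * KKinv i, scalar (qq powi weight_form r (alpha i) (alpha j)) * EE j) \<in> U_rels r"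
| K_F: "\<lbrakk>i \<in> node_set r; j \<in> node_set r\<rbrakk> \<Longrightarrow>
    (KK i * FF j * KKinv i, scalar (qq powi (- weight_form r (alpha i) (alpha j))) * FF j) \<in> U_rels r"
| E_F: "\<lbrakk>i \<in> node_set r; j \<in> node_set r\<rbrakk> \<Longrightarrow>
    (EE i * FF j - FF j * EE i,
     if i = j then scalar (1 / (qq - inverse qq)) * (KK i - KKinv i) else 0) \<in> U_rels r"
| Serre_E_far: "\<lbrakk>i \<in> node_set r; j \<in> node_set r; weight_form r (alpha i) (alpha j) = 0\<rbrakk> \<Longrightarrow>
    (EE i * EE j, EE j * EE i) \<in> U_rels r"
| Serre_F_far: "\<lbrakk>i \<in> node_set r; j \<in> node_set r; weight_form r (alpha i) (alpha j) = 0\<rbrakk> \<Longrightarrow>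
    (FF i * FF j, FF j * FF i) \<in> U_rels r"
| Serre_E: "\<lbrakk>i \<in> node_set r; j \<in> node_set r; weight_form r (alpha i) (alpha j) = -1\<rbrakk> \<Longrightarrow>
    (EE i * EE i * EE j + EE j * EE i * EE i,
     scalar (qq + inverse qq) * (EE i * EE j * EE i)) \<in> U_rels r"
| Serre_F: "\<lbrakk>i \<in> node_set r; j \<in> node_set r; weight_form r (alpha i) (alpha j) = -1\<rbrakk> \<Longrightarrow>
    (FF i * FF i * FF j + FF j * FF i * FF i,
     scalar (qq + inverse qq) * (FF i * FF j * FF i)) \<in> U_rels r"

definition U_alg :: "nat \<Rightarrow> qgen free_alg set ring" where
  "U_alg r = presented_algebra (U_gens r) (U_rels r)"

definition U_class :: "nat \<Rightarrow> qgen free_alg \<Rightarrow> qgen free_alg set" where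
  "U_class r x = presented_class (U_gens r) (U_rels r) x"

section \<open>The coideal subalgebra\<close>

definition Ui_gens :: "nat \<Rightarrow> qgen free_alg set" where
  "Ui_gens r =
    (\<Union>i\<in>{1..int r}.
      {KK i * KKinv (- i),
       KKinv i * KK (- i),
       EE i + FF (- i) * KKinv i,
       EE (- i) + KKinv (- i) * FF i}) \<union>
    {EE 0 + scalar qq * (FF 0 * KKinv 0)
      + scalar ((pp - inverse pp) / (qq - inverse qq)) * KKinv 0}"

text \<open>The subring generated by the images of the scalars and of \<open>Ui_gens r\<close> is the
  \<open>\<rat>(p,q)\<close>-subalgebra generated by \<open>Ui_gens r\<close>.\<close>

definition Ui_alg :: "nat \<Rightarrow> qgen free_alg set ring" where
  "Ui_alg r = (U_alg r)\<lparr>carrier :=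
    generate_ring (U_alg r) (U_class r ` (range scalar \<union> Ui_gens r))\<rparr>"

section \<open>The tensor space\<close>

text \<open>The list \<open>f = [f(1), \<dots>, f(m)]\<close>, as a basis vector, is
  \<open>M\<^sub>f = u\<^bsub>f(1)\<^esub> \<otimes> \<dots> \<otimes> u\<^bsub>f(m)\<^esub>\<close>.\<close>

type_synonym tensor = "rat list \<Rightarrow>\<^sub>0 Qpq"

definition tensor_space :: "nat \<Rightarrow> nat \<Rightarrow> tensor set" where
  "tensor_space r m =
    {v. \<forall>f \<in> Poly_Mapping.keys v. length f = m \<and> set f \<subseteq> index_set r}"

definition End_ring :: "nat \<Rightarrow> nat \<Rightarrow> (tensor \<Rightarrow> tensor) ring" where
  "End_ring r m =
    \<lparr>carrier = {\<phi> \<in> tensor_space r m \<rightarrow>\<^sub>E tensor_space r m.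
        (\<forall>v\<in>tensor_space r m. \<forall>w\<in>tensor_space r m. \<phi> (v + w) = \<phi> v + \<phi> w) \<and>
        (\<forall>c. \<forall>v\<in>tensor_space r m. \<phi> (scale c v) = scale c (\<phi> v))},
     mult = compose (tensor_space r m),
     one = (\<lambda>v\<in>tensor_space r m. v),
     zero = (\<lambda>v\<in>tensor_space r m. 0),
     add = (\<lambda>\<phi> \<psi>. \<lambda>v\<in>tensor_space r m. \<phi> v + \<psi> v)\<rparr>"

definition opposite_ring :: "'a ring \<Rightarrow> 'a ring" where
  "opposite_ring R = R\<lparr>mult := (\<lambda>x y. y \<otimes>\<^bsub>R\<^esub> x)\<rparr>"

section \<open>The action of the quantum group\<close>

fun natural_basis :: "nat \<Rightarrow> qgen \<Rightarrow> rat \<Rightarrow> tensor" where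
  "natural_basis r (Egen i) a = (if a = of_int i + 1/2 then basis_vec [of_int i - 1/2] else 0)"
| "natural_basis r (Fgen i) a = (if a = of_int i - 1/2 then basis_vec [of_int i + 1/2] else 0)"
| "natural_basis r (Kgen i) a = scale (qq powi weight_form r (alpha i) (eps a)) (basis_vec [a])"
| "natural_basis r (Kinvgen i) a = scale (qq powi (- weight_form r (alpha i) (eps a))) (basis_vec [a])"

definition natural_rep :: "nat \<Rightarrow> qgen \<Rightarrow> tensor \<Rightarrow> tensor" where
  "natural_rep r g = lin_extend (\<lambda>f. natural_basis r g (hd f))"

text \<open>The list \<open>[(x\<^sub>1, y\<^sub>1), \<dots>]\<close> stands for \<open>x\<^sub>1 \<otimes> y\<^sub>1 + \<dots>\<close>, the \<open>x\<^sub>k\<close> and \<open>y\<^sub>k\<close>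
  being words in the generators.\<close>

fun comult :: "qgen \<Rightarrow> (qgen list \<times> qgen list) list" where
  "comult (Egen i) = [([], [Egen i]), ([Egen i], [Kinvgen i])]"
| "comult (Fgen i) = [([Fgen i], []), ([Kgen i], [Fgen i])]"
| "comult (Kgen i) = [([Kgen i], [Kgen i])]"
| "comult (Kinvgen i) = [([Kinvgen i], [Kinvgen i])]"

definition tensor_vec :: "tensor \<Rightarrow> tensor \<Rightarrow> tensor" where
  "tensor_vec v w = lin_extend (\<lambda>f. lin_extend (\<lambda>g. basis_vec (f @ g)) w) v"

text \<open>\<open>A \<otimes> B\<close> on \<open>\<V> \<otimes> \<V>\<^sup>\<otimes>\<^sup>n\<close>, the first factor being spanned by the lists of length 1.\<close>

definition tensor_map :: "(tensor \<Rightarrow> tensor) \<Rightarrow> (tensor \<Rightarrow> tensor) \<Rightarrow> tensor \<Rightarrow> tensor" where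
  "tensor_map A B =
    lin_extend (\<lambda>f. tensor_vec (A (basis_vec [hd f])) (B (basis_vec (tl f))))"

text \<open>The generators act on \<open>\<V>\<^sup>\<otimes>\<^sup>m = \<V> \<otimes> \<V>\<^sup>\<otimes>\<^sup>(\<^sup>m\<^sup>-\<^sup>1\<^sup>)\<close> through the comultiplication. Only
  \<open>m \<ge> 1\<close> is meaningful; the value for \<open>m = 0\<close> is a dummy.\<close>

fun tensor_rep :: "nat \<Rightarrow> nat \<Rightarrow> qgen \<Rightarrow> tensor \<Rightarrow> tensor" where
  "tensor_rep r 0 g v = 0"
| "tensor_rep r (Suc 0) g v = natural_rep r g v"
| "tensor_rep r (Suc (Suc n)) g v =
    (\<Sum>(x, y)\<leftarrow>comult g.
      tensor_map (foldr (natural_rep r) x) (foldr (tensor_rep r (Suc n)) y) v)"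

text \<open>An element of a presented algebra is a coset; \<open>the_elem\<close> picks the common value of the
  action on its members.\<close>

definition \<Phi> :: "nat \<Rightarrow> nat \<Rightarrow> qgen free_alg set \<Rightarrow> (tensor \<Rightarrow> tensor)" where
  "\<Phi> r m u = the_elem ((\<lambda>x. restrict (left_action (tensor_rep r m) x) (tensor_space r m)) ` u)"

section \<open>The Hecke algebra and its action\<close>

definition hecke_par :: "nat \<Rightarrow> Qpq" where
  "hecke_par i = (if i = 0 then pp else qq)"

inductive_set hecke_rels :: "nat \<Rightarrow> (nat free_alg \<times> nat free_alg) set" for m :: nat where
  quadratic: "i < m \<Longrightarrow>
    ((gen i - scalar (inverse (hecke_par i))) * (gen i + scalar (hecke_par i)), 0) \<in> hecke_rels m"
| braid: "\<lbrakk>1 \<le> i; i + 1 < m\<rbrakk> \<Longrightarrow>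
    (gen i * gen (i + 1) * gen i, gen (i + 1) * gen i * gen (i + 1)) \<in> hecke_rels m"
| braid0: "1 < m \<Longrightarrow>
    (gen 0 * gen 1 * gen 0 * gen 1, gen 1 * gen 0 * gen 1 * gen 0) \<in> hecke_rels m"
| far: "\<lbrakk>i < m; j < m; \<bar>int i - int j\<bar> > 1\<rbrakk> \<Longrightarrow>
    (gen i * gen j, gen j * gen i) \<in> hecke_rels m"

definition hecke_alg :: "nat \<Rightarrow> nat free_alg set ring" where
  "hecke_alg m = presented_algebra {..<m} (hecke_rels m)"

text \<open>Lists are indexed from 0, so \<open>f(j)\<close> is \<open>f ! (j - 1)\<close>.\<close>

definition weyl_act :: "rat list \<Rightarrow> nat \<Rightarrow> rat list" where
  "weyl_act f j =
    (if j = 0 then f[0 := - (f ! 0)] else f[j - 1 := f ! j, j := f ! (j - 1)])"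

definition hecke_basis :: "nat \<Rightarrow> rat list \<Rightarrow> tensor" where
  "hecke_basis i f =
    (if i = 0 then
       if f ! 0 > 0 then basis_vec (weyl_act f 0)
       else basis_vec (weyl_act f 0) + scale (inverse pp - pp) (basis_vec f)
     else
       if f ! (i - 1) = f ! i then scale (inverse qq) (basis_vec f)
       else if f ! (i - 1) < f ! i then basis_vec (weyl_act f i)
       else basis_vec (weyl_act f i) + scale (inverse qq - qq) (basis_vec f))"

definition \<Psi> :: "nat \<Rightarrow> nat \<Rightarrow> nat free_alg set \<Rightarrow> (tensor \<Rightarrow> tensor)" where
  "\<Psi> r m h = the_elem ((\<lambda>x.
    restrict (right_action (\<lambda>i. lin_extend (hecke_basis i)) x) (tensor_space r m)) ` h)"

section \<open>The centralizer algebras\<close>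

definition End_hecke :: "nat \<Rightarrow> nat \<Rightarrow> (tensor \<Rightarrow> tensor) ring" where
  "End_hecke r m = (End_ring r m)\<lparr>carrier :=
    {\<phi> \<in> carrier (End_ring r m).
      \<forall>h \<in> carrier (hecke_alg m). \<forall>v \<in> tensor_space r m. \<phi> (\<Psi> r m h v) = \<Psi> r m h (\<phi> v)}\<rparr>"

definition End_Ui :: "nat \<Rightarrow> nat \<Rightarrow> (tensor \<Rightarrow> tensor) ring" where
  "End_Ui r m = (End_ring r m)\<lparr>carrier :=
    {\<phi> \<in> carrier (End_ring r m).
      \<forall>u \<in> carrier (Ui_alg r). \<forall>v \<in> tensor_space r m. \<phi> (\<Phi> r m u v) = \<Phi> r m u (\<phi> v)}\<rparr>"

end

theory Submission
  imports Defs
begin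

text \<open>Relations and commutation are checked on \<open>V\<^sup>\<otimes>\<^sup>m\<close> by splitting off the first tensor factor.
  For the double centralizer property write \<open>A\<close> and \<open>B\<close> for the images of the two algebras.

  \<open>A = B'\<close>: at \<open>p = 1\<close>, then \<open>q = 1\<close>, the generators \<open>e\<^sub>i, f\<^sub>i, t\<close> become derivations of the tensor
  power by matrices commuting with \<open>a \<mapsto> - a\<close>; by taking commutators they generate the
  derivations by all such matrices, and these generate all operators commuting with
  the Weyl group. So at this point the words in the generators span the space of solutions of the
  linear system \<open>X H\<^sub>i = H\<^sub>i X\<close>. As the specialization is a place of \<open>\<rat>(p,q)\<close> and the words lift to
  solutions over \<open>\<rat>(p,q)\<close>, they span the solution space there, too.

  \<open>B = B''\<close>: the matrices of the \<open>H\<^sub>i\<close> are symmetric and \<open>\<rat>(p,q)\<close> is an ordered field, so the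
  orthogonal projection of the matrix algebra onto \<open>B\<close> is \<open>B\<close>-linear. Hence \<open>A' = B'' = B\<close>.\<close>

section \<open>Linear maps between free vector spaces\<close>

text \<open>For generic p and q there is no direct description of the operators that words in the
  generators produce, so the proof rests on a squeeze. Under specialization the solution space of a
  linear system can only grow in dimension, and the span of a family of solutions can only shrink.
  If the two coincide at the special point, they already coincide over the function field. The
  coefficient of t forces p to be specialized before q. It does not lie in the local ring of the
  point p = q = 1; moreover, to rescale a vector until its specialization is defined and nonzero,
  one of any two entries has to divide the other. Both are reasons to work with a valuation ring,
  here one of rank two. The generators \<open>k\<^sub>i\<close> become the identity at the special
  point and contribute nothing to the span there, so only words in e, f and t are followed.\<close>

lemma lookup_scale [simp]: "Poly_Mapping.lookup (scale c v) b = c * Poly_Mapping.lookup v b"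
  by (simp add: scale_def Poly_Mapping.map.rep_eq when_def)

lemma lookup_basis_vec: "Poly_Mapping.lookup (basis_vec a) b = (if a = b then 1 else 0)"
  by (simp add: basis_vec_def lookup_single when_def)

lemma scale_zero_left [simp]: "scale 0 v = 0"
  and scale_zero_right [simp]: "scale c 0 = 0"
  and scale_one [simp]: "scale 1 v = v"
  and scale_scale [simp]: "scale c (scale d v) = scale (c * d) v"
  by (rule poly_mapping_eqI, simp add: mult.assoc)+

lemma scale_add: "scale c (u + v) = scale c u + scale c v"
  and scale_diff: "scale c (u - v) = scale c u - scale c v"
  and scale_minus: "scale c (- v) = - scale c v"
  and scale_add_left: "scale (c + d) v = scale c v + scale d v"
  by (rule poly_mapping_eqI, simp add: lookup_add lookup_minus algebra_simps)+

lemma scale_sum: "scale c (sum f A) = (\<Sum>a\<in>A. scale c (f a))"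
  by (induction A rule: infinite_finite_induct) (simp_all add: scale_add)

lemma keys_scale: "Poly_Mapping.keys (scale c v) \<subseteq> Poly_Mapping.keys v"
  by (auto simp: in_keys_iff)

lemma keys_basis_vec [simp]: "Poly_Mapping.keys (basis_vec b) = {b}"
  by (simp add: basis_vec_def)

lemma basis_vec_expansion: "v = (\<Sum>b\<in>Poly_Mapping.keys v. scale (Poly_Mapping.lookup v b) (basis_vec b))"
proof (rule poly_mapping_eqI)
  fix a
  show "Poly_Mapping.lookup v a =
      Poly_Mapping.lookup (\<Sum>b\<in>Poly_Mapping.keys v. scale (Poly_Mapping.lookup v b) (basis_vec b)) a"
    by (cases "a \<in> Poly_Mapping.keys v")
      (auto simp: lookup_sum lookup_basis_vec if_distrib sum.delta in_keys_iff cong: if_cong)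
qed

definition linear_map :: "(('b \<Rightarrow>\<^sub>0 Qpq) \<Rightarrow> ('c \<Rightarrow>\<^sub>0 Qpq)) \<Rightarrow> bool" where
  "linear_map T \<longleftrightarrow> (\<forall>u v. T (u + v) = T u + T v) \<and> (\<forall>c v. T (scale c v) = scale c (T v))"

lemma linear_mapI:
  assumes "\<And>u v. T (u + v) = T u + T v" "\<And>c v. T (scale c v) = scale c (T v)"
  shows "linear_map T"
  using assms by (simp add: linear_map_def)

lemma linear_map_add: "linear_map T \<Longrightarrow> T (u + v) = T u + T v"
  and linear_map_scale: "linear_map T \<Longrightarrow> T (scale c v) = scale c (T v)"
  by (simp_all add: linear_map_def)

lemma linear_map_zero: "linear_map T \<Longrightarrow> T 0 = 0"
  using linear_map_scale[of T 0 0] by simp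

lemma linear_map_sum: "linear_map T \<Longrightarrow> T (sum f A) = (\<Sum>a\<in>A. T (f a))"
  by (induction A rule: infinite_finite_induct) (simp_all add: linear_map_zero linear_map_add)

lemma linear_map_expansion:
  "linear_map T \<Longrightarrow>
    T v = (\<Sum>b\<in>Poly_Mapping.keys v. scale (Poly_Mapping.lookup v b) (T (basis_vec b)))"
  by (subst basis_vec_expansion[of v]) (simp add: linear_map_sum linear_map_scale)

text \<open>Only basis vectors in the support of v are tested, so membership of v in
  \<open>tensor_space\<close> becomes a condition on single lists.\<close>

lemma linear_map_eq_on:
  assumes "linear_map S" "linear_map T" "\<And>b. b \<in> Poly_Mapping.keys v \<Longrightarrow> S (basis_vec b) = T (basis_vec b)"
  shows "S v = T v"
  using assms by (simp add: linear_map_expansion[of S v] linear_map_expansion[of T v])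

lemma linear_map_compose: "linear_map S \<Longrightarrow> linear_map T \<Longrightarrow> linear_map (\<lambda>v. S (T v))"
  and linear_map_plus: "linear_map S \<Longrightarrow> linear_map T \<Longrightarrow> linear_map (\<lambda>v. S v + T v)"
  and linear_map_scaled: "linear_map T \<Longrightarrow> linear_map (\<lambda>v. scale c (T v))"
  and linear_map_ident: "linear_map (\<lambda>v. v)"
  and linear_map_const0: "linear_map (\<lambda>v. 0)"
  by (simp_all add: linear_map_def scale_add ac_simps)

lemma lin_extend_superset:
  assumes "finite A" "Poly_Mapping.keys v \<subseteq> A"
  shows "lin_extend T v = (\<Sum>b\<in>A. scale (Poly_Mapping.lookup v b) (T b))"
  unfolding lin_extend_def
  by (rule sum.mono_neutral_left) (use assms in \<open>auto simp: in_keys_iff\<close>)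

lemma linear_lin_extend: "linear_map (lin_extend T)"
proof (rule linear_mapI)
  fix u v :: "'a \<Rightarrow>\<^sub>0 Qpq"
  let ?A = "Poly_Mapping.keys u \<union> Poly_Mapping.keys v"
  show "lin_extend T (u + v) = lin_extend T u + lin_extend T v"
    using keys_add[of u v]
    by (simp add: lin_extend_superset[of ?A] lookup_add scale_add_left sum.distrib)
next
  fix c and v :: "'a \<Rightarrow>\<^sub>0 Qpq"
  show "lin_extend T (scale c v) = scale c (lin_extend T v)"
    using keys_scale[of c v]
    by (simp add: lin_extend_superset[of "Poly_Mapping.keys v"] scale_sum)
qed

lemma lin_extend_basis [simp]: "lin_extend T (basis_vec b) = T b"
  by (simp add: lin_extend_def lookup_basis_vec)

lemma lin_extend_zero [simp]: "lin_extend T 0 = 0"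
  by (simp add: lin_extend_def)

lemmas lin_extend_add = linear_map_add[OF linear_lin_extend]
lemmas lin_extend_scale = linear_map_scale[OF linear_lin_extend]

lemma lookup_lin_extend:
  "Poly_Mapping.lookup (lin_extend T v) b =
    (\<Sum>a\<in>Poly_Mapping.keys v. Poly_Mapping.lookup v a * Poly_Mapping.lookup (T a) b)"
  by (simp add: lin_extend_def lookup_sum)

lemma keys_lin_extend:
  "Poly_Mapping.keys (lin_extend T v) \<subseteq> (\<Union>b\<in>Poly_Mapping.keys v. Poly_Mapping.keys (T b))"
proof
  fix a assume "a \<in> Poly_Mapping.keys (lin_extend T v)"
  then have "(\<Sum>b\<in>Poly_Mapping.keys v. Poly_Mapping.lookup v b * Poly_Mapping.lookup (T b) a) \<noteq> 0"
    by (simp add: in_keys_iff lookup_lin_extend)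
  then obtain b where "b \<in> Poly_Mapping.keys v" "Poly_Mapping.lookup (T b) a \<noteq> 0"
    by (metis (no_types, lifting) mult_zero_right sum.neutral)
  then show "a \<in> (\<Union>b\<in>Poly_Mapping.keys v. Poly_Mapping.keys (T b))"
    by (auto simp: in_keys_iff)
qed

lemma lin_extend_plus: "lin_extend (\<lambda>b. S b + T b) v = lin_extend S v + lin_extend T v"
  by (simp add: lin_extend_def scale_add sum.distrib)

lemma lin_extend_compose: "linear_map S \<Longrightarrow> lin_extend (\<lambda>b. S (T b)) v = S (lin_extend T v)"
  by (simp add: lin_extend_def linear_map_sum linear_map_scale)

lemma lin_extend_scaled: "lin_extend (\<lambda>b. scale c (T b)) v = scale c (lin_extend T v)"
  by (rule lin_extend_compose) (simp add: linear_map_def scale_add ac_simps)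

section \<open>The action of the generators on tensors of arbitrary length\<close>

text \<open>The operator that tensors with u_a from the left. Splitting off the first factor turns a
  comultiplication formula into a rule for moving an operator past
  \<open>cons_tensor a\<close>.\<close>

definition cons_tensor :: "rat \<Rightarrow> tensor \<Rightarrow> tensor" where
  "cons_tensor a = lin_extend (\<lambda>f. basis_vec (a # f))"

lemma linear_cons_tensor: "linear_map (cons_tensor a)"
  by (simp add: cons_tensor_def linear_lin_extend)

lemma cons_tensor_basis: "cons_tensor a (basis_vec f) = basis_vec (a # f)"
  by (simp add: cons_tensor_def)

lemma cons_tensor_zero [simp]: "cons_tensor a 0 = 0"
  by (simp add: cons_tensor_def)

lemmas cons_tensor_add = linear_map_add[OF linear_cons_tensor]
lemmas cons_tensor_scale = linear_map_scale[OF linear_cons_tensor]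

text \<open>The two indices joined by node i: E_i carries \<open>upper i\<close> to
  \<open>lower i\<close>, and F_i goes back.\<close>

definition lower :: "int \<Rightarrow> rat" where "lower i = of_int i - 1/2"

definition upper :: "int \<Rightarrow> rat" where "upper i = of_int i + 1/2"

lemma alpha_eq: "alpha i a = (if a = lower i then 1 else 0) - (if a = upper i then 1 else 0)"
  by (simp add: lower_def upper_def alpha_def eps_def)

text \<open>The pairing of \<alpha>_i with the weight of M_f, hence the power of q by which K_i
  acts. It avoids \<open>weight_form\<close> in order to be free of the bound r.\<close>

definition weight :: "int \<Rightarrow> rat list \<Rightarrow> int" where
  "weight i f = (\<Sum>a\<leftarrow>f. alpha i a)"

lemma weight_simps [simp]: "weight i [] = 0" "weight i (a # f) = alpha i a + weight i f"
  by (simp_all add: weight_def)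

text \<open>On the empty list the generators act by the counit; this extends the action on \<open>V\<^sup>\<otimes>\<^sup>m\<close> to
  \<open>m = 0\<close>, which serves as the base of all inductions on \<open>m\<close>.\<close>

fun U_basis :: "qgen \<Rightarrow> rat list \<Rightarrow> tensor" where
  "U_basis (Kgen i) f = scale (qq powi weight i f) (basis_vec f)"
| "U_basis (Kinvgen i) f = scale (qq powi (- weight i f)) (basis_vec f)"
| "U_basis (Egen i) [] = 0"
| "U_basis (Egen i) (a # f) = cons_tensor a (U_basis (Egen i) f) +
    (if a = upper i then scale (qq powi (- weight i f)) (basis_vec (lower i # f)) else 0)"
| "U_basis (Fgen i) [] = 0"
| "U_basis (Fgen i) (a # f) = (if a = lower i then basis_vec (upper i # f) else 0) +
    scale (qq powi alpha i a) (cons_tensor a (U_basis (Fgen i) f))"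

definition U_act :: "qgen \<Rightarrow> tensor \<Rightarrow> tensor" where
  "U_act g = lin_extend (U_basis g)"

lemma linear_U_act: "linear_map (U_act g)"
  by (simp add: U_act_def linear_lin_extend)

lemma U_act_zero [simp]: "U_act g 0 = 0"
  by (simp add: U_act_def)

lemmas U_act_add = linear_map_add[OF linear_U_act]
lemmas U_act_scale = linear_map_scale[OF linear_U_act]

lemma U_act_basis: "U_act g (basis_vec f) = U_basis g f"
  by (simp add: U_act_def)

lemma qq_nonzero [simp]: "qq \<noteq> 0"
  by (simp add: qq_def Zero_fract_def eq_fract)

lemma pp_nonzero [simp]: "pp \<noteq> 0"
  by (simp add: pp_def Zero_fract_def eq_fract)

lemma qq_diff_nonzero: "qq - inverse qq \<noteq> 0"
proof
  assume "qq - inverse qq = 0"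
  then have "qq * qq = 1" by (simp add: field_simps)
  then show False
    by (simp add: qq_def One_fract_def eq_fract one_pCons)
qed

text \<open>The comultiplication with its left part evaluated in the natural representation. Being
  stated for arbitrary w, the rules also rewrite nested applications of generators.\<close>

lemma U_act_cons:
  "U_act (Kgen i) (cons_tensor a w) = scale (qq powi alpha i a) (cons_tensor a (U_act (Kgen i) w))"
  "U_act (Kinvgen i) (cons_tensor a w) = scale (qq powi (- alpha i a)) (cons_tensor a (U_act (Kinvgen i) w))"
  "U_act (Egen i) (cons_tensor a w) = cons_tensor a (U_act (Egen i) w) +
     (if a = upper i then cons_tensor (lower i) (U_act (Kinvgen i) w) else 0)"
  "U_act (Fgen i) (cons_tensor a w) = (if a = lower i then cons_tensor (upper i) w else 0) +
     scale (qq powi alpha i a) (cons_tensor a (U_act (Fgen i) w))"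
proof -
  note lin = linear_map_plus linear_map_scaled linear_map_compose[OF linear_U_act]
    linear_map_compose[OF linear_cons_tensor] linear_cons_tensor linear_U_act linear_map_const0
  show "U_act (Kgen i) (cons_tensor a w) = scale (qq powi alpha i a) (cons_tensor a (U_act (Kgen i) w))"
    by (rule linear_map_eq_on[where v = w])
      (auto intro!: lin simp: cons_tensor_basis U_act_basis cons_tensor_scale power_int_add)
  show "U_act (Kinvgen i) (cons_tensor a w) = scale (qq powi (- alpha i a)) (cons_tensor a (U_act (Kinvgen i) w))"
    by (rule linear_map_eq_on[where v = w])
      (auto intro!: lin simp: cons_tensor_basis U_act_basis cons_tensor_scale power_int_diff power_int_minus field_simps)
  show "U_act (Egen i) (cons_tensor a w) = cons_tensor a (U_act (Egen i) w) +
     (if a = upper i then cons_tensor (lower i) (U_act (Kinvgen i) w) else 0)"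
    by (cases "a = upper i"; rule linear_map_eq_on[where v = w])
      (auto intro!: lin simp: cons_tensor_basis U_act_basis cons_tensor_scale)
  show "U_act (Fgen i) (cons_tensor a w) = (if a = lower i then cons_tensor (upper i) w else 0) +
     scale (qq powi alpha i a) (cons_tensor a (U_act (Fgen i) w))"
    by (cases "a = lower i"; rule linear_map_eq_on[where v = w])
      (auto intro!: lin simp: cons_tensor_basis U_act_basis cons_tensor_scale)
qed

text \<open>Induction on the number of tensor factors for identities of operators. The step is
  phrased with \<open>cons_tensor\<close> so that \<open>U_act_cons\<close> applies; the base case
  concerns the counit.\<close>

lemma list_basis_induct:
  fixes S T :: "tensor \<Rightarrow> tensor"
  assumes "linear_map S" "linear_map T" "S (basis_vec []) = T (basis_vec [])"
    and "\<And>a f. S (basis_vec f) = T (basis_vec f) \<Longrightarrow>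
      S (cons_tensor a (basis_vec f)) = T (cons_tensor a (basis_vec f))"
  shows "S v = T v"
proof (rule linear_map_eq_on[OF assms(1,2)])
  show "S (basis_vec b) = T (basis_vec b)" for b
    by (induction b) (use assms(3,4) in \<open>auto simp: cons_tensor_basis\<close>)
qed

section \<open>The relations of the quantum group on tensors\<close>

definition cartan :: "int \<Rightarrow> int \<Rightarrow> int" where
  "cartan i j = (if i = j then 2 else if \<bar>i - j\<bar> = 1 then - 1 else 0)"

lemma lower_upper_eq [simp]:
  "upper i = upper j \<longleftrightarrow> i = j" "lower i = lower j \<longleftrightarrow> i = j"
  "upper i = lower j \<longleftrightarrow> j = i + 1" "lower i = upper j \<longleftrightarrow> i = j + 1"
proof -
  have "upper i = lower j \<longleftrightarrow> of_int (i + 1) = (of_int j :: rat)" for i j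
    by (auto simp: lower_def upper_def algebra_simps)
  then have *: "upper i = lower j \<longleftrightarrow> i + 1 = j" for i j
    by (simp only: of_int_eq_iff)
  show "upper i = lower j \<longleftrightarrow> j = i + 1" "lower i = upper j \<longleftrightarrow> i = j + 1"
    using *[of i j] *[of j i] by (auto simp: eq_commute)
qed (auto simp: lower_def upper_def)

lemma alpha_lower_upper:
  "alpha i (upper j) = (if j + 1 = i then 1 else 0) - (if i = j then 1 else 0)"
  "alpha i (lower j) = (if i = j then 1 else 0) - (if j = i + 1 then 1 else 0)"
  by (auto simp: alpha_eq)

lemma lower_upper_in_index_set:
  assumes "i \<in> node_set r"
  shows "lower i \<in> index_set r" "upper i \<in> index_set r"
proof -
  show "lower i \<in> index_set r"
    unfolding index_set_def lower_def by (rule imageI) (use assms in \<open>auto simp: node_set_def\<close>)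
  have "(of_int (i + 1) - 1/2 :: rat) \<in> index_set r"
    unfolding index_set_def by (rule imageI) (use assms in \<open>auto simp: node_set_def\<close>)
  then show "upper i \<in> index_set r" by (simp add: upper_def algebra_simps)
qed

lemma finite_index_set [simp]: "finite (index_set r)"
  by (simp add: index_set_def)

lemma weight_form_alpha:
  assumes "i \<in> node_set r"
  shows "weight_form r (alpha i) y = y (lower i) - y (upper i)"
proof -
  have "weight_form r (alpha i) y =
      (\<Sum>a\<in>index_set r. (if a = lower i then y a else 0) - (if a = upper i then y a else 0))"
    unfolding weight_form_def by (rule sum.cong) (auto simp: alpha_eq)
  also have "\<dots> = y (lower i) - y (upper i)"
    using lower_upper_in_index_set[OF assms] by (simp add: sum_subtractf)
  finally show ?thesis .
qed

lemma weight_form_alpha_alpha: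
  "i \<in> node_set r \<Longrightarrow> weight_form r (alpha i) (alpha j) = cartan i j"
  by (auto simp: weight_form_alpha alpha_lower_upper cartan_def)

lemma weight_form_alpha_eps: "i \<in> node_set r \<Longrightarrow> weight_form r (alpha i) (eps a) = alpha i a"
  by (auto simp: weight_form_alpha eps_def alpha_eq)

lemmas linear_U_intros = linear_map_plus linear_map_scaled linear_map_compose[OF linear_U_act]
    linear_map_compose[OF linear_cons_tensor] linear_cons_tensor linear_U_act linear_map_const0
    linear_map_ident

lemma linear_map_diff: "linear_map S \<Longrightarrow> linear_map T \<Longrightarrow> linear_map (\<lambda>v. S v - T v)"
  by (simp add: linear_map_def scale_diff)

lemma U_act_Kgen_Kinvgen: "U_act (Kgen i) (U_act (Kinvgen i) v) = v"
  by (rule linear_map_eq_on[where v = v])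
    (auto intro!: linear_U_intros simp: U_act_basis U_act_scale power_int_minus)

lemma U_act_Kinvgen_Kgen: "U_act (Kinvgen i) (U_act (Kgen i) v) = v"
  by (rule linear_map_eq_on[where v = v])
    (auto intro!: linear_U_intros simp: U_act_basis U_act_scale power_int_minus)

lemma U_act_Kgen_Kgen: "U_act (Kgen i) (U_act (Kgen j) v) = U_act (Kgen j) (U_act (Kgen i) v)"
  by (rule linear_map_eq_on[where v = v])
    (auto intro!: linear_U_intros simp: U_act_basis U_act_scale mult.commute)

lemma cons_tensor_diff: "cons_tensor a (u - v) = cons_tensor a u - cons_tensor a v"
  using cons_tensor_add[of a "u - v" v] by (simp add: algebra_simps)

lemma U_act_diff: "U_act g (u - v) = U_act g u - U_act g v"
  using U_act_add[of g "u - v" v] by (simp add: algebra_simps)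

lemma U_act_Kgen_Egen:
  "U_act (Kgen i) (U_act (Egen j) v) = scale (qq powi cartan i j) (U_act (Egen j) (U_act (Kgen i) v))"
proof (rule list_basis_induct[where v = v])
  fix a :: rat and f
  assume IH: "U_act (Kgen i) (U_act (Egen j) (basis_vec f)) =
    scale (qq powi cartan i j) (U_act (Egen j) (U_act (Kgen i) (basis_vec f)))"
  have K: "U_act (Kgen i) (U_act (Kinvgen j) v) = U_act (Kinvgen j) (U_act (Kgen i) v)" for v
    by (rule linear_map_eq_on[where v = v])
      (auto intro!: linear_U_intros simp: U_act_basis U_act_scale mult.commute)
  \<comment> \<open>E_j raises the weight by \<alpha>_j, the difference between the weights of its
    target and its source.\<close>
  have q: "qq powi alpha i (lower j) = qq powi cartan i j * qq powi alpha i (upper j)"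
    unfolding power_int_add[OF disjI1, OF qq_nonzero, symmetric]
    by (rule arg_cong[where f = "\<lambda>n. qq powi n"]) (auto simp: alpha_lower_upper cartan_def)
  show "U_act (Kgen i) (U_act (Egen j) (cons_tensor a (basis_vec f))) =
    scale (qq powi cartan i j) (U_act (Egen j) (U_act (Kgen i) (cons_tensor a (basis_vec f))))"
    by (auto simp: U_act_cons U_act_add U_act_scale cons_tensor_add cons_tensor_scale IH K q scale_add mult_ac)
qed (auto intro!: linear_U_intros simp: U_act_basis U_act_scale)

lemma U_act_Kgen_Fgen:
  "U_act (Kgen i) (U_act (Fgen j) v) = scale (qq powi - cartan i j) (U_act (Fgen j) (U_act (Kgen i) v))"
proof (rule list_basis_induct[where v = v])
  fix a :: rat and f
  assume IH: "U_act (Kgen i) (U_act (Fgen j) (basis_vec f)) =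
    scale (qq powi - cartan i j) (U_act (Fgen j) (U_act (Kgen i) (basis_vec f)))"
  have q: "qq powi alpha i (upper j) = qq powi - cartan i j * qq powi alpha i (lower j)"
    unfolding power_int_add[OF disjI1, OF qq_nonzero, symmetric]
    by (rule arg_cong[where f = "\<lambda>n. qq powi n"]) (auto simp: alpha_lower_upper cartan_def)
  show "U_act (Kgen i) (U_act (Fgen j) (cons_tensor a (basis_vec f))) =
    scale (qq powi - cartan i j) (U_act (Fgen j) (U_act (Kgen i) (cons_tensor a (basis_vec f))))"
    by (auto simp: U_act_cons U_act_add U_act_scale cons_tensor_add cons_tensor_scale IH q scale_add mult_ac)
qed (auto intro!: linear_U_intros simp: U_act_basis U_act_scale)

lemma U_act_Kinvgen_Egen:
  "U_act (Kinvgen i) (U_act (Egen j) v) = scale (qq powi - cartan i j) (U_act (Egen j) (U_act (Kinvgen i) v))"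
proof -
  have "U_act (Kinvgen i) (U_act (Egen j) v) =
      U_act (Kinvgen i) (U_act (Egen j) (U_act (Kgen i) (U_act (Kinvgen i) v)))"
    by (simp add: U_act_Kgen_Kinvgen)
  also have "\<dots> = U_act (Kinvgen i) (scale (qq powi - cartan i j) (scale (qq powi cartan i j) (U_act (Egen j) (U_act (Kgen i) (U_act (Kinvgen i) v)))))"
    by (simp add: power_int_minus)
  also have "\<dots> = scale (qq powi - cartan i j) (U_act (Egen j) (U_act (Kinvgen i) v))"
    by (simp add: U_act_Kgen_Egen[symmetric] U_act_scale U_act_Kinvgen_Kgen del: scale_scale)
  finally show ?thesis .
qed

lemma U_act_Kinvgen_Fgen:
  "U_act (Kinvgen i) (U_act (Fgen j) v) = scale (qq powi cartan i j) (U_act (Fgen j) (U_act (Kinvgen i) v))"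
proof -
  have "U_act (Kinvgen i) (U_act (Fgen j) v) =
      U_act (Kinvgen i) (U_act (Fgen j) (U_act (Kgen i) (U_act (Kinvgen i) v)))"
    by (simp add: U_act_Kgen_Kinvgen)
  also have "\<dots> = U_act (Kinvgen i) (scale (qq powi cartan i j) (scale (qq powi - cartan i j) (U_act (Fgen j) (U_act (Kgen i) (U_act (Kinvgen i) v)))))"
    by (simp add: power_int_minus)
  also have "\<dots> = scale (qq powi cartan i j) (U_act (Fgen j) (U_act (Kinvgen i) v))"
    by (simp add: U_act_Kgen_Fgen[symmetric] U_act_scale U_act_Kinvgen_Kgen del: scale_scale)
  finally show ?thesis .
qed

text \<open>The induction step says that the comultiplication respects the relation. In the
  commutator of the two coproducts the mixed terms E_i K_j \<otimes> K_i^-1 F_j and K_j E_i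
  \<otimes> F_j K_i^-1 cancel, since moving the K's costs inverse powers of q. For i = j there
  remains K \<otimes> [E,F] + [E,F] \<otimes> K^-1, which telescopes.\<close>

lemma U_act_Egen_Fgen:
  "U_act (Egen i) (U_act (Fgen j) v) - U_act (Fgen j) (U_act (Egen i) v) =
    (if i = j then scale (1 / (qq - inverse qq)) (U_act (Kgen i) v - U_act (Kinvgen i) v) else 0)"
proof (cases "i = j")
  case True
  have "U_act (Egen i) (U_act (Fgen i) v) - U_act (Fgen i) (U_act (Egen i) v) =
    scale (1 / (qq - inverse qq)) (U_act (Kgen i) v - U_act (Kinvgen i) v)"
  proof (rule list_basis_induct[where v = v])
    fix a :: rat and f
    assume "U_act (Egen i) (U_act (Fgen i) (basis_vec f)) - U_act (Fgen i) (U_act (Egen i) (basis_vec f)) =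
      scale (1 / (qq - inverse qq)) (U_act (Kgen i) (basis_vec f) - U_act (Kinvgen i) (basis_vec f))"
    then have IH: "U_act (Egen i) (U_act (Fgen i) (basis_vec f)) = U_act (Fgen i) (U_act (Egen i) (basis_vec f)) +
      scale (1 / (qq - inverse qq)) (U_act (Kgen i) (basis_vec f) - U_act (Kinvgen i) (basis_vec f))"
      by (simp add: algebra_simps)
    consider "a = upper i" | "a = lower i" | "a \<noteq> upper i" "a \<noteq> lower i"
      by blast
    then show "U_act (Egen i) (U_act (Fgen i) (cons_tensor a (basis_vec f))) -
        U_act (Fgen i) (U_act (Egen i) (cons_tensor a (basis_vec f))) =
      scale (1 / (qq - inverse qq)) (U_act (Kgen i) (cons_tensor a (basis_vec f)) - U_act (Kinvgen i) (cons_tensor a (basis_vec f)))"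
    proof cases
      case 1
      show ?thesis unfolding 1 using qq_diff_nonzero
        by (auto intro!: poly_mapping_eqI simp: U_act_cons U_act_add U_act_scale U_act_diff cons_tensor_add
          cons_tensor_scale cons_tensor_diff IH U_act_Kinvgen_Fgen alpha_lower_upper cartan_def
          scale_add scale_diff lookup_add lookup_minus divide_simps algebra_simps power2_eq_square)
    next
      case 2
      show ?thesis unfolding 2 using qq_diff_nonzero
        by (auto intro!: poly_mapping_eqI simp: U_act_cons U_act_add U_act_scale U_act_diff cons_tensor_add
          cons_tensor_scale cons_tensor_diff IH U_act_Kinvgen_Fgen alpha_lower_upper cartan_def
          scale_add scale_diff lookup_add lookup_minus divide_simps algebra_simps power2_eq_square)
    next
      case 3
      then have "alpha i a = 0" by (simp add: alpha_eq)
      then show ?thesis using 3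
        by (simp add: U_act_cons U_act_add U_act_scale U_act_diff cons_tensor_add
          cons_tensor_scale cons_tensor_diff IH)
    qed
  qed (auto intro!: linear_U_intros linear_map_diff simp: U_act_basis)
  with True show ?thesis by simp
next
  case False
  have "U_act (Egen i) (U_act (Fgen j) v) = U_act (Fgen j) (U_act (Egen i) v)"
  proof (rule list_basis_induct[where v = v])
    fix a :: rat and f
    assume IH: "U_act (Egen i) (U_act (Fgen j) (basis_vec f)) = U_act (Fgen j) (U_act (Egen i) (basis_vec f))"
    show "U_act (Egen i) (U_act (Fgen j) (cons_tensor a (basis_vec f))) =
        U_act (Fgen j) (U_act (Egen i) (cons_tensor a (basis_vec f)))"
      using False
      by (auto simp: U_act_cons U_act_add U_act_scale cons_tensor_add cons_tensor_scale IH
          U_act_Kinvgen_Fgen alpha_lower_upper cartan_def power_int_minus scale_add)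
  qed (auto intro!: linear_U_intros simp: U_act_basis)
  with False show ?thesis by simp
qed

lemmas U_act_distribs = U_act_add U_act_scale U_act_diff cons_tensor_add cons_tensor_scale
  cons_tensor_diff scale_add scale_diff

lemma U_act_Egen_far:
  assumes "cartan i j = 0"
  shows "U_act (Egen i) (U_act (Egen j) v) = U_act (Egen j) (U_act (Egen i) v)"
proof (rule list_basis_induct[where v = v])
  fix a :: rat and f
  assume IH: "U_act (Egen i) (U_act (Egen j) (basis_vec f)) = U_act (Egen j) (U_act (Egen i) (basis_vec f))"
  have "j \<noteq> i \<and> j \<noteq> i + 1 \<and> i \<noteq> j + 1 \<and> cartan j i = 0"
    using assms unfolding cartan_def by (smt (verit))
  then show "U_act (Egen i) (U_act (Egen j) (cons_tensor a (basis_vec f))) =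
      U_act (Egen j) (U_act (Egen i) (cons_tensor a (basis_vec f)))"
    using assms
    by (auto simp: U_act_cons U_act_distribs IH U_act_Kinvgen_Egen)
qed (auto intro!: linear_U_intros simp: U_act_basis)

lemma U_act_Fgen_far:
  assumes "cartan i j = 0"
  shows "U_act (Fgen i) (U_act (Fgen j) v) = U_act (Fgen j) (U_act (Fgen i) v)"
proof (rule list_basis_induct[where v = v])
  fix a :: rat and f
  assume IH: "U_act (Fgen i) (U_act (Fgen j) (basis_vec f)) = U_act (Fgen j) (U_act (Fgen i) (basis_vec f))"
  have "j \<noteq> i \<and> j \<noteq> i + 1 \<and> i \<noteq> j + 1 \<and> cartan j i = 0"
    using assms unfolding cartan_def by (smt (verit))
  then show "U_act (Fgen i) (U_act (Fgen j) (cons_tensor a (basis_vec f))) =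
      U_act (Fgen j) (U_act (Fgen i) (cons_tensor a (basis_vec f)))"
    using assms
    by (auto simp: U_act_cons U_act_distribs IH alpha_lower_upper mult_ac)
qed (auto intro!: linear_U_intros simp: U_act_basis)

text \<open>A word with two E_i and one E_j kills the natural representation, because 2\<alpha>_i +
  \<alpha>_j is not a difference of two weights of V. Apart from the induction hypothesis only terms
  with the E's spread over both parts occur; they cancel once every K^-1 has been moved to the
  right.\<close>

lemma U_act_Egen_Serre:
  assumes "cartan i j = - 1"
  shows "U_act (Egen i) (U_act (Egen i) (U_act (Egen j) v)) + U_act (Egen j) (U_act (Egen i) (U_act (Egen i) v)) =
    scale (qq + inverse qq) (U_act (Egen i) (U_act (Egen j) (U_act (Egen i) v)))"
proof (rule list_basis_induct[where v = v])
  fix a :: rat and f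
  assume "U_act (Egen i) (U_act (Egen i) (U_act (Egen j) (basis_vec f))) +
      U_act (Egen j) (U_act (Egen i) (U_act (Egen i) (basis_vec f))) =
    scale (qq + inverse qq) (U_act (Egen i) (U_act (Egen j) (U_act (Egen i) (basis_vec f))))"
  then have IH: "U_act (Egen i) (U_act (Egen i) (U_act (Egen j) (basis_vec f))) =
    scale (qq + inverse qq) (U_act (Egen i) (U_act (Egen j) (U_act (Egen i) (basis_vec f)))) -
      U_act (Egen j) (U_act (Egen i) (U_act (Egen i) (basis_vec f)))"
    by (simp add: algebra_simps)
  have KK: "U_act (Kinvgen i) (U_act (Kinvgen j) v) = U_act (Kinvgen j) (U_act (Kinvgen i) v)" for v
    by (rule linear_map_eq_on[where v = v])
      (auto intro!: linear_U_intros simp: U_act_basis U_act_scale mult.commute)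
  consider "j = i + 1" | "i = j + 1"
    using assms by (force simp: cartan_def abs_if split: if_splits)
  then show "U_act (Egen i) (U_act (Egen i) (U_act (Egen j) (cons_tensor a (basis_vec f)))) +
      U_act (Egen j) (U_act (Egen i) (U_act (Egen i) (cons_tensor a (basis_vec f)))) =
    scale (qq + inverse qq) (U_act (Egen i) (U_act (Egen j) (U_act (Egen i) (cons_tensor a (basis_vec f)))))"
  proof cases
    case 1
    consider "a = upper i" | "a = upper j" | "a \<noteq> upper i" "a \<noteq> upper j"
      by blast
    then show ?thesis
      unfolding 1 by cases (auto simp: U_act_cons U_act_distribs IH[unfolded 1] U_act_Kinvgen_Egen
        cartan_def power_int_minus KK[unfolded 1];
        auto intro!: poly_mapping_eqI simp: lookup_add lookup_minus divide_simps algebra_simps power2_eq_square)+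
  next
    case 2
    consider "a = upper i" | "a = upper j" | "a \<noteq> upper i" "a \<noteq> upper j"
      by blast
    then show ?thesis
      unfolding 2 by cases (auto simp: U_act_cons U_act_distribs IH[unfolded 2] U_act_Kinvgen_Egen
        cartan_def power_int_minus KK[unfolded 2];
        auto intro!: poly_mapping_eqI simp: lookup_add lookup_minus divide_simps algebra_simps power2_eq_square)+
  qed
qed (auto intro!: linear_U_intros simp: U_act_basis)

lemma U_act_Fgen_Serre:
  assumes "cartan i j = - 1"
  shows "U_act (Fgen i) (U_act (Fgen i) (U_act (Fgen j) v)) + U_act (Fgen j) (U_act (Fgen i) (U_act (Fgen i) v)) =
    scale (qq + inverse qq) (U_act (Fgen i) (U_act (Fgen j) (U_act (Fgen i) v)))"
proof (rule list_basis_induct[where v = v])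
  fix a :: rat and f
  assume "U_act (Fgen i) (U_act (Fgen i) (U_act (Fgen j) (basis_vec f))) +
      U_act (Fgen j) (U_act (Fgen i) (U_act (Fgen i) (basis_vec f))) =
    scale (qq + inverse qq) (U_act (Fgen i) (U_act (Fgen j) (U_act (Fgen i) (basis_vec f))))"
  then have IH: "U_act (Fgen i) (U_act (Fgen i) (U_act (Fgen j) (basis_vec f))) =
    scale (qq + inverse qq) (U_act (Fgen i) (U_act (Fgen j) (U_act (Fgen i) (basis_vec f)))) -
      U_act (Fgen j) (U_act (Fgen i) (U_act (Fgen i) (basis_vec f)))"
    by (simp add: algebra_simps)
  consider "j = i + 1" | "i = j + 1"
    using assms by (force simp: cartan_def abs_if split: if_splits)
  then show "U_act (Fgen i) (U_act (Fgen i) (U_act (Fgen j) (cons_tensor a (basis_vec f)))) +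
      U_act (Fgen j) (U_act (Fgen i) (U_act (Fgen i) (cons_tensor a (basis_vec f)))) =
    scale (qq + inverse qq) (U_act (Fgen i) (U_act (Fgen j) (U_act (Fgen i) (cons_tensor a (basis_vec f)))))"
  proof cases
    case 1
    show ?thesis
    proof (cases "a = lower i \<or> a = lower j")
      case True
      then show ?thesis
        unfolding 1 by (elim disjE) (auto simp: U_act_cons U_act_distribs IH[unfolded 1] alpha_lower_upper power_int_minus;
          auto intro!: poly_mapping_eqI simp: lookup_add lookup_minus divide_simps algebra_simps power2_eq_square)+
    next
      case False
      then show ?thesis by (simp add: U_act_cons U_act_distribs IH mult_ac)
    qed
  next
    case 2
    show ?thesis
    proof (cases "a = lower i \<or> a = lower j")
      case True
      then show ?thesis
        unfolding 2 by (elim disjE) (auto simp: U_act_cons U_act_distribs IH[unfolded 2] alpha_lower_upper power_int_minus;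
          auto intro!: poly_mapping_eqI simp: lookup_add lookup_minus divide_simps algebra_simps power2_eq_square)+
    next
      case False
      then show ?thesis by (simp add: U_act_cons U_act_distribs IH mult_ac)
    qed
  qed
qed (auto intro!: linear_U_intros simp: U_act_basis)

section \<open>The Hecke operators and their relations\<close>

definition H_act :: "nat \<Rightarrow> tensor \<Rightarrow> tensor" where
  "H_act i = lin_extend (hecke_basis i)"

lemma linear_H_act: "linear_map (H_act i)"
  by (simp add: H_act_def linear_lin_extend)

lemma H_act_zero [simp]: "H_act g 0 = 0"
  by (simp add: H_act_def)

lemma H_act_basis: "H_act i (basis_vec f) = hecke_basis i f"
  by (simp add: H_act_def)

lemmas H_act_add = linear_map_add[OF linear_H_act]
lemmas H_act_scale = linear_map_scale[OF linear_H_act]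

lemmas linear_intros = linear_U_intros linear_map_diff linear_H_act linear_map_compose[OF linear_H_act]

lemma H_act_cons_0:
  "H_act 0 (cons_tensor a w) =
    cons_tensor (- a) w + (if a > 0 then 0 else scale (inverse pp - pp) (cons_tensor a w))"
  by (cases "a > 0"; rule linear_map_eq_on[where v = w])
    (auto intro!: linear_intros simp: H_act_basis cons_tensor_basis hecke_basis_def weyl_act_def)

lemma H_act_cons_1:
  "H_act (Suc 0) (cons_tensor a (cons_tensor b w)) =
    (if a = b then scale (inverse qq) (cons_tensor a (cons_tensor b w))
     else cons_tensor b (cons_tensor a w) +
       (if a < b then 0 else scale (inverse qq - qq) (cons_tensor a (cons_tensor b w))))"
proof -
  let ?R = "\<lambda>w. if a = b then scale (inverse qq) (cons_tensor a (cons_tensor b w))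
     else cons_tensor b (cons_tensor a w) +
       (if a < b then 0 else scale (inverse qq - qq) (cons_tensor a (cons_tensor b w)))"
  have "linear_map ?R"
    by (simp add: linear_map_def cons_tensor_add cons_tensor_scale scale_add ac_simps)
  then have "H_act (Suc 0) (cons_tensor a (cons_tensor b w)) = ?R w"
  proof (rule linear_map_eq_on[rotated])
    show "linear_map (\<lambda>w. H_act (Suc 0) (cons_tensor a (cons_tensor b w)))"
    by (rule linear_map_compose[OF linear_H_act linear_map_compose[OF linear_cons_tensor linear_cons_tensor]])
    show "H_act (Suc 0) (cons_tensor a (cons_tensor b (basis_vec f))) = ?R (basis_vec f)" for f
      by (simp add: H_act_basis cons_tensor_basis hecke_basis_def weyl_act_def)
  qed
  then show ?thesis .
qed

lemma H_act_cons_Suc: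
  "H_act (Suc (Suc k)) (cons_tensor a w) = cons_tensor a (H_act (Suc k) w)"
  by (rule linear_map_eq_on[where v = w])
    (auto intro!: linear_intros simp: H_act_basis cons_tensor_basis hecke_basis_def weyl_act_def
      cons_tensor_add cons_tensor_scale)

lemmas H_act_distribs = H_act_add H_act_scale U_act_distribs

text \<open>The relation (H - c^-1)(H + c) = 0 solved for H^2. A first entry 0 would be scaled by 1
  + p^-1 - p under H_0, which is neither p^-1 nor -p, so entries 0 are excluded; half-integral
  indices avoid them.\<close>

lemma H_act_quadratic_basis:
  "i < length f \<Longrightarrow> 0 \<notin> set f \<Longrightarrow>
    H_act i (H_act i (basis_vec f)) =
      scale (inverse (hecke_par i) - hecke_par i) (H_act i (basis_vec f)) + basis_vec f"
proof (induction f arbitrary: i)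
  case (Cons a f)
  show ?case
  proof (cases i)
    case 0
    then show ?thesis using Cons.prems
      by (auto simp: cons_tensor_basis[symmetric] H_act_cons_0 H_act_distribs hecke_par_def
        intro!: poly_mapping_eqI simp: lookup_add algebra_simps)
  next
    case (Suc j)
    show ?thesis
    proof (cases j)
      case 0
      with Suc Cons.prems obtain b f' where f: "f = b # f'" by (cases f) auto
      show ?thesis unfolding f Suc 0
        by (cases a b rule: linorder_cases)
          (auto simp: cons_tensor_basis[symmetric] H_act_cons_1 H_act_distribs hecke_par_def
            intro!: poly_mapping_eqI simp: lookup_add algebra_simps divide_simps power2_eq_square)
    next
      case (Suc k)
      then show ?thesis using Cons.prems Cons.IH[of j] \<open>i = Suc j\<close>
        by (simp add: cons_tensor_basis[symmetric] H_act_cons_Suc cons_tensor_add cons_tensor_scale hecke_par_def)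
    qed
  qed
qed simp

text \<open>Splitting off factors on which neither operator acts leads to the first three factors,
  where the relation is checked for every relative order of the entries.\<close>

lemma H_act_braid_basis:
  "Suc (Suc k) < length f \<Longrightarrow>
    H_act (Suc k) (H_act (Suc (Suc k)) (H_act (Suc k) (basis_vec f))) =
    H_act (Suc (Suc k)) (H_act (Suc k) (H_act (Suc (Suc k)) (basis_vec f)))"
proof (induction f arbitrary: k)
  case (Cons a f)
  show ?case
  proof (cases k)
    case 0
    with Cons.prems obtain b c f' where f: "f = b # c # f'" by (cases f; cases "tl f") auto
    show ?thesis unfolding f 0
      by (cases a b rule: linorder_cases; cases b c rule: linorder_cases; cases a c rule: linorder_cases)
        (auto simp: cons_tensor_basis[symmetric] H_act_cons_1 H_act_cons_Suc H_act_distribs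
            intro!: poly_mapping_eqI simp: lookup_add algebra_simps)
  next
    case (Suc j)
    then show ?thesis using Cons.prems Cons.IH[of j]
      by (simp add: cons_tensor_basis[symmetric] H_act_cons_Suc)
  qed
qed simp

lemma H_act_braid0_basis:
  assumes "Suc 0 < length f" "0 \<notin> set f"
  shows "H_act 0 (H_act (Suc 0) (H_act 0 (H_act (Suc 0) (basis_vec f)))) =
    H_act (Suc 0) (H_act 0 (H_act (Suc 0) (H_act 0 (basis_vec f))))"
proof -
  obtain a b f' where f: "f = a # b # f'"
    using assms by (cases f; cases "tl f") auto
  have nz: "a \<noteq> 0" "b \<noteq> 0" using assms f by auto
  show ?thesis
    unfolding f
    \<comment> \<open>The four comparisons determine the relative order of a, b, -a, -b and 0, on
      which all branches of \<open>hecke_basis\<close> depend.\<close>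
    by (insert nz, cases a b rule: linorder_cases; cases a "- b" rule: linorder_cases; cases a "0::rat" rule: linorder_cases; cases b "0::rat" rule: linorder_cases)
      (auto simp: cons_tensor_basis[symmetric] H_act_cons_0 H_act_cons_1 H_act_distribs
            intro!: poly_mapping_eqI simp: lookup_add algebra_simps, simp add: field_simps)
qed

lemma H_act_far:
  "Suc i < j \<Longrightarrow> j < length f \<Longrightarrow>
    H_act i (H_act j (basis_vec f)) = H_act j (H_act i (basis_vec f))"
proof (induction f arbitrary: i j)
  case (Cons a f)
  then obtain k where j: "j = Suc (Suc k)" by (cases j; cases "j - 1") auto
  show ?case
  proof (cases i)
    case 0
    then show ?thesis
      by (simp add: j cons_tensor_basis[symmetric] H_act_cons_Suc H_act_cons_0 H_act_distribs)
  next
    case (Suc i')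
    show ?thesis
    proof (cases i')
      case 0
      with Suc Cons.prems j obtain b f' k' where f: "f = b # f'" "k = Suc k'" by (cases f; cases k) auto
      show ?thesis
        by (simp add: j Suc 0 f cons_tensor_basis[symmetric] H_act_cons_Suc H_act_cons_1 H_act_distribs)
    next
      case (Suc i'')
      then show ?thesis using Cons.prems Cons.IH[of i' "Suc k"] \<open>i = Suc i'\<close> j
        by (simp add: cons_tensor_basis[symmetric] H_act_cons_Suc)
    qed
  qed
qed simp

section \<open>Commutation of the quantum group with H_i for positive i\<close>

lemma upper_eq_lower: "upper i = lower (i + 1)"
  by (simp add: lower_def upper_def)

lemma lower_less_iff [simp]: "lower i < lower j \<longleftrightarrow> i < j"
  by (simp add: lower_def)

lemma uminus_lower: "- lower i = lower (1 - i)"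
  by (simp add: lower_def)

lemma lower_pos_iff [simp]: "lower i > 0 \<longleftrightarrow> i > 0"
proof -
  have "lower i > 0 \<longleftrightarrow> 2 * (of_int i :: rat) > 1" by (auto simp: lower_def)
  also have "\<dots> \<longleftrightarrow> of_int (2 * i) > (of_int 1 :: rat)" by simp
  also have "\<dots> \<longleftrightarrow> i > 0" by (simp only: of_int_less_iff) linarith
  finally show ?thesis .
qed

lemma lower_nonzero [simp]: "lower i \<noteq> 0"
proof
  assume "lower i = 0"
  then have "\<not> lower i > 0" "\<not> lower (1 - i) > 0"
    using uminus_lower[of i] by auto
  then show False unfolding lower_pos_iff by linarith
qed

lemma index_set_eq_lower: "index_set r = lower ` {- int r..int r + 1}"
  by (simp add: index_set_def lower_def)

text \<open>A generator moves an index at most to its neighbour, and no \<open>lower l\<close> lies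
  strictly between the two. Hence the order relative to another entry can change only if that entry
  is i - 1/2 or i + 1/2 as well. Entries are written as \<open>lower j\<close> to make all
  comparisons integral.\<close>

lemma U_act_H_act_1:
  "U_act g (H_act (Suc 0) (cons_tensor (lower j) (cons_tensor (lower k) w))) =
    H_act (Suc 0) (U_act g (cons_tensor (lower j) (cons_tensor (lower k) w)))"
proof (cases g)
  case (Egen i)
  consider "j = i + 1" "k = i + 1" | "j = i + 1" "k = i" | "j = i" "k = i + 1"
    | "j = i + 1" "k \<noteq> i + 1" "k \<noteq> i" | "k = i + 1" "j \<noteq> i + 1" "j \<noteq> i" | "k \<noteq> i + 1" "j \<noteq> i + 1"
    by blast
  then show ?thesis
    unfolding Egen
    by cases (cases j k rule: linorder_cases; auto simp: H_act_cons_1 U_act_cons H_act_distribs upper_eq_lower alpha_lower_upper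
        intro!: poly_mapping_eqI simp: lookup_add divide_simps algebra_simps)+
next
  case (Fgen i)
  consider "j = i" "k = i" | "j = i + 1" "k = i" | "j = i" "k = i + 1"
    | "j = i" "k \<noteq> i + 1" "k \<noteq> i" | "k = i" "j \<noteq> i + 1" "j \<noteq> i" | "k \<noteq> i" "j \<noteq> i"
    by blast
  then show ?thesis
    unfolding Fgen
    by cases (cases j k rule: linorder_cases; auto simp: H_act_cons_1 U_act_cons H_act_distribs upper_eq_lower alpha_lower_upper
        intro!: poly_mapping_eqI simp: lookup_add divide_simps algebra_simps)+
qed (auto simp: H_act_cons_1 U_act_cons H_act_distribs mult_ac)

lemma U_act_H_act_basis:
  "Suc i < length f \<Longrightarrow> set f \<subseteq> range lower \<Longrightarrow>
    U_act g (H_act (Suc i) (basis_vec f)) = H_act (Suc i) (U_act g (basis_vec f))"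
proof (induction f arbitrary: i g)
  case (Cons a f)
  show ?case
  proof (cases i)
    case 0
    with Cons.prems obtain j k f' where "a = lower j" "f = lower k # f'"
      by (cases f) auto
    then show ?thesis
      using U_act_H_act_1[of g j k "basis_vec f'"] 0 by (simp add: cons_tensor_basis)
  next
    case (Suc k)
    then have IH: "U_act g (H_act (Suc k) (basis_vec f)) = H_act (Suc k) (U_act g (basis_vec f))" for g
      using Cons by auto
    show ?thesis
      by (cases g) (auto simp: Suc cons_tensor_basis[symmetric] H_act_cons_Suc U_act_cons IH H_act_distribs)
  qed
qed simp

section \<open>Actions of free algebras\<close>

lemma scale_mult_left: "scale c x * y = scale c (x * y)" for x y :: "'g free_alg"
  by (simp add: scale_def mult_map_scale_conv_mult mult.assoc)

text \<open>The convolution product is noncommutative, so the passage of a scalar through a left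
  factor has to be checked on words.\<close>

lemma scale_mult_right: "x * scale c y = scale c (x * y)" for x y :: "'g free_alg"
proof -
  have single: "Poly_Mapping.single 0 c * scale d z = scale d (Poly_Mapping.single 0 c * z)" for d and z :: "'g free_alg"
    by (simp add: scale_def mult_map_scale_conv_mult mult_single mult.commute[of c] flip: mult.assoc)
  have "x * Poly_Mapping.single 0 c =
      (\<Sum>b\<in>Poly_Mapping.keys x. scale (Poly_Mapping.lookup x b) (basis_vec b)) * Poly_Mapping.single 0 c"
    by (subst basis_vec_expansion[of x]) (rule refl)
  also have "\<dots> = Poly_Mapping.single 0 c * (\<Sum>b\<in>Poly_Mapping.keys x. scale (Poly_Mapping.lookup x b) (basis_vec b))"
    by (simp add: sum_distrib_left sum_distrib_right scale_mult_left single basis_vec_def mult_single)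
  also have "\<dots> = Poly_Mapping.single 0 c * x"
    by (subst (2) basis_vec_expansion[of x]) (rule refl)
  finally have "x * Poly_Mapping.single 0 c = Poly_Mapping.single 0 c * x" .
  then show ?thesis
    by (simp add: scale_def mult_map_scale_conv_mult flip: mult.assoc)
qed

lemma basis_vec_word_mult: "basis_vec u * basis_vec w = (basis_vec (u + w) :: 'g free_alg)"
  by (simp add: basis_vec_def mult_single)

text \<open>Multiplicativity of a left action reduced to words: T is the action of a concatenation
  on a fixed vector, R that of its right part, and S u the operator of its left part.\<close>

lemma lin_extend_mult:
  fixes x y :: "'g free_alg"
  assumes "\<And>u w. T (u + w) = S u (R w)" "\<And>u. linear_map (S u)"
  shows "lin_extend T (x * y) = lin_extend (\<lambda>u. S u (lin_extend R y)) x"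
proof -
  have "x * y = (\<Sum>u\<in>Poly_Mapping.keys x. \<Sum>w\<in>Poly_Mapping.keys y.
      scale (Poly_Mapping.lookup x u) (scale (Poly_Mapping.lookup y w) (basis_vec (u + w))))"
    using arg_cong2[OF basis_vec_expansion[of x] basis_vec_expansion[of y], of "(*)"]
    by (simp add: sum_product scale_mult_left scale_mult_right basis_vec_word_mult mult.commute)
  then have "lin_extend T (x * y) = (\<Sum>u\<in>Poly_Mapping.keys x. \<Sum>w\<in>Poly_Mapping.keys y.
      scale (Poly_Mapping.lookup x u) (scale (Poly_Mapping.lookup y w) (S u (R w))))"
    by (simp add: linear_map_sum[OF linear_lin_extend] lin_extend_scale assms(1) del: scale_scale)
  also have "\<dots> = lin_extend (\<lambda>u. S u (lin_extend R y)) x"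
    by (simp add: lin_extend_def linear_map_sum[OF assms(2)] linear_map_scale[OF assms(2)] scale_sum)
  finally show ?thesis .
qed

lemma linear_foldr: "(\<And>g. linear_map (\<rho> g)) \<Longrightarrow> linear_map (foldr \<rho> w)"
  by (induction w) (auto simp: linear_map_def)

lemma linear_fold: "(\<And>g. linear_map (\<rho> g)) \<Longrightarrow> linear_map (fold \<rho> w)"
  by (induction w) (auto simp: linear_map_def)

lemma left_action_mult:
  assumes "\<And>g. linear_map (\<rho> g)"
  shows "left_action \<rho> (x * y) v = left_action \<rho> x (left_action \<rho> y v)"
  unfolding left_action_def
  by (rule lin_extend_mult) (simp_all add: plus_free_monoid_def linear_foldr assms)

lemma lin_extend_mult_rev:
  fixes x y :: "'g free_alg"
  assumes "\<And>u w. T (u + w) = S w (R u)" "\<And>u. linear_map (S u)"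
  shows "lin_extend T (x * y) = lin_extend (\<lambda>w. S w (lin_extend R x)) y"
proof -
  have "x * y = (\<Sum>u\<in>Poly_Mapping.keys x. \<Sum>w\<in>Poly_Mapping.keys y.
      scale (Poly_Mapping.lookup x u) (scale (Poly_Mapping.lookup y w) (basis_vec (u + w))))"
    using arg_cong2[OF basis_vec_expansion[of x] basis_vec_expansion[of y], of "(*)"]
    by (simp add: sum_product scale_mult_left scale_mult_right basis_vec_word_mult mult.commute)
  then have "lin_extend T (x * y) = (\<Sum>u\<in>Poly_Mapping.keys x. \<Sum>w\<in>Poly_Mapping.keys y.
      scale (Poly_Mapping.lookup x u) (scale (Poly_Mapping.lookup y w) (S w (R u))))"
    by (simp add: linear_map_sum[OF linear_lin_extend] lin_extend_scale assms(1) del: scale_scale)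
  also have "\<dots> = lin_extend (\<lambda>w. S w (lin_extend R x)) y"
    by (subst sum.swap)
      (simp add: lin_extend_def linear_map_sum[OF assms(2)] linear_map_scale[OF assms(2)] scale_sum mult.commute)
  finally show ?thesis .
qed

lemma right_action_mult:
  assumes "\<And>g. linear_map (\<rho> g)"
  shows "right_action \<rho> (x * y) v = right_action \<rho> y (right_action \<rho> x v)"
  unfolding right_action_def
  by (rule lin_extend_mult_rev) (simp_all add: plus_free_monoid_def linear_fold assms)

lemma action_add:
  "left_action \<rho> (x + y) v = left_action \<rho> x v + left_action \<rho> y v"
  "right_action \<rho> (x + y) v = right_action \<rho> x v + right_action \<rho> y v"
  by (simp_all add: left_action_def right_action_def lin_extend_add)

lemma action_zero [simp]: "left_action \<rho> 0 v = 0" "right_action \<rho> 0 v = 0"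
  by (simp_all add: left_action_def right_action_def)

lemma action_diff:
  "left_action \<rho> (x - y) v = left_action \<rho> x v - left_action \<rho> y v"
  "right_action \<rho> (x - y) v = right_action \<rho> x v - right_action \<rho> y v"
  using action_add[of \<rho> "x - y" y v] by (simp_all add: algebra_simps)

lemma action_gen [simp]:
  "left_action \<rho> (gen g) v = \<rho> g v" "right_action \<rho> (gen g) v = \<rho> g v"
  by (simp_all add: left_action_def right_action_def gen_def)

lemma scalar_eq: "scalar c = scale c (basis_vec 0)"
  by (simp add: scalar_def scale_def basis_vec_def del: single_one)

lemma action_scalar [simp]:
  "left_action \<rho> (scalar c) v = scale c v" "right_action \<rho> (scalar c) v = scale c v"
  by (simp_all add: left_action_def right_action_def scalar_eq lin_extend_scale zero_free_monoid_def)

lemma one_free_alg_eq: "(1 :: 'g free_alg) = basis_vec 0"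
  by (simp add: basis_vec_def)

lemma action_one [simp]:
  "left_action \<rho> 1 v = v" "right_action \<rho> 1 v = v"
  by (simp_all add: left_action_def right_action_def one_free_alg_eq zero_free_monoid_def)

lemma linear_left_action:
  assumes "\<And>g. linear_map (\<rho> g)" shows "linear_map (left_action \<rho> x)"
  unfolding left_action_def linear_map_def
  by (simp add: linear_map_add[OF linear_foldr[OF assms]] linear_map_scale[OF linear_foldr[OF assms]]
      lin_extend_plus lin_extend_scaled)

lemma linear_right_action:
  assumes "\<And>g. linear_map (\<rho> g)" shows "linear_map (right_action \<rho> x)"
  unfolding right_action_def linear_map_def
  by (simp add: linear_map_add[OF linear_fold[OF assms]] linear_map_scale[OF linear_fold[OF assms]]
      lin_extend_plus lin_extend_scaled)

lemmas left_action_U_mult = left_action_mult[of U_act, OF linear_U_act]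
lemmas linear_left_action_U = linear_left_action[of U_act, OF linear_U_act]
lemmas right_action_H_mult = right_action_mult[of H_act, OF linear_H_act]
lemmas linear_right_action_H = linear_right_action[of H_act, OF linear_H_act]

lemma U_act_respects_rels:
  assumes "(x, y) \<in> U_rels r"
  shows "left_action U_act x v = left_action U_act y v"
  using assms
proof cases
  case (K_E i j)
  have "U_act (Kgen i) (U_act (Egen j) (U_act (Kinvgen i) v)) = scale (qq powi cartan i j) (U_act (Egen j) v)"
    by (simp add: U_act_Kgen_Egen U_act_Kgen_Kinvgen)
  with K_E show ?thesis by (simp add: left_action_U_mult weight_form_alpha_alpha)
next
  case (K_F i j)
  have "U_act (Kgen i) (U_act (Fgen j) (U_act (Kinvgen i) v)) = scale (qq powi - cartan i j) (U_act (Fgen j) v)"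
    by (simp add: U_act_Kgen_Fgen U_act_Kgen_Kinvgen)
  with K_F show ?thesis by (simp add: left_action_U_mult weight_form_alpha_alpha)
qed (auto simp: left_action_U_mult action_diff action_add U_act_Kgen_Kinvgen U_act_Kinvgen_Kgen U_act_Egen_Fgen
    weight_form_alpha_alpha U_act_Egen_Serre U_act_Fgen_Serre intro: U_act_Kgen_Kgen U_act_Egen_far U_act_Fgen_far)

section \<open>The tensor space\<close>

definition tensor_index :: "nat \<Rightarrow> nat \<Rightarrow> rat list set" where
  "tensor_index r m = {f. length f = m \<and> set f \<subseteq> index_set r}"

lemma finite_tensor_index [simp]: "finite (tensor_index r m)"
  using finite_lists_length_eq[of "index_set r" m] by (simp add: tensor_index_def conj_commute)

lemma tensor_space_eq: "tensor_space r m = {v. Poly_Mapping.keys v \<subseteq> tensor_index r m}"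
  by (auto simp: tensor_space_def tensor_index_def)

lemma tensor_space_add: "u \<in> tensor_space r m \<Longrightarrow> v \<in> tensor_space r m \<Longrightarrow> u + v \<in> tensor_space r m"
  using keys_add[of u v] by (auto simp: tensor_space_eq)

lemma tensor_space_scale: "v \<in> tensor_space r m \<Longrightarrow> scale c v \<in> tensor_space r m"
  using keys_scale[of c v] by (auto simp: tensor_space_eq)

lemma tensor_space_zero: "0 \<in> tensor_space r m"
  by (simp add: tensor_space_eq)

lemma tensor_space_uminus: "v \<in> tensor_space r m \<Longrightarrow> - v \<in> tensor_space r m"
  by (auto simp: tensor_space_eq in_keys_iff subset_iff)

lemma tensor_space_basis: "basis_vec f \<in> tensor_space r m \<longleftrightarrow> f \<in> tensor_index r m"
  by (simp add: tensor_space_eq)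

lemma tensor_space_lin_extend:
  assumes "\<And>b. b \<in> Poly_Mapping.keys v \<Longrightarrow> T b \<in> tensor_space r m"
  shows "lin_extend T v \<in> tensor_space r m"
  using assms keys_lin_extend[of T v] by (fastforce simp: tensor_space_eq)

lemma tensor_space_cons:
  "a \<in> index_set r \<Longrightarrow> v \<in> tensor_space r m \<Longrightarrow> cons_tensor a v \<in> tensor_space r (Suc m)"
  unfolding cons_tensor_def
  by (rule tensor_space_lin_extend) (auto simp: tensor_space_eq tensor_index_def)

lemma node_of_U_gens:
  "Egen i \<in> U_gens r \<longleftrightarrow> i \<in> node_set r" "Fgen i \<in> U_gens r \<longleftrightarrow> i \<in> node_set r"
  "Kgen i \<in> U_gens r \<longleftrightarrow> i \<in> node_set r" "Kinvgen i \<in> U_gens r \<longleftrightarrow> i \<in> node_set r"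
  by (auto simp: U_gens_def)

lemma U_basis_in_tensor_space:
  assumes "g \<in> U_gens r"
  shows "f \<in> tensor_index r m \<Longrightarrow> U_basis g f \<in> tensor_space r m"
proof (induction f arbitrary: m)
  case Nil
  with assms show ?case
    by (cases g) (auto intro: tensor_space_scale simp: tensor_space_basis tensor_space_zero)
next
  case (Cons a f)
  then obtain n where m: "m = Suc n" "f \<in> tensor_index r n" "a \<in> index_set r"
    by (auto simp: tensor_index_def)
  with Cons have "U_basis g f \<in> tensor_space r n" by blast
  moreover have "basis_vec (b # f) \<in> tensor_space r (Suc n)" if "b \<in> index_set r" for b
    using that m by (simp add: tensor_space_basis tensor_index_def)
  ultimately show ?case
    using assms m
    by (cases g) (auto simp: node_of_U_gens lower_upper_in_index_set tensor_space_zero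
        intro!: tensor_space_add tensor_space_scale tensor_space_cons)
qed

lemma U_act_tensor_space: "g \<in> U_gens r \<Longrightarrow> v \<in> tensor_space r m \<Longrightarrow> U_act g v \<in> tensor_space r m"
  unfolding U_act_def
proof (rule tensor_space_lin_extend)
  fix f assume "g \<in> U_gens r" "v \<in> tensor_space r m" "f \<in> Poly_Mapping.keys v"
  then show "U_basis g f \<in> tensor_space r m"
    by (intro U_basis_in_tensor_space) (auto simp: tensor_space_eq)
qed

lemma uminus_index_set: "a \<in> index_set r \<Longrightarrow> - a \<in> index_set r"
  by (auto simp: index_set_eq_lower uminus_lower)

lemma weyl_act_tensor_index:
  assumes "f \<in> tensor_index r m" "i < m"
  shows "weyl_act f i \<in> tensor_index r m"
proof -
  have "set f \<subseteq> index_set r" "length f = m" using assms by (auto simp: tensor_index_def)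
  moreover have "f ! k \<in> index_set r" if "k < m" for k
    using that calculation by (metis nth_mem subsetD)
  ultimately show ?thesis
    using assms(2) set_update_subset_insert[of f] set_update_subset_insert[of "f[i - 1 := f ! i]" i "f ! (i - 1)"]
    by (fastforce simp: weyl_act_def tensor_index_def uminus_index_set)
qed

lemma H_act_tensor_space: "i < m \<Longrightarrow> v \<in> tensor_space r m \<Longrightarrow> H_act i v \<in> tensor_space r m"
  unfolding H_act_def
proof (rule tensor_space_lin_extend)
  fix f assume "i < m" "v \<in> tensor_space r m" "f \<in> Poly_Mapping.keys v"
  then have "f \<in> tensor_index r m" "weyl_act f i \<in> tensor_index r m"
    by (auto simp: tensor_space_eq intro: weyl_act_tensor_index)
  then show "hecke_basis i f \<in> tensor_space r m"
    by (cases "i = 0") (auto simp: hecke_basis_def tensor_space_basis intro!: tensor_space_add tensor_space_scale)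
qed

section \<open>Agreement with the action through the iterated comultiplication\<close>

lemma natural_basis_eq: "g \<in> U_gens r \<Longrightarrow> natural_basis r g a = U_basis g [a]"
  by (cases g) (auto simp: node_of_U_gens weight_form_alpha_eps lower_def upper_def)

lemma natural_rep_basis: "g \<in> U_gens r \<Longrightarrow> natural_rep r g (basis_vec [a]) = U_basis g [a]"
  by (simp add: natural_rep_def natural_basis_eq)

lemma tensor_vec_basis: "tensor_vec (basis_vec [a]) w = cons_tensor a w"
  by (simp add: tensor_vec_def cons_tensor_def)

lemma tensor_vec_scale: "tensor_vec (scale c v) w = scale c (tensor_vec v w)"
  by (simp add: tensor_vec_def lin_extend_scale)

lemma tensor_vec_zero: "tensor_vec 0 w = 0"
  by (simp add: tensor_vec_def)

lemma linear_tensor_map: "linear_map (tensor_map A B)"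
  unfolding tensor_map_def by (rule linear_lin_extend)

lemma linear_tensor_rep: "linear_map (tensor_rep r m g)"
proof (cases "(r, m, g, 0::tensor)" rule: tensor_rep.cases)
  case (2 r' g' v)
  then have "tensor_rep r m g = natural_rep r g" by (auto simp: fun_eq_iff)
  then show ?thesis by (simp add: natural_rep_def linear_lin_extend)
next
  case (3 r' n g' v)
  have *: "linear_map (\<lambda>v. \<Sum>(x, y)\<leftarrow>xs. tensor_map (A x) (B y) v)" for xs and A B :: "qgen list \<Rightarrow> tensor \<Rightarrow> tensor"
    by (induction xs) (auto simp: linear_map_const0 intro!: linear_map_plus linear_tensor_map)
  have "tensor_rep r m g = (\<lambda>v. (\<Sum>(x, y)\<leftarrow>comult g.
      tensor_map (foldr (natural_rep r) x) (foldr (tensor_rep r (Suc n)) y) v))"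
    using 3 by (auto simp: fun_eq_iff)
  then show ?thesis by (simp only: *)
qed (auto simp: linear_map_def)

text \<open>Links the prescribed action, a recursion on m through \<open>comult\<close>, to the
  recursion on lists used in all computations. The empty list is left out because the prescribed
  action is a dummy for m = 0.\<close>

lemma tensor_rep_basis:
  assumes "f \<noteq> []" "g \<in> U_gens r"
  shows "tensor_rep r (length f) g (basis_vec f) = U_basis g f"
  using assms
proof (induction f arbitrary: g rule: list_nonempty_induct)
  case (single a)
  then show ?case by (simp add: natural_rep_basis)
next
  case (cons a f)
  then obtain n where n: "length f = Suc n" by (cases f) auto
  have IH: "g \<in> U_gens r \<Longrightarrow> tensor_rep r (Suc n) g (basis_vec f) = U_basis g f" for g
    using cons n by auto
  show ?case
    using cons.prems
    by (cases g) (auto simp: node_of_U_gens n tensor_map_def natural_rep_basis IH tensor_vec_basis tensor_vec_scale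
        tensor_vec_zero cons_tensor_basis cons_tensor_scale power_int_add power_int_diff power_int_minus divide_inverse
        simp flip: lower_def upper_def)
qed

lemma tensor_rep_eq_U_act:
  assumes "g \<in> U_gens r" "v \<in> tensor_space r m" "m \<ge> 1"
  shows "tensor_rep r m g v = U_act g v"
proof (rule linear_map_eq_on[OF linear_tensor_rep linear_U_act])
  fix f assume "f \<in> Poly_Mapping.keys v"
  with assms have "length f = m" "f \<noteq> []" by (auto simp: tensor_space_eq tensor_index_def)
  then show "tensor_rep r m g (basis_vec f) = U_act g (basis_vec f)"
    using tensor_rep_basis[OF _ assms(1)] by (auto simp: U_act_basis)
qed

lemma foldr_tensor_rep:
  assumes "v \<in> tensor_space r m" "m \<ge> 1" "set w \<subseteq> U_gens r"
  shows "foldr (tensor_rep r m) w v = foldr U_act w v \<and> foldr U_act w v \<in> tensor_space r m"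
  using assms(3)
  by (induction w) (auto simp: assms tensor_rep_eq_U_act[OF _ _ assms(2)] U_act_tensor_space)

lemma left_action_tensor_rep:
  assumes "x \<in> carrier (free_algebra (U_gens r))" "v \<in> tensor_space r m" "m \<ge> 1"
  shows "left_action (tensor_rep r m) x v = left_action U_act x v"
    "left_action U_act x v \<in> tensor_space r m"
proof -
  have *: "set (letters w) \<subseteq> U_gens r" if "w \<in> Poly_Mapping.keys x" for w
    using assms(1) that by (simp add: free_algebra_def)
  show "left_action (tensor_rep r m) x v = left_action U_act x v"
    unfolding left_action_def lin_extend_def
    by (rule sum.cong) (use foldr_tensor_rep[OF assms(2,3) *] in auto)
  show "left_action U_act x v \<in> tensor_space r m"
    unfolding left_action_def
    by (rule tensor_space_lin_extend) (use foldr_tensor_rep[OF assms(2,3) *] in auto)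
qed

lemma fold_H_act:
  assumes "set w \<subseteq> {..<m}"
  shows "v \<in> tensor_space r m \<Longrightarrow> fold H_act w v \<in> tensor_space r m"
  using assms by (induction w arbitrary: v) (auto simp: H_act_tensor_space)

lemma right_action_tensor_space:
  assumes "x \<in> carrier (free_algebra {..<m})" "v \<in> tensor_space r m"
  shows "right_action H_act x v \<in> tensor_space r m"
  unfolding right_action_def
  by (rule tensor_space_lin_extend) (use assms in \<open>auto simp: free_algebra_def intro!: fold_H_act\<close>)

lemma index_set_nonzero: "0 \<notin> index_set r"
  by (auto simp: index_set_eq_lower dest: sym[of _ "lower _"])

lemma linear_map_eq_on_tensor_space:
  assumes "linear_map S" "linear_map T" "v \<in> tensor_space r m"
    "\<And>f. length f = m \<Longrightarrow> set f \<subseteq> range lower \<Longrightarrow> 0 \<notin> set f \<Longrightarrow> S (basis_vec f) = T (basis_vec f)"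
  shows "S v = T v"
proof (rule linear_map_eq_on[OF assms(1,2)])
  fix f assume "f \<in> Poly_Mapping.keys v"
  then have "length f = m" "set f \<subseteq> index_set r" using assms(3) by (auto simp: tensor_space_eq tensor_index_def)
  then show "S (basis_vec f) = T (basis_vec f)"
    using index_set_nonzero[of r] by (intro assms(4)) (auto simp: index_set_eq_lower)
qed

lemma linear_H_act_words:
  "linear_map (\<lambda>v. H_act i (H_act j v))" "linear_map (\<lambda>v. H_act i (H_act j (H_act k v)))"
  "linear_map (\<lambda>v. H_act i (H_act j (H_act k (H_act l v))))"
  by (simp_all add: linear_map_def H_act_add H_act_scale)

lemma H_act_diff: "H_act i (u - v) = H_act i u - H_act i v"
  using H_act_add[of i "u - v" v] by (simp add: algebra_simps)

text \<open>Unlike \<open>U_act_respects_rels\<close> this is restricted to the tensor space: the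
  Hecke relations were verified only for lists that are long enough and, where H_0 occurs, have no
  entry 0.\<close>

lemma H_act_respects_rels:
  assumes "(x, y) \<in> hecke_rels m" "v \<in> tensor_space r m"
  shows "right_action H_act x v = right_action H_act y v"
  using assms(1)
proof cases
  case (quadratic i)
  let ?c = "hecke_par i"
  have c: "?c \<noteq> 0" by (simp add: hecke_par_def)
  have "H_act i (H_act i v) = scale (inverse ?c - ?c) (H_act i v) + v"
    by (rule linear_map_eq_on_tensor_space[where v = v])
      (use quadratic assms(2) in \<open>auto intro!: linear_intros simp: H_act_quadratic_basis linear_H_act_words\<close>)
  with c show ?thesis
    unfolding quadratic(1,2)
    by (intro poly_mapping_eqI)
      (simp add: right_action_H_mult action_diff action_add H_act_distribs H_act_diff lookup_add lookup_minus,
       simp add: algebra_simps)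
next
  case (braid i)
  then obtain k where k: "i = Suc k" by (cases i) auto
  have "H_act (Suc k) (H_act (Suc (Suc k)) (H_act (Suc k) v)) =
      H_act (Suc (Suc k)) (H_act (Suc k) (H_act (Suc (Suc k)) v))"
    by (rule linear_map_eq_on_tensor_space[where v = v])
      (use braid k assms(2) in \<open>auto simp: H_act_braid_basis linear_H_act_words\<close>)
  then show ?thesis using braid k by (simp add: right_action_H_mult)
next
  case braid0
  have "H_act 0 (H_act (Suc 0) (H_act 0 (H_act (Suc 0) v))) =
    H_act (Suc 0) (H_act 0 (H_act (Suc 0) (H_act 0 v)))"
    by (rule linear_map_eq_on_tensor_space[where v = v])
      (use braid0 assms(2) in \<open>auto intro: H_act_braid0_basis simp: linear_H_act_words\<close>)
  then show ?thesis using braid0 by (simp add: right_action_H_mult)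
next
  case (far i j)
  have "H_act i (H_act j v) = H_act j (H_act i v)"
  proof (rule linear_map_eq_on_tensor_space[where v = v])
    fix f :: "rat list" assume "length f = m"
    then show "H_act i (H_act j (basis_vec f)) = H_act j (H_act i (basis_vec f))"
      using far H_act_far[of i j f] H_act_far[of j i f] by (cases "i < j") auto
  qed (use assms(2) in \<open>auto simp: linear_H_act_words\<close>)
  then show ?thesis using far by (simp add: right_action_H_mult)
qed

lemma U_act_H_act:
  assumes "i \<ge> 1" "i < m" "v \<in> tensor_space r m"
  shows "U_act g (H_act i v) = H_act i (U_act g v)"
proof (rule linear_map_eq_on_tensor_space[where v = v])
  obtain k where k: "i = Suc k" using assms by (cases i) auto
  fix f :: "rat list" assume "length f = m" "set f \<subseteq> range lower"
  then show "U_act g (H_act i (basis_vec f)) = H_act i (U_act g (basis_vec f))"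
    using assms U_act_H_act_basis[of k f g] k by auto
qed (use assms in \<open>auto simp: linear_map_def H_act_distribs\<close>)

lemma left_action_H_act:
  assumes "i \<ge> 1" "i < m" "v \<in> tensor_space r m" "x \<in> carrier (free_algebra (U_gens r))"
  shows "left_action U_act x (H_act i v) = H_act i (left_action U_act x v)"
proof -
  have "foldr U_act w (H_act i v) = H_act i (foldr U_act w v)" if "set w \<subseteq> U_gens r" for w
    using that
  proof (induction w)
    case (Cons g w)
    have "foldr U_act w v \<in> tensor_space r m" 
      using foldr_tensor_rep[OF assms(3)] assms Cons.prems by auto
    then show ?case using Cons assms by (simp add: U_act_H_act)
  qed simp
  then show ?thesis
    using assms(4)
    by (auto simp: left_action_def lin_extend_def linear_map_sum[OF linear_H_act] H_act_scale free_algebra_def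
        intro!: sum.cong)
qed

text \<open>The coproduct of each generator lies in the coideal tensored with U; e_i, for example,
  goes to e_i \<otimes> K_i^-1 + 1 \<otimes> E_i + k_i^-1 \<otimes> F_{-i} K_i^-1. Since H_0 sees
  only the first factor, the question is one about V. There k_i, e_i and f_i are compatible with a
  \<mapsto> -a and with the sign of a. The element t acts on the span of u_{1/2} and u_{-1/2} as H_0
  plus the scalar q(p - p^-1)/(q - q^-1), and as a scalar on the other basis vectors; this is the
  origin of its coefficient.\<close>

lemma left_action_Ui_gens_H_act_0:
  assumes "x \<in> Ui_gens r" "v \<in> tensor_space r m" "m \<ge> 1"
  shows "left_action U_act x (H_act 0 v) = H_act 0 (left_action U_act x v)"
proof (rule linear_map_eq_on_tensor_space[where v = v])
  fix f :: "rat list" assume "length f = m" "set f \<subseteq> range lower"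
  with assms obtain j f' where f: "basis_vec f = cons_tensor (lower j) (basis_vec f')"
    by (cases f) (auto simp: cons_tensor_basis)
  show "left_action U_act x (H_act 0 (basis_vec f)) = H_act 0 (left_action U_act x (basis_vec f))"
  proof -
    have "qq * qq \<noteq> 1" using qq_diff_nonzero by (auto simp: field_simps)
    then show ?thesis
      unfolding f using assms(1) qq_diff_nonzero
      by (auto simp: Ui_gens_def left_action_U_mult action_add H_act_cons_0 H_act_distribs U_act_cons
       uminus_lower upper_eq_lower alpha_lower_upper intro!: poly_mapping_eqI simp: lookup_add)
      (simp_all add: divide_simps, simp_all add: algebra_simps)
  qed
qed (auto intro: assms linear_map_compose linear_H_act linear_left_action_U)

section \<open>Representations of presented algebras\<close>

lemma free_algebra_simps [simp]:
  "mult (free_algebra X) = (*)" "one (free_algebra X) = 1" "zero (free_algebra X) = 0" "add (free_algebra X) = (+)"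
  by (simp_all add: free_algebra_def)

lemma free_algebra_carrier:
  "x \<in> carrier (free_algebra X) \<longleftrightarrow> (\<forall>w\<in>Poly_Mapping.keys x. set (letters w) \<subseteq> X)"
  by (simp add: free_algebra_def)

lemma free_algebra_closed:
  "x \<in> carrier (free_algebra X) \<Longrightarrow> y \<in> carrier (free_algebra X) \<Longrightarrow> x + y \<in> carrier (free_algebra X)"
  "x \<in> carrier (free_algebra X) \<Longrightarrow> y \<in> carrier (free_algebra X) \<Longrightarrow> x * y \<in> carrier (free_algebra X)"
  "x \<in> carrier (free_algebra X) \<Longrightarrow> - x \<in> carrier (free_algebra X)"
  "x \<in> carrier (free_algebra X) \<Longrightarrow> y \<in> carrier (free_algebra X) \<Longrightarrow> x - y \<in> carrier (free_algebra X)"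
  "1 \<in> carrier (free_algebra X)" "0 \<in> carrier (free_algebra X)"
  "scalar c \<in> carrier (free_algebra X)"
  "g \<in> X \<Longrightarrow> gen g \<in> carrier (free_algebra X)"
proof -
  show plus: "x + y \<in> carrier (free_algebra X)"
    if "x \<in> carrier (free_algebra X)" "y \<in> carrier (free_algebra X)" for x y
    using that keys_add[of x y] by (auto simp: free_algebra_carrier)
  show minus: "- x \<in> carrier (free_algebra X)" if "x \<in> carrier (free_algebra X)" for x
    using that by (auto simp: free_algebra_carrier in_keys_iff)
  show "x - y \<in> carrier (free_algebra X)"
    if "x \<in> carrier (free_algebra X)" "y \<in> carrier (free_algebra X)"
    using plus[OF that(1) minus[OF that(2)]] by simp
  show "x * y \<in> carrier (free_algebra X)"
    if "x \<in> carrier (free_algebra X)" "y \<in> carrier (free_algebra X)"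
    using that keys_mult[of x y] by (fastforce simp: free_algebra_carrier plus_free_monoid_def)
  show "scalar c \<in> carrier (free_algebra X)"
    by (auto simp: free_algebra_carrier scalar_def zero_free_monoid_def in_keys_iff lookup_single when_def split: if_splits)
qed (auto simp: free_algebra_carrier zero_free_monoid_def gen_def)

lemma ring_free_algebra: "ring (free_algebra X)"
proof (rule ringI)
  show "abelian_group (free_algebra X)"
    by (rule abelian_groupI)
      (auto intro: free_algebra_closed simp: ac_simps intro!: bexI[of _ "- x" for x])
  show "Group.monoid (free_algebra X)"
    by (rule monoidI) (auto intro: free_algebra_closed simp: mult.assoc)
qed (auto simp: algebra_simps)

lemma free_algebra_minus:
  "x \<in> carrier (free_algebra X) \<Longrightarrow> \<ominus>\<^bsub>free_algebra X\<^esub> x = - x"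
proof -
  interpret ring "free_algebra X" by (rule ring_free_algebra)
  assume x: "x \<in> carrier (free_algebra X)"
  then show ?thesis by (intro minus_equality) (auto intro: free_algebra_closed)
qed

text \<open>The kernel of h is an ideal that contains x - y for each relation, hence the whole
  relation ideal. So h has a single value on each coset, and \<open>the_elem\<close> picks this
  value.\<close>

lemma
  fixes S :: "('a, 'b) ring_scheme" and h :: "'g free_alg \<Rightarrow> 'a"
  assumes "ring S" and h: "h \<in> ring_hom (free_algebra X) S"
    and R: "\<And>x y. (x, y) \<in> R \<Longrightarrow>
      x \<in> carrier (free_algebra X) \<and> y \<in> carrier (free_algebra X) \<and> h x = h y"
  shows the_elem_presented_class: "x \<in> carrier (free_algebra X) \<Longrightarrow> the_elem (h ` presented_class X R x) = h x"
    and the_elem_presented_hom: "(\<lambda>u. the_elem (h ` u)) \<in> ring_hom (presented_algebra X R) S"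
proof -
  interpret F: ring "free_algebra X" by (rule ring_free_algebra)
  interpret S: ring S by fact
  interpret hom: ring_hom_ring "free_algebra X" S h
    by (rule ring_hom_ringI2) (use h in \<open>auto intro: F.ring_axioms S.ring_axioms\<close>)
  let ?I = "relation_ideal X R"
  have carr: "{x - y | x y. (x, y) \<in> R} \<subseteq> carrier (free_algebra X)"
    using R by (auto intro: free_algebra_closed)
  have ideal: "ideal ?I (free_algebra X)"
    unfolding relation_ideal_def by (rule F.genideal_ideal[OF carr])
  interpret I: ideal ?I "free_algebra X" by (rule ideal)
  have hdiff: "h (x - y) = \<zero>\<^bsub>S\<^esub>" if "x \<in> carrier (free_algebra X)" "y \<in> carrier (free_algebra X)" "h x = h y" for x y
  proof -
    have c: "x - y \<in> carrier (free_algebra X)" by (rule free_algebra_closed(4)[OF that(1,2)])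
    have "h (x - y) \<oplus>\<^bsub>S\<^esub> h y = h y"
      using hom.hom_add[OF c that(2)] unfolding free_algebra_simps diff_add_cancel that(3) by (rule sym)
    then show ?thesis
      using S.add.r_cancel_one[OF hom.hom_closed[OF that(2)] hom.hom_closed[OF c]] by blast
  qed
  have "{x - y | x y. (x, y) \<in> R} \<subseteq> a_kernel (free_algebra X) S h"
  proof clarify
    fix x y assume "(x, y) \<in> R"
    then have "x \<in> carrier (free_algebra X)" "y \<in> carrier (free_algebra X)" "h x = h y" using R by blast+
    then show "x - y \<in> a_kernel (free_algebra X) S h"
      unfolding a_kernel_def' mem_Collect_eq by (intro conjI free_algebra_closed(4) hdiff)
  qed
  then have ker: "?I \<subseteq> a_kernel (free_algebra X) S h"
    unfolding relation_ideal_def by (intro F.genideal_minimal hom.kernel_is_ideal)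
  have img: "h ` (?I +>\<^bsub>free_algebra X\<^esub> x) = {h x}" if x: "x \<in> carrier (free_algebra X)" for x
  proof -
    have "h z = h x" if z: "z \<in> ?I +>\<^bsub>free_algebra X\<^esub> x" for z
    proof -
      obtain i where i: "i \<in> ?I" "z = i + x" using z by (auto simp: a_r_coset_def')
      then have "h i = \<zero>\<^bsub>S\<^esub>" "i \<in> carrier (free_algebra X)" using ker unfolding a_kernel_def' by blast+
      then show ?thesis using hom.hom_add[OF _ x, of i] hom.hom_closed[OF x] unfolding i(2) by simp
    qed
    moreover have "x \<in> ?I +>\<^bsub>free_algebra X\<^esub> x" using I.a_rcos_self[OF x] .
    ultimately show ?thesis by blast
  qed
  then show elem: "the_elem (h ` presented_class X R x) = h x" if "x \<in> carrier (free_algebra X)" for x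
    using that by (simp add: presented_class_def)
  show "(\<lambda>u. the_elem (h ` u)) \<in> ring_hom (presented_algebra X R) S"
  proof (rule ring_hom_memI)
    let ?F = "free_algebra X"
    have Q: "\<exists>x\<in>carrier ?F. u = ?I +>\<^bsub>?F\<^esub> x" if "u \<in> carrier (presented_algebra X R)" for u
      using that by (auto simp: presented_algebra_def FactRing_def A_RCOSETS_def')
    fix u assume u: "u \<in> carrier (presented_algebra X R)"
    then obtain x where x: "x \<in> carrier ?F" "u = ?I +>\<^bsub>?F\<^esub> x" using Q by blast
    show "the_elem (h ` u) \<in> carrier S" unfolding x(2) img[OF x(1)] using x(1) by simp
    fix v assume v: "v \<in> carrier (presented_algebra X R)"
    then obtain y where y: "y \<in> carrier ?F" "v = ?I +>\<^bsub>?F\<^esub> y" using Q by blast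
    have "u \<otimes>\<^bsub>presented_algebra X R\<^esub> v = ?I +>\<^bsub>?F\<^esub> (x \<otimes>\<^bsub>?F\<^esub> y)"
      unfolding x(2) y(2) presented_algebra_def FactRing_def by (simp add: I.rcoset_mult_add x(1) y(1) del: free_algebra_simps)
    then show "the_elem (h ` (u \<otimes>\<^bsub>presented_algebra X R\<^esub> v)) = the_elem (h ` u) \<otimes>\<^bsub>S\<^esub> the_elem (h ` v)"
      using img[OF F.m_closed[OF x(1) y(1)]] hom.hom_mult[OF x(1) y(1)] by (simp only: x(2) y(2) img x(1) y(1) the_elem_eq)
    have "u \<oplus>\<^bsub>presented_algebra X R\<^esub> v = ?I +>\<^bsub>?F\<^esub> (x \<oplus>\<^bsub>?F\<^esub> y)"
      unfolding x(2) y(2) presented_algebra_def FactRing_def by (simp add: I.a_rcos_sum x(1) y(1) del: free_algebra_simps)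
    then show "the_elem (h ` (u \<oplus>\<^bsub>presented_algebra X R\<^esub> v)) = the_elem (h ` u) \<oplus>\<^bsub>S\<^esub> the_elem (h ` v)"
      using img[OF F.a_closed[OF x(1) y(1)]] hom.hom_add[OF x(1) y(1)] by (simp only: x(2) y(2) img x(1) y(1) the_elem_eq)
  next
    have "\<one>\<^bsub>presented_algebra X R\<^esub> = ?I +>\<^bsub>free_algebra X\<^esub> \<one>\<^bsub>free_algebra X\<^esub>"
      by (simp add: presented_algebra_def FactRing_def)
    then show "the_elem (h ` \<one>\<^bsub>presented_algebra X R\<^esub>) = \<one>\<^bsub>S\<^esub>"
      using img[OF F.one_closed] hom.hom_one by (simp only: the_elem_eq)
  qed
qed

lemma End_ring_simps:
  "\<phi> \<in> carrier (End_ring r m) \<longleftrightarrow> \<phi> \<in> tensor_space r m \<rightarrow>\<^sub>E tensor_space r m \<and>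
        (\<forall>v\<in>tensor_space r m. \<forall>w\<in>tensor_space r m. \<phi> (v + w) = \<phi> v + \<phi> w) \<and>
        (\<forall>c. \<forall>v\<in>tensor_space r m. \<phi> (scale c v) = scale c (\<phi> v))"
  "mult (End_ring r m) = compose (tensor_space r m)"
  "one (End_ring r m) = (\<lambda>v\<in>tensor_space r m. v)"
  "zero (End_ring r m) = (\<lambda>v\<in>tensor_space r m. 0)"
  "add (End_ring r m) = (\<lambda>\<phi> \<psi>. \<lambda>v\<in>tensor_space r m. \<phi> v + \<psi> v)"
  by (simp_all add: End_ring_def)

lemma restrict_in_End_ring:
  assumes "linear_map T" "\<And>v. v \<in> tensor_space r m \<Longrightarrow> T v \<in> tensor_space r m"
  shows "restrict T (tensor_space r m) \<in> carrier (End_ring r m)"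
  using assms by (auto simp: End_ring_simps linear_map_def tensor_space_add tensor_space_scale)

lemma ring_End_ring: "ring (End_ring r m)"
proof (rule ringI)
  let ?M = "tensor_space r m"
  have closed: "\<phi> v \<in> ?M" if "\<phi> \<in> carrier (End_ring r m)" "v \<in> ?M" for \<phi> v
    using that by (auto simp: End_ring_simps)
  have ext: "\<phi> = \<psi>" if "\<phi> \<in> extensional ?M" "\<psi> \<in> extensional ?M" "\<And>v. v \<in> ?M \<Longrightarrow> \<phi> v = \<psi> v" for \<phi> \<psi>
    using that by (rule extensionalityI)
  have ext1: "\<phi> \<in> extensional ?M" if "\<phi> \<in> carrier (End_ring r m)" for \<phi>
    using that by (auto simp: End_ring_simps PiE_def)
  show "abelian_group (End_ring r m)"
  proof (rule abelian_groupI)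
    fix \<phi> \<psi> assume \<phi>: "\<phi> \<in> carrier (End_ring r m)" and \<psi>: "\<psi> \<in> carrier (End_ring r m)"
    show "\<phi> \<oplus>\<^bsub>End_ring r m\<^esub> \<psi> \<in> carrier (End_ring r m)"
      using \<phi> \<psi> by (auto simp: End_ring_simps PiE_iff tensor_space_add tensor_space_scale scale_add add_ac)
    show "\<phi> \<oplus>\<^bsub>End_ring r m\<^esub> \<psi> = \<psi> \<oplus>\<^bsub>End_ring r m\<^esub> \<phi>"
      by (simp add: End_ring_simps add.commute)
    show "\<zero>\<^bsub>End_ring r m\<^esub> \<oplus>\<^bsub>End_ring r m\<^esub> \<phi> = \<phi>"
      by (rule ext) (use ext1[OF \<phi>] in \<open>auto simp: End_ring_simps\<close>)
    show "\<exists>\<psi>\<in>carrier (End_ring r m). \<psi> \<oplus>\<^bsub>End_ring r m\<^esub> \<phi> = \<zero>\<^bsub>End_ring r m\<^esub>"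
      by (rule bexI[of _ "\<lambda>v\<in>?M. - \<phi> v"])
        (use \<phi> in \<open>auto simp: End_ring_simps PiE_iff tensor_space_add tensor_space_scale tensor_space_uminus scale_minus\<close>)
    fix \<chi>
    show "\<phi> \<oplus>\<^bsub>End_ring r m\<^esub> \<psi> \<oplus>\<^bsub>End_ring r m\<^esub> \<chi> = \<phi> \<oplus>\<^bsub>End_ring r m\<^esub> (\<psi> \<oplus>\<^bsub>End_ring r m\<^esub> \<chi>)"
      by (auto simp: End_ring_simps add.assoc)
  qed (auto simp: End_ring_simps tensor_space_zero tensor_space_add tensor_space_scale)
  show "Group.monoid (End_ring r m)"
    by (rule monoidI)
      (auto simp: End_ring_simps tensor_space_add tensor_space_scale compose_def PiE_iff extensional_restrict
        intro!: ext)
qed (auto simp: End_ring_simps compose_def PiE_iff tensor_space_add intro!: ext)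

section \<open>The two actions as ring homomorphisms\<close>

lemma U_rels_carrier:
  assumes "(x, y) \<in> U_rels r"
  shows "x \<in> carrier (free_algebra (U_gens r)) \<and> y \<in> carrier (free_algebra (U_gens r))"
  using assms by cases (auto intro!: free_algebra_closed simp: node_of_U_gens)

lemma hecke_rels_carrier:
  assumes "(x, y) \<in> hecke_rels m"
  shows "x \<in> carrier (free_algebra {..<m}) \<and> y \<in> carrier (free_algebra {..<m})"
  using assms by cases (auto intro!: free_algebra_closed)

definition U_op :: "nat \<Rightarrow> nat \<Rightarrow> qgen free_alg \<Rightarrow> tensor \<Rightarrow> tensor" where
  "U_op r m x = restrict (left_action U_act x) (tensor_space r m)"

definition H_op :: "nat \<Rightarrow> nat \<Rightarrow> nat free_alg \<Rightarrow> tensor \<Rightarrow> tensor" where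
  "H_op r m x = restrict (right_action H_act x) (tensor_space r m)"

lemma restrict_tensor_rep:
  "x \<in> carrier (free_algebra (U_gens r)) \<Longrightarrow> m \<ge> 1 \<Longrightarrow>
    restrict (left_action (tensor_rep r m) x) (tensor_space r m) = U_op r m x"
  unfolding U_op_def by (rule restrict_ext) (rule left_action_tensor_rep)

lemma U_op_hom:
  assumes "m \<ge> 1"
  shows "U_op r m \<in> ring_hom (free_algebra (U_gens r)) (End_ring r m)"
proof (rule ring_hom_memI)
  fix x assume x: "x \<in> carrier (free_algebra (U_gens r))"
  show "U_op r m x \<in> carrier (End_ring r m)"
    unfolding U_op_def
    by (rule restrict_in_End_ring) (auto intro: linear_left_action_U left_action_tensor_rep[OF x _ assms])
  fix y assume y: "y \<in> carrier (free_algebra (U_gens r))"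
  show "U_op r m (x \<otimes>\<^bsub>free_algebra (U_gens r)\<^esub> y) = U_op r m x \<otimes>\<^bsub>End_ring r m\<^esub> U_op r m y"
    by (auto simp: U_op_def End_ring_simps compose_def left_action_U_mult left_action_tensor_rep[OF y _ assms])
  show "U_op r m (x \<oplus>\<^bsub>free_algebra (U_gens r)\<^esub> y) = U_op r m x \<oplus>\<^bsub>End_ring r m\<^esub> U_op r m y"
    by (auto simp: U_op_def End_ring_simps action_add)
qed (auto simp: U_op_def End_ring_simps)

lemma ring_opposite_ring: "ring R \<Longrightarrow> ring (opposite_ring R)"
proof -
  assume "ring R"
  then interpret ring R .
  have "abelian_group (opposite_ring R)"
    by (rule abelian_groupI) (auto simp: opposite_ring_def a_ac intro: bexI[of _ "a_inv R x" for x] l_neg)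
  then show ?thesis
    by (rule ringI, intro monoidI) (auto simp: opposite_ring_def m_assoc l_distr r_distr)
qed

lemma H_op_hom: "H_op r m \<in> ring_hom (free_algebra {..<m}) (opposite_ring (End_ring r m))"
proof (rule ring_hom_memI)
  fix x assume x: "x \<in> carrier (free_algebra {..<m})"
  have "H_op r m x \<in> carrier (End_ring r m)"
    unfolding H_op_def
    by (rule restrict_in_End_ring) (auto intro: linear_right_action_H right_action_tensor_space[OF x])
  then show "H_op r m x \<in> carrier (opposite_ring (End_ring r m))"
    by (simp add: opposite_ring_def)
  fix y assume y: "y \<in> carrier (free_algebra {..<m})"
  show "H_op r m (x \<otimes>\<^bsub>free_algebra {..<m}\<^esub> y) = H_op r m x \<otimes>\<^bsub>opposite_ring (End_ring r m)\<^esub> H_op r m y"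
    by (auto simp: H_op_def opposite_ring_def End_ring_simps compose_def right_action_H_mult
        right_action_tensor_space[OF x])
  show "H_op r m (x \<oplus>\<^bsub>free_algebra {..<m}\<^esub> y) = H_op r m x \<oplus>\<^bsub>opposite_ring (End_ring r m)\<^esub> H_op r m y"
    by (auto simp: H_op_def opposite_ring_def End_ring_simps action_add)
qed (auto simp: H_op_def opposite_ring_def End_ring_simps)

lemma U_op_rels:
  "(x, y) \<in> U_rels r \<Longrightarrow> U_op r m x = U_op r m y"
  by (auto simp: U_op_def U_act_respects_rels)

lemma H_op_rels:
  "(x, y) \<in> hecke_rels m \<Longrightarrow> H_op r m x = H_op r m y"
  unfolding H_op_def by (rule restrict_ext) (rule H_act_respects_rels)

text \<open>For transporting the homomorphism property from \<open>U_op\<close> to the prescribed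
  action: their agreement is known on the carrier only, as \<open>tensor_rep\<close> and
  \<open>U_act\<close> may differ on generators outside \<open>U_gens\<close>.\<close>

lemma ring_hom_cong:
  assumes "ring R" "h \<in> ring_hom R S" "\<And>x. x \<in> carrier R \<Longrightarrow> h' x = h x"
  shows "h' \<in> ring_hom R S"
proof -
  interpret ring R by fact
  show ?thesis
    by (rule ring_hom_memI)
      (use assms(2) in \<open>auto simp: assms(3) ring_hom_closed ring_hom_mult ring_hom_add ring_hom_one\<close>)
qed

lemma restrict_tensor_rep_hom:
  assumes "m \<ge> 1"
  shows "(\<lambda>x. restrict (left_action (tensor_rep r m) x) (tensor_space r m))
    \<in> ring_hom (free_algebra (U_gens r)) (End_ring r m)"
  by (rule ring_hom_cong[OF ring_free_algebra U_op_hom[OF assms]]) (rule restrict_tensor_rep[OF _ assms])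

lemma \<Phi>_class:
  assumes "m \<ge> 1" "x \<in> carrier (free_algebra (U_gens r))"
  shows "\<Phi> r m (U_class r x) = U_op r m x"
  unfolding \<Phi>_def U_class_def
  by (subst the_elem_presented_class[OF ring_End_ring[of r m] restrict_tensor_rep_hom[OF assms(1)]])
    (use assms U_rels_carrier in \<open>auto simp: restrict_tensor_rep U_op_rels\<close>)

lemma \<Phi>_hom_U:
  assumes "m \<ge> 1"
  shows "\<Phi> r m \<in> ring_hom (U_alg r) (End_ring r m)"
proof -
  have "(\<lambda>u. the_elem ((\<lambda>x. restrict (left_action (tensor_rep r m) x) (tensor_space r m)) ` u))
      \<in> ring_hom (U_alg r) (End_ring r m)"
    unfolding U_alg_def
    by (rule the_elem_presented_hom[OF ring_End_ring[of r m] restrict_tensor_rep_hom[OF assms(1)]])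
      (use assms U_rels_carrier in \<open>auto simp: restrict_tensor_rep U_op_rels\<close>)
  then show ?thesis by (simp add: \<Phi>_def[abs_def])
qed

abbreviation hecke_class :: "nat \<Rightarrow> nat free_alg \<Rightarrow> nat free_alg set" where
  "hecke_class m \<equiv> presented_class {..<m} (hecke_rels m)"

lemma \<Psi>_eq: "\<Psi> r m = (\<lambda>h. the_elem (H_op r m ` h))"
  by (intro HOL.ext) (simp add: \<Psi>_def H_op_def H_act_def[abs_def])

lemma \<Psi>_class: "x \<in> carrier (free_algebra {..<m}) \<Longrightarrow> \<Psi> r m (hecke_class m x) = H_op r m x"
  unfolding \<Psi>_eq
  by (rule the_elem_presented_class[OF ring_opposite_ring[OF ring_End_ring] H_op_hom])
    (auto simp: hecke_rels_carrier H_op_rels)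

lemma \<Psi>_hom: "\<Psi> r m \<in> ring_hom (hecke_alg m) (opposite_ring (End_ring r m))"
  unfolding \<Psi>_eq hecke_alg_def
  by (rule the_elem_presented_hom[OF ring_opposite_ring[OF ring_End_ring] H_op_hom])
    (auto simp: hecke_rels_carrier H_op_rels)

lemma carrier_presented_algebra:
  "carrier (presented_algebra X R) = presented_class X R ` carrier (free_algebra X)"
  by (auto simp: presented_algebra_def presented_class_def FactRing_def A_RCOSETS_def')

lemma ideal_U: "ideal (relation_ideal (U_gens r) (U_rels r)) (free_algebra (U_gens r))"
  unfolding relation_ideal_def
  by (rule ring.genideal_ideal[OF ring_free_algebra])
    (auto intro!: free_algebra_closed dest: U_rels_carrier)

lemma ring_U_alg: "ring (U_alg r)"
  unfolding U_alg_def presented_algebra_def by (rule ideal.quotient_is_ring[OF ideal_U])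

lemma U_class_hom: "U_class r \<in> ring_hom (free_algebra (U_gens r)) (U_alg r)"
  unfolding U_alg_def presented_algebra_def U_class_def[abs_def] presented_class_def
  by (rule ideal.rcos_ring_hom[OF ideal_U])

lemma Ui_gens_carrier: "x \<in> Ui_gens r \<Longrightarrow> x \<in> carrier (free_algebra (U_gens r))"
  unfolding Ui_gens_def
  by (auto intro!: free_algebra_closed simp: node_of_U_gens node_set_def)

lemma Ui_generators_carrier: "U_class r ` (range scalar \<union> Ui_gens r) \<subseteq> carrier (U_alg r)"
  using Ui_gens_carrier[of _ r] ring_hom_closed[OF U_class_hom] free_algebra_closed(7) by blast

lemma carrier_Ui_alg: "carrier (Ui_alg r) = generate_ring (U_alg r) (U_class r ` (range scalar \<union> Ui_gens r))"
  by (simp add: Ui_alg_def)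

lemma Ui_alg_subset: "carrier (Ui_alg r) \<subseteq> carrier (U_alg r)"
  unfolding carrier_Ui_alg by (rule ring.generate_ring_incl[OF ring_U_alg Ui_generators_carrier])

lemma \<Phi>_hom: "m \<ge> 1 \<Longrightarrow> \<Phi> r m \<in> ring_hom (Ui_alg r) (End_ring r m)"
  using \<Phi>_hom_U[of m r] subsetD[OF Ui_alg_subset[of r]]
  by (intro ring_hom_memI)
    (auto simp: Ui_alg_def dest: ring_hom_closed ring_hom_mult ring_hom_add ring_hom_one)

text \<open>Commutation with H_0 fails for general elements of U, for example E_0. It is therefore
  carried through the generation of the subring, as a property of some representative in the free
  algebra.\<close>

lemma Ui_alg_cases:
  assumes "u \<in> carrier (Ui_alg r)" "m \<ge> 1"
  obtains x where "x \<in> carrier (free_algebra (U_gens r))" "u = U_class r x"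
    "\<And>i v. i < m \<Longrightarrow> v \<in> tensor_space r m \<Longrightarrow>
      left_action U_act x (H_act i v) = H_act i (left_action U_act x v)"
proof -
  let ?F = "free_algebra (U_gens r)"
  let ?C = "\<lambda>x. \<forall>i<m. \<forall>v\<in>tensor_space r m. left_action U_act x (H_act i v) = H_act i (left_action U_act x v)"
  interpret hom: ring_hom_ring ?F "U_alg r" "U_class r"
    by (rule ring_hom_ringI2) (auto intro: ring_free_algebra ring_U_alg U_class_hom)
  have "\<exists>x\<in>carrier ?F. u = U_class r x \<and> ?C x"
    using assms(1) unfolding carrier_Ui_alg
  proof (induction rule: generate_ring.induct)
    case one
    show ?case by (rule bexI[of _ 1]) (use hom.hom_one in \<open>auto intro: free_algebra_closed\<close>)
  next
    case (incl h)
    then obtain x where x: "h = U_class r x" "x \<in> range scalar \<union> Ui_gens r" by auto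
    have "?C x"
    proof (intro allI ballI impI)
      fix i v assume "i < m" "v \<in> tensor_space r m"
      then show "left_action U_act x (H_act i v) = H_act i (left_action U_act x v)"
        using x(2) left_action_Ui_gens_H_act_0[of x r v m] left_action_H_act[of i m v r x] assms(2)
          Ui_gens_carrier[of x r]
        by (cases "i = 0") (auto simp: H_act_scale)
    qed
    moreover have "x \<in> carrier ?F" using x Ui_gens_carrier free_algebra_closed(7) by auto
    ultimately show ?case using x by auto
  next
    case (a_inv h)
    then obtain x where x: "x \<in> carrier ?F" "h = U_class r x" "?C x" by auto
    have "left_action U_act (- x) v = - left_action U_act x v" for v
      using action_diff(1)[of U_act 0 x v] by simp
    moreover have "H_act i (- v) = - H_act i v" for i v
      using H_act_diff[of i 0 v] by simp
    ultimately have "?C (- x)" using x(3) by simp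
    moreover have "\<ominus>\<^bsub>U_alg r\<^esub> h = U_class r (- x)"
      using hom.hom_a_inv[OF x(1)] x by (simp add: free_algebra_minus)
    ultimately show ?case using x(1) free_algebra_closed(3) by blast
  next
    case (eng_add h1 h2)
    then obtain x y where x: "x \<in> carrier ?F" "h1 = U_class r x" "?C x"
      and y: "y \<in> carrier ?F" "h2 = U_class r y" "?C y" by auto
    have "?C (x + y)" using x y by (simp add: action_add H_act_add)
    moreover have "h1 \<oplus>\<^bsub>U_alg r\<^esub> h2 = U_class r (x + y)" using hom.hom_add[of x y] x y by simp
    ultimately show ?case using x(1) y(1) free_algebra_closed(1) by blast
  next
    case (eng_mult h1 h2)
    then obtain x y where x: "x \<in> carrier ?F" "h1 = U_class r x" "?C x"
      and y: "y \<in> carrier ?F" "h2 = U_class r y" "?C y" by auto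
    have "?C (x * y)" using x y left_action_tensor_rep(2)[OF y(1) _ assms(2)]
      by (simp add: left_action_U_mult)
    moreover have "h1 \<otimes>\<^bsub>U_alg r\<^esub> h2 = U_class r (x * y)" using hom.hom_mult[of x y] x y by simp
    ultimately show ?case using x(1) y(1) free_algebra_closed(2) by blast
  qed
  then show ?thesis using that by blast
qed

text \<open>T is assumed to be linear on the tensor space only, so that the lemma covers the
  operators from U as well as the extensional elements of \<open>End_ring\<close>.\<close>

lemma left_right_actions_commute:
  assumes x: "\<And>i v. i < m \<Longrightarrow> v \<in> tensor_space r m \<Longrightarrow> T (H_act i v) = H_act i (T v)"
    and T: "\<And>u v. u \<in> tensor_space r m \<Longrightarrow> v \<in> tensor_space r m \<Longrightarrow> T (u + v) = T u + T v"
      "\<And>c v. v \<in> tensor_space r m \<Longrightarrow> T (scale c v) = scale c (T v)"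
    and y: "y \<in> carrier (free_algebra {..<m})" and v: "v \<in> tensor_space r m"
  shows "T (right_action H_act y v) = right_action H_act y (T v)"
proof -
  let ?M = "tensor_space r m"
  have fold: "T (fold H_act w v) = fold H_act w (T v)" if "set w \<subseteq> {..<m}" "v \<in> ?M" for w v
    using that by (induction w arbitrary: v) (auto simp: x H_act_tensor_space)
  have w: "set (letters w) \<subseteq> {..<m}" if "w \<in> Poly_Mapping.keys y" for w
    using that y by (auto simp: free_algebra_carrier)
  have T0: "T 0 = 0" using T(2)[of 0 0] by (simp add: tensor_space_zero)
  have sum: "sum f A \<in> ?M \<and> T (sum f A) = (\<Sum>a\<in>A. T (f a))" if "finite A" "\<And>a. a \<in> A \<Longrightarrow> f a \<in> ?M"
    for f and A :: "nat free_monoid set"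
    using that by (induction A rule: finite_induct) (auto simp: T T0 tensor_space_zero tensor_space_add)
  have "T (right_action H_act y v) = (\<Sum>w\<in>Poly_Mapping.keys y. T (scale (Poly_Mapping.lookup y w) (fold H_act (letters w) v)))"
    unfolding right_action_def lin_extend_def
    by (rule sum[THEN conjunct2]) (auto intro!: tensor_space_scale fold_H_act[OF _ v] dest: w)
  also have "\<dots> = right_action H_act y (T v)"
    unfolding right_action_def lin_extend_def
    by (rule sum.cong) (use w v in \<open>auto simp: T fold fold_H_act\<close>)
  finally show ?thesis .
qed

lemma \<Phi>_\<Psi>_commute:
  assumes "m \<ge> 1" "u \<in> carrier (Ui_alg r)" "h \<in> carrier (hecke_alg m)" "v \<in> tensor_space r m"
  shows "\<Phi> r m u (\<Psi> r m h v) = \<Psi> r m h (\<Phi> r m u v)"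
proof -
  obtain x where x: "x \<in> carrier (free_algebra (U_gens r))" "u = U_class r x"
    "\<And>i v. i < m \<Longrightarrow> v \<in> tensor_space r m \<Longrightarrow>
      left_action U_act x (H_act i v) = H_act i (left_action U_act x v)"
    using Ui_alg_cases[OF assms(2,1)] by blast
  obtain y where y: "y \<in> carrier (free_algebra {..<m})" "h = hecke_class m y"
    using assms(3) by (auto simp: hecke_alg_def carrier_presented_algebra)
  have "left_action U_act x (right_action H_act y v) = right_action H_act y (left_action U_act x v)"
    by (rule left_right_actions_commute[OF x(3) _ _ y(1) assms(4)])
      (auto simp: linear_map_add[OF linear_left_action_U] linear_map_scale[OF linear_left_action_U])
  then show ?thesis
    using assms(4) x(1) y(1) left_action_tensor_rep(2)[OF x(1) assms(4,1)] right_action_tensor_space[OF y(1) assms(4)]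
    by (simp add: x(2) y(2) \<Phi>_class[OF assms(1)] \<Psi>_class U_op_def H_op_def)
qed

section \<open>Linear algebra on a finite set of coordinates\<close>

text \<open>Vectors are functions on a whole type; they are compared only at the coordinates in some
  finite set N.\<close>

definition fun_subspace :: "('n \<Rightarrow> 'k::field) set \<Rightarrow> bool" where
  "fun_subspace V \<longleftrightarrow> (\<lambda>_. 0) \<in> V \<and> (\<forall>u\<in>V. \<forall>v\<in>V. (\<lambda>n. u n + v n) \<in> V) \<and>
    (\<forall>c. \<forall>v\<in>V. (\<lambda>n. c * v n) \<in> V)"

lemma fun_subspace_add: "fun_subspace V \<Longrightarrow> u \<in> V \<Longrightarrow> v \<in> V \<Longrightarrow> (\<lambda>n. u n + v n) \<in> V"
  and fun_subspace_scale: "fun_subspace V \<Longrightarrow> v \<in> V \<Longrightarrow> (\<lambda>n. c * v n) \<in> V"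
  by (simp_all add: fun_subspace_def)

lemma fun_subspace_sum:
  assumes "fun_subspace V" "\<And>a. a \<in> A \<Longrightarrow> f a \<in> V"
  shows "(\<lambda>n. \<Sum>a\<in>A. c a * f a n) \<in> V"
  using assms(2)
proof (induction A rule: infinite_finite_induct)
  case (insert a A)
  then have "f a \<in> V" "(\<lambda>n. \<Sum>a\<in>A. c a * f a n) \<in> V" by auto
  then have "(\<lambda>n. c a * f a n + (\<Sum>a\<in>A. c a * f a n)) \<in> V"
    by (rule fun_subspace_add[OF assms(1) fun_subspace_scale[OF assms(1)]])
  with insert show ?case by simp
qed (use assms(1) in \<open>auto simp: fun_subspace_def\<close>)

lemma fun_subspace_lincomb2:
  assumes "fun_subspace V" "u \<in> V" "v \<in> V"
  shows "(\<lambda>n. a * u n + b * v n) \<in> V"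
  by (rule fun_subspace_add[OF assms(1) fun_subspace_scale[OF assms(1,2)] fun_subspace_scale[OF assms(1,3)]])

text \<open>D is a maximal set of coordinates with a dual family in V. A vector of V that vanishes
  on D but not at n could be scaled and subtracted from the family so as to add n to D. Hence a
  vector of V is determined on N by its coordinates in D.\<close>

lemma reduced_echelon_basis:
  fixes V :: "('n \<Rightarrow> 'k::field) set"
  assumes V: "fun_subspace V" and N: "finite N"
  obtains D b where "D \<subseteq> N"
    and "\<And>d. d \<in> D \<Longrightarrow> b d \<in> V"
    and "\<And>d d'. d \<in> D \<Longrightarrow> d' \<in> D \<Longrightarrow> b d d' = (if d = d' then 1 else 0)"
    and "\<And>v n. v \<in> V \<Longrightarrow> n \<in> N \<Longrightarrow> v n = (\<Sum>d\<in>D. v d * b d n)"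
proof -
  let ?good = "\<lambda>D. D \<subseteq> N \<and> (\<exists>b. \<forall>d\<in>D. b d \<in> V \<and> (\<forall>d'\<in>D. b d d' = (if d = d' then 1 else 0)))"
  define S where "S = {D. ?good D}"
  have "finite S"
    by (rule finite_subset[of _ "Pow N"]) (use N in \<open>auto simp: S_def\<close>)
  moreover have "S \<noteq> {}" by (auto simp: S_def)
  ultimately obtain D where "D \<in> S" "\<forall>E\<in>S. D \<subseteq> E \<longrightarrow> D = E"
    using finite_has_maximal by blast
  then have D: "?good D" and max: "\<And>E. ?good E \<Longrightarrow> D \<subseteq> E \<Longrightarrow> D = E"
    unfolding S_def by simp_all
  from D obtain b where b: "\<And>d. d \<in> D \<Longrightarrow> b d \<in> V"
    "\<And>d d'. d \<in> D \<Longrightarrow> d' \<in> D \<Longrightarrow> b d d' = (if d = d' then 1 else 0)" by blast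
  have finD: "finite D" using D N finite_subset by blast
  have zero: "v n = 0" if v: "v \<in> V" "\<And>d. d \<in> D \<Longrightarrow> v d = 0" and n: "n \<in> N" for v n
  proof (rule ccontr)
    assume nz: "v n \<noteq> 0"
    then have nD: "n \<notin> D" using v(2) by auto
    define w where "w = (\<lambda>m. inverse (v n) * v m)"
    have w: "w \<in> V" "w n = 1" "\<And>d. d \<in> D \<Longrightarrow> w d = 0"
      using V v nz by (auto simp: w_def fun_subspace_def)
    \<comment> \<open>One elimination step: w is the vector of the new pivot n, and coordinate n of
      the other vectors is cleared.\<close>
    define b' where "b' = (\<lambda>d. if d = n then w else (\<lambda>m. 1 * b d m + (- b d n) * w m))"
    have b'V: "b' d \<in> V" if "d \<in> insert n D" for d
    proof (cases "d = n")
      case False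
      then have "(\<lambda>m. 1 * b d m + (- b d n) * w m) \<in> V"
        by (intro fun_subspace_lincomb2[OF V]) (use that w b in auto)
      then show ?thesis using False by (simp add: b'_def)
    qed (use w in \<open>simp add: b'_def\<close>)
    have "?good (insert n D)"
      by (intro conjI exI[of _ b'] ballI b'V) (use D n w b nD in \<open>auto simp: b'_def\<close>)
    then show False using max[of "insert n D"] nD by blast
  qed
  have "v n = (\<Sum>d\<in>D. v d * b d n)" if v: "v \<in> V" and n: "n \<in> N" for v n
  proof -
    define w where "w = (\<lambda>n. 1 * v n + (- 1) * (\<Sum>d\<in>D. v d * b d n))"
    have wV: "w \<in> V"
      unfolding w_def by (intro fun_subspace_lincomb2 V v fun_subspace_sum b)
    have "(\<Sum>d\<in>D. v d * b d d') = v d'" if "d' \<in> D" for d'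
      using that finD by (simp add: b(2) if_distrib cong: if_cong sum.cong)
    then have "w d' = 0" if "d' \<in> D" for d'
      using that by (simp add: w_def)
    then have "w n = 0" by (rule zero[OF wV _ n])
    then show ?thesis by (simp add: w_def)
  qed
  then show ?thesis using D b by (intro that[of D b]) simp_all
qed

section \<open>Orthogonal projections and the double commutant\<close>

lemma sum_mult_lincomb:
  fixes a :: "'d \<Rightarrow> 'k::comm_ring"
  shows "(\<Sum>n\<in>N. y n * (\<Sum>d\<in>D. a d * b d n)) = (\<Sum>d\<in>D. a d * (\<Sum>n\<in>N. y n * b d n))"
  by (simp add: sum_distrib_left mult_ac) (rule sum.swap)

text \<open>Gram-Schmidt, one vector at a time. The projection is kept as a matrix p because
  \<open>bicommutant\<close> works with its blocks.\<close>

lemma orthogonal_projection_finite: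
  fixes b :: "'d \<Rightarrow> 'n \<Rightarrow> 'k::linordered_field"
  assumes N: "finite N" and "finite E"
  shows "\<exists>p. (\<forall>x. \<exists>a. \<forall>n\<in>N. (\<Sum>n'\<in>N. p n n' * x n') = (\<Sum>d\<in>E. a d * b d n)) \<and>
    (\<forall>x. \<forall>d\<in>E. (\<Sum>n\<in>N. (x n - (\<Sum>n'\<in>N. p n n' * x n')) * b d n) = 0)"
  using assms(2)
proof (induction E)
  case empty
  show ?case by (rule exI[of _ "\<lambda>_ _. 0"]) simp
next
  case (insert e E)
  then obtain p where p1: "\<And>x. \<exists>a. \<forall>n\<in>N. (\<Sum>n'\<in>N. p n n' * x n') = (\<Sum>d\<in>E. a d * b d n)"
    and p2: "\<And>x d. d \<in> E \<Longrightarrow> (\<Sum>n\<in>N. (x n - (\<Sum>n'\<in>N. p n n' * x n')) * b d n) = 0" by blast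
  define P where "P = (\<lambda>x n. \<Sum>n'\<in>N. p n n' * x n')"
  define c where "c = (\<lambda>n. b e n - P (b e) n)"
  \<comment> \<open>The squared norm of the part c of \<open>b e\<close> that is orthogonal to the
    earlier vectors. If it is 0, c vanishes on N since the field is ordered, and division by 0 makes
    the correction vanish as well.\<close>
  define \<gamma> where "\<gamma> = (\<Sum>n\<in>N. c n * c n)"
  define p' where "p' = (\<lambda>n n'. p n n' + c n * c n' / \<gamma>)"
  define s where "s = (\<lambda>x. (\<Sum>n\<in>N. x n * c n) / \<gamma>)"
  have p': "(\<Sum>n'\<in>N. p' n n' * x n') = P x n + s x * c n" for x n
    by (simp add: p'_def P_def s_def ring_distribs sum.distrib sum_distrib_right sum_distrib_left sum_divide_distrib mult_ac)
  have cE: "(\<Sum>n\<in>N. c n * b d n) = 0" if "d \<in> E" for d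
    using p2[OF that, of "b e"] by (simp add: c_def P_def)
  obtain ae where ae: "\<And>n. n \<in> N \<Longrightarrow> P (b e) n = (\<Sum>d\<in>E. ae d * b d n)"
    using p1[of "b e"] by (auto simp: P_def)
  have orthE: "(\<Sum>n\<in>N. (x n - (P x n + s x * c n)) * b d n) = 0" if "d \<in> E" for x d
  proof -
    have "(\<Sum>n\<in>N. (x n - (P x n + s x * c n)) * b d n) =
        (\<Sum>n\<in>N. (x n - P x n) * b d n) - s x * (\<Sum>n\<in>N. c n * b d n)"
      by (simp add: algebra_simps sum.distrib sum_subtractf sum_distrib_left)
    then show ?thesis using p2[OF that, of x] cE[OF that] by (simp add: P_def)
  qed
  have orthspan: "(\<Sum>n\<in>N. y n * (\<Sum>d\<in>E. a d * b d n)) = 0"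
    if "\<And>d. d \<in> E \<Longrightarrow> (\<Sum>n\<in>N. y n * b d n) = 0" for y and a :: "'d \<Rightarrow> 'k"
    using that by (simp add: sum_mult_lincomb)
  show ?case
  proof (intro exI[of _ p'] conjI allI ballI, unfold p')
    fix x
    obtain a where a: "\<And>n. n \<in> N \<Longrightarrow> P x n = (\<Sum>d\<in>E. a d * b d n)"
      using p1[of x] by (auto simp: P_def)
    have "P x n + s x * c n = (\<Sum>d\<in>insert e E. (if d = e then s x else a d - s x * ae d) * b d n)" if "n \<in> N" for n
    proof -
      have "(\<Sum>d\<in>E. (if d = e then s x else a d - s x * ae d) * b d n) = (\<Sum>d\<in>E. (a d - s x * ae d) * b d n)"
        by (rule sum.cong) (use insert in auto)
      then show ?thesis
        using insert that by (simp add: a c_def ae ring_distribs sum_subtractf sum_distrib_left mult_ac)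
    qed
    then show "\<exists>a. \<forall>n\<in>N. P x n + s x * c n = (\<Sum>d\<in>insert e E. a d * b d n)"
      by (intro exI[of _ "\<lambda>d. if d = e then s x else a d - s x * ae d"] ballI)
    fix d assume d: "d \<in> insert e E"
    show "(\<Sum>n\<in>N. (x n - (P x n + s x * c n)) * b d n) = 0"
    proof (cases "d = e")
      case de: True
      have be: "b e n = c n + (\<Sum>d\<in>E. ae d * b d n)" if "n \<in> N" for n
        using ae[OF that] by (simp add: c_def)
      have "(\<Sum>n\<in>N. (x n - (P x n + s x * c n)) * b e n) =
          (\<Sum>n\<in>N. (x n - (P x n + s x * c n)) * c n) +
          (\<Sum>n\<in>N. (x n - (P x n + s x * c n)) * (\<Sum>d\<in>E. ae d * b d n))"
        by (simp add: be ring_distribs sum.distrib)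
      also have "\<dots> = (\<Sum>n\<in>N. (x n - (P x n + s x * c n)) * c n)"
        using orthspan[of "\<lambda>n. x n - (P x n + s x * c n)", OF orthE] by simp
      also have "\<dots> = (\<Sum>n\<in>N. x n * c n) - (\<Sum>n\<in>N. c n * P x n) - s x * \<gamma>"
        by (simp add: \<gamma>_def algebra_simps sum.distrib sum_subtractf sum_distrib_left)
      also have "(\<Sum>n\<in>N. c n * P x n) = 0"
        using orthspan[of c, OF cE] by (simp add: a)
      also have "(\<Sum>n\<in>N. x n * c n) - 0 - s x * \<gamma> = 0"
      proof (cases "\<gamma> = 0")
        case True
        then have "\<forall>n\<in>N. c n * c n = 0"
          unfolding \<gamma>_def by (subst (asm) sum_nonneg_eq_0_iff) (use N in auto)
        then show ?thesis by (simp add: True)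
      qed (simp add: s_def)
      finally show ?thesis by (simp add: de)
    next
      case False
      with d have "d \<in> E" by simp
      then show ?thesis by (rule orthE)
    qed
  qed
qed

lemma orthogonal_projection:
  fixes V :: "('n \<Rightarrow> 'k::linordered_field) set"
  assumes V: "fun_subspace V" and N: "finite N"
  obtains p where "\<And>x. \<exists>v\<in>V. \<forall>n\<in>N. (\<Sum>n'\<in>N. p n n' * x n') = v n"
    and "\<And>x v. v \<in> V \<Longrightarrow> (\<Sum>n\<in>N. (x n - (\<Sum>n'\<in>N. p n n' * x n')) * v n) = 0"
proof -
  obtain D b where D: "D \<subseteq> N" and b: "\<And>d. d \<in> D \<Longrightarrow> b d \<in> V"
    and "\<And>d d'. d \<in> D \<Longrightarrow> d' \<in> D \<Longrightarrow> b d d' = (if d = d' then 1 else 0)"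
    and ex: "\<And>v n. v \<in> V \<Longrightarrow> n \<in> N \<Longrightarrow> v n = (\<Sum>d\<in>D. v d * b d n)"
    by (rule reduced_echelon_basis[OF V N]) (rule that)
  have "finite D" using D N finite_subset by blast
  then obtain p where p1: "\<And>x. \<exists>a. \<forall>n\<in>N. (\<Sum>n'\<in>N. p n n' * x n') = (\<Sum>d\<in>D. a d * b d n)"
    and p2: "\<And>x d. d \<in> D \<Longrightarrow> (\<Sum>n\<in>N. (x n - (\<Sum>n'\<in>N. p n n' * x n')) * b d n) = 0"
    using orthogonal_projection_finite[OF N, of D b] by blast
  show ?thesis
  proof
    fix x
    obtain a where "\<forall>n\<in>N. (\<Sum>n'\<in>N. p n n' * x n') = (\<Sum>d\<in>D. a d * b d n)" using p1 by blast
    moreover have "(\<lambda>n. \<Sum>d\<in>D. a d * b d n) \<in> V" by (intro fun_subspace_sum V b)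
    ultimately show "\<exists>v\<in>V. \<forall>n\<in>N. (\<Sum>n'\<in>N. p n n' * x n') = v n"
      by (intro bexI[where x = "\<lambda>n. \<Sum>d\<in>D. a d * b d n"])
  next
    fix x v assume v: "v \<in> V"
    have "(\<Sum>n\<in>N. (x n - (\<Sum>n'\<in>N. p n n' * x n')) * v n) =
        (\<Sum>n\<in>N. (x n - (\<Sum>n'\<in>N. p n n' * x n')) * (\<Sum>d\<in>D. v d * b d n))"
      using ex[OF v] by (intro sum.cong) auto
    also have "\<dots> = (\<Sum>d\<in>D. v d * (\<Sum>n\<in>N. (x n - (\<Sum>n'\<in>N. p n n' * x n')) * b d n))"
      by (rule sum_mult_lincomb)
    also have "\<dots> = 0" using p2 by simp
    finally show "(\<Sum>n\<in>N. (x n - (\<Sum>n'\<in>N. p n n' * x n')) * v n) = 0" .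
  qed
qed

text \<open>Matrices are functions on pairs, so a space of matrices is a \<open>fun_subspace\<close>
  with coordinates X \<times> X.\<close>

definition mat_mult :: "'i set \<Rightarrow> ('i \<times> 'i \<Rightarrow> 'k::comm_ring) \<Rightarrow> ('i \<times> 'i \<Rightarrow> 'k) \<Rightarrow> 'i \<times> 'i \<Rightarrow> 'k" where
  "mat_mult X A B = (\<lambda>(i, k). \<Sum>j\<in>X. A (i, j) * B (j, k))"

lemma mat_mult_apply: "mat_mult X A B (i, k) = (\<Sum>j\<in>X. A (i, j) * B (j, k))"
  by (simp add: mat_mult_def)

text \<open>Orthogonal projection onto \<open>V\<close> commutes with left multiplication by \<open>G\<close>, so its
  matrix blocks centralize \<open>G\<close>; hence it also commutes with left multiplication by \<open>T\<close>,
  and \<open>T = T \<sqdot> 1\<close> is fixed by it.\<close>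

lemma bicommutant:
  fixes V :: "('i \<times> 'i \<Rightarrow> 'k::linordered_field) set"
  assumes X: "finite X" and V: "fun_subspace V"
    and e: "e \<in> V" "\<And>i j. i \<in> X \<Longrightarrow> j \<in> X \<Longrightarrow> e (i, j) = (if i = j then 1 else 0)"
    and sym: "\<And>g i j. g \<in> G \<Longrightarrow> i \<in> X \<Longrightarrow> j \<in> X \<Longrightarrow> g (i, j) = g (j, i)"
    and left: "\<And>g v. g \<in> G \<Longrightarrow> v \<in> V \<Longrightarrow> mat_mult X g v \<in> V"
    and T: "\<And>C. (\<And>g i k. g \<in> G \<Longrightarrow> i \<in> X \<Longrightarrow> k \<in> X \<Longrightarrow> mat_mult X C g (i, k) = mat_mult X g C (i, k))
      \<Longrightarrow> \<forall>i\<in>X. \<forall>k\<in>X. mat_mult X T C (i, k) = mat_mult X C T (i, k)"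
  shows "\<exists>v\<in>V. \<forall>i\<in>X. \<forall>j\<in>X. T (i, j) = v (i, j)"
proof -
  let ?N = "X \<times> X"
  have N: "finite ?N" using X by simp
  obtain p where p1: "\<And>x. \<exists>v\<in>V. \<forall>n\<in>?N. (\<Sum>n'\<in>?N. p n n' * x n') = v n"
    and p2: "\<And>x v. v \<in> V \<Longrightarrow> (\<Sum>n\<in>?N. (x n - (\<Sum>n'\<in>?N. p n n' * x n')) * v n) = 0"
    using orthogonal_projection[OF V N] by blast
  define P where "P = (\<lambda>x n. \<Sum>n'\<in>?N. p n n' * x n')"
  \<comment> \<open>Uniqueness of the projection: the difference of two candidates lies in V and is
    orthogonal to itself.\<close>
  have uniq: "P x n = v n"
    if v: "v \<in> V" "\<And>w. w \<in> V \<Longrightarrow> (\<Sum>n\<in>?N. (x n - v n) * w n) = 0" and n: "n \<in> ?N" for x v n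
  proof -
    obtain u where u: "u \<in> V" "\<And>n. n \<in> ?N \<Longrightarrow> P x n = u n" using p1[of x] by (auto simp: P_def)
    define w where "w = (\<lambda>n. 1 * u n + (- 1) * v n)"
    have w: "w \<in> V" unfolding w_def by (rule fun_subspace_lincomb2[OF V u(1) v(1)])
    have "(\<Sum>n\<in>?N. w n * w n) = (\<Sum>n\<in>?N. (x n - v n) * w n - (x n - P x n) * w n)"
      by (rule sum.cong) (auto simp: w_def u(2) algebra_simps)
    also have "\<dots> = 0" using v(2)[OF w] p2[OF w, of x] by (simp add: sum_subtractf P_def)
    finally have "w n * w n = 0" using n N by (subst (asm) sum_nonneg_eq_0_iff) auto
    then show ?thesis using u(2)[OF n] by (simp add: w_def)
  qed
  have Pg: "P (mat_mult X g x) (i, k) = mat_mult X g (P x) (i, k)"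
    if g: "g \<in> G" and ik: "i \<in> X" "k \<in> X" for g x i k
  proof -
    obtain u where u: "u \<in> V" "\<And>n. n \<in> ?N \<Longrightarrow> P x n = u n" using p1[of x] by (auto simp: P_def)
    \<comment> \<open>Left multiplication by a symmetric matrix is self-adjoint, so it preserves the
      orthogonal complement of V along with V.\<close>
    have adj: "(\<Sum>n\<in>?N. mat_mult X g y n * w n) = (\<Sum>n\<in>?N. y n * mat_mult X g w n)" for y w
    proof -
      have "(\<Sum>n\<in>?N. mat_mult X g y n * w n) = (\<Sum>k\<in>X. \<Sum>i\<in>X. \<Sum>j\<in>X. g (i, j) * y (j, k) * w (i, k))"
        unfolding sum.cartesian_product' mat_mult_apply sum_distrib_right by (rule sum.swap)
      also have "\<dots> = (\<Sum>k\<in>X. \<Sum>j\<in>X. \<Sum>i\<in>X. g (j, i) * y (j, k) * w (i, k))"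
        by (rule sum.cong[OF refl], subst sum.swap) (auto intro!: sum.cong simp: sym[OF g])
      also have "\<dots> = (\<Sum>n\<in>?N. y n * mat_mult X g w n)"
        unfolding sum.cartesian_product' mat_mult_apply sum_distrib_left
        by (subst sum.swap) (simp add: mult_ac)
      finally show ?thesis .
    qed
    have "P (mat_mult X g x) (i, k) = mat_mult X g u (i, k)"
    proof (rule uniq)
      show "mat_mult X g u \<in> V" by (rule left[OF g u(1)])
      fix w assume w: "w \<in> V"
      have "(\<Sum>n\<in>?N. (mat_mult X g x n - mat_mult X g u n) * w n) =
          (\<Sum>n\<in>?N. mat_mult X g x n * w n) - (\<Sum>n\<in>?N. mat_mult X g u n * w n)"
        by (simp add: algebra_simps sum_subtractf)
      also have "\<dots> = (\<Sum>n\<in>?N. x n * mat_mult X g w n) - (\<Sum>n\<in>?N. u n * mat_mult X g w n)"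
        by (simp only: adj)
      also have "\<dots> = (\<Sum>n\<in>?N. (x n - P x n) * mat_mult X g w n)"
        unfolding sum_subtractf[symmetric] by (rule sum.cong) (auto simp: u(2) algebra_simps)
      also have "\<dots> = 0" using p2[OF left[OF g w], of x] by (simp add: P_def)
      finally show "(\<Sum>n\<in>?N. (mat_mult X g x n - mat_mult X g u n) * w n) = 0" .
    qed (use ik in auto)
    also have "\<dots> = mat_mult X g (P x) (i, k)"
      unfolding mat_mult_apply by (rule sum.cong) (use u(2) ik in auto)
    finally show ?thesis .
  qed
  have TC: "(\<Sum>a\<in>X. T (i, a) * p (a, k) (j, l)) = (\<Sum>a\<in>X. p (i, k) (a, l) * T (a, j))"
    if ijkl: "i \<in> X" "j \<in> X" "k \<in> X" "l \<in> X" for i j k l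
  proof -
    \<comment> \<open>The block of P that maps column l of the argument to column k of the
      result.\<close>
    define C where "C = (\<lambda>(i, j). p (i, k) (j, l))"
    have "mat_mult X C g (i, j) = mat_mult X g C (i, j)" if g: "g \<in> G" and ij: "i \<in> X" "j \<in> X" for g i j
    proof -
      \<comment> \<open>The elementary matrix at (j, l); for it, \<open>Pg\<close> becomes one entry
        of the equation C g = g C.\<close>
      define x where "x = (\<lambda>n. if n = (j, l) then 1 else 0 :: 'k)"
      have "P (mat_mult X g x) (i, k) = (\<Sum>a\<in>X. \<Sum>b\<in>X. p (i, k) (a, b) * (if b = l then g (a, j) else 0))"
        unfolding P_def sum.cartesian_product'
        using X ij ijkl by (intro sum.cong refl arg_cong2[where f = "(*)"]) (auto simp: mat_mult_apply x_def if_distrib cong: if_cong)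
      also have "\<dots> = mat_mult X C g (i, j)"
        using X ijkl by (simp add: mat_mult_apply C_def if_distrib cong: if_cong)
      finally have 1: "P (mat_mult X g x) (i, k) = mat_mult X C g (i, j)" .
      have "P x n = p n (j, l)" for n
        unfolding P_def x_def using N ij ijkl by (simp add: if_distrib cong: if_cong)
      then have "mat_mult X g (P x) (i, k) = mat_mult X g C (i, j)"
        by (simp add: mat_mult_apply C_def)
      with 1 Pg[OF g ij(1) ijkl(3), of x] show ?thesis by simp
    qed
    then have "mat_mult X T C (i, j) = mat_mult X C T (i, j)" using T[of C] ijkl by blast
    then show ?thesis by (simp add: mat_mult_apply C_def)
  qed
  obtain v where v: "v \<in> V" "\<And>n. n \<in> ?N \<Longrightarrow> P T n = v n" using p1[of T] by (auto simp: P_def)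
  have "T (i, k) = v (i, k)" if ik: "i \<in> X" "k \<in> X" for i k
  proof -
    have Pe: "P e n = e n" if "n \<in> ?N" for n
      by (rule uniq) (use e that in auto)
    have "T (i, k) = (\<Sum>a\<in>X. T (i, a) * e (a, k))"
      using X ik by (simp add: e(2) if_distrib cong: if_cong)
    also have "\<dots> = (\<Sum>a\<in>X. T (i, a) * (\<Sum>j\<in>X. \<Sum>l\<in>X. p (a, k) (j, l) * e (j, l)))"
      by (rule sum.cong) (use Pe ik in \<open>auto simp: P_def sum.cartesian_product'\<close>)
    also have "\<dots> = (\<Sum>a\<in>X. T (i, a) * (\<Sum>j\<in>X. p (a, k) (j, j)))"
      using X by (simp add: e(2) if_distrib cong: if_cong)
    also have "\<dots> = (\<Sum>j\<in>X. \<Sum>a\<in>X. T (i, a) * p (a, k) (j, j))"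
      unfolding sum_distrib_left by (rule sum.swap)
    also have "\<dots> = (\<Sum>j\<in>X. \<Sum>a\<in>X. p (i, k) (a, j) * T (a, j))"
      using TC ik by simp
    also have "\<dots> = P T (i, k)"
      unfolding P_def sum.cartesian_product' by (rule sum.swap)
    finally show ?thesis using v(2) ik by simp
  qed
  with v(1) show ?thesis by blast
qed

definition lincombs :: "'j set \<Rightarrow> ('j \<Rightarrow> 'n \<Rightarrow> 'k::field) \<Rightarrow> ('n \<Rightarrow> 'k) set" where
  "lincombs J \<sigma> = {v. \<exists>A a. finite A \<and> A \<subseteq> J \<and> v = (\<lambda>n. \<Sum>j\<in>A. a j * \<sigma> j n)}"

lemma lincombsI: "finite A \<Longrightarrow> A \<subseteq> J \<Longrightarrow> (\<lambda>n. \<Sum>j\<in>A. a j * \<sigma> j n) \<in> lincombs J \<sigma>"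
  by (auto simp: lincombs_def)

lemma fun_subspace_lincombs: "fun_subspace (lincombs J \<sigma>)"
  unfolding fun_subspace_def
proof (intro conjI ballI allI)
  show "(\<lambda>_. 0) \<in> lincombs J \<sigma>"
    using lincombsI[of "{}" J "\<lambda>_. 0" \<sigma>] by simp
next
  fix u v assume "u \<in> lincombs J \<sigma>" "v \<in> lincombs J \<sigma>"
  then obtain A a B b where A: "finite A" "A \<subseteq> J" "u = (\<lambda>n. \<Sum>j\<in>A. a j * \<sigma> j n)"
    and B: "finite B" "B \<subseteq> J" "v = (\<lambda>n. \<Sum>j\<in>B. b j * \<sigma> j n)"
    by (auto simp: lincombs_def)
  have "(\<lambda>n. u n + v n) =
      (\<lambda>n. \<Sum>j\<in>A \<union> B. ((if j \<in> A then a j else 0) + (if j \<in> B then b j else 0)) * \<sigma> j n)"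
  proof
    fix n
    have "u n = (\<Sum>j\<in>A \<union> B. (if j \<in> A then a j else 0) * \<sigma> j n)"
      unfolding A(3) by (rule sum.mono_neutral_cong_left) (use A B in auto)
    moreover have "v n = (\<Sum>j\<in>A \<union> B. (if j \<in> B then b j else 0) * \<sigma> j n)"
      unfolding B(3) by (rule sum.mono_neutral_cong_left) (use A B in auto)
    ultimately show "u n + v n =
        (\<Sum>j\<in>A \<union> B. ((if j \<in> A then a j else 0) + (if j \<in> B then b j else 0)) * \<sigma> j n)"
      by (simp add: ring_distribs sum.distrib)
  qed
  then show "(\<lambda>n. u n + v n) \<in> lincombs J \<sigma>"
    using lincombsI[of "A \<union> B" J "\<lambda>j. (if j \<in> A then a j else 0) + (if j \<in> B then b j else 0)" \<sigma>] A B by simp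
next
  fix c v assume "v \<in> lincombs J \<sigma>"
  then obtain B b where B: "finite B" "B \<subseteq> J" "v = (\<lambda>n. \<Sum>j\<in>B. b j * \<sigma> j n)"
    by (auto simp: lincombs_def)
  then show "(\<lambda>n. c * v n) \<in> lincombs J \<sigma>"
    using lincombsI[of B J "\<lambda>j. c * b j" \<sigma>] by (simp add: sum_distrib_left mult.assoc)
qed

section \<open>Places\<close>

text \<open>A valuation ring \<open>Ov\<close> with its residue map; \<open>\<pi>\<close> carries no
  meaning outside \<open>Ov\<close>.\<close>

locale place =
  fixes Ov :: "'F::field set" and \<pi> :: "'F \<Rightarrow> 'k::field"
  assumes zero: "0 \<in> Ov" "\<pi> 0 = 0"
    and one: "1 \<in> Ov" "\<pi> 1 = 1"
    and add: "\<And>x y. x \<in> Ov \<Longrightarrow> y \<in> Ov \<Longrightarrow> x + y \<in> Ov"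
      "\<And>x y. x \<in> Ov \<Longrightarrow> y \<in> Ov \<Longrightarrow> \<pi> (x + y) = \<pi> x + \<pi> y"
    and mult: "\<And>x y. x \<in> Ov \<Longrightarrow> y \<in> Ov \<Longrightarrow> x * y \<in> Ov"
      "\<And>x y. x \<in> Ov \<Longrightarrow> y \<in> Ov \<Longrightarrow> \<pi> (x * y) = \<pi> x * \<pi> y"
    and valuation: "\<And>x. x \<noteq> 0 \<Longrightarrow> x \<in> Ov \<or> inverse x \<in> Ov"
    and unit: "\<And>x. x \<in> Ov \<Longrightarrow> \<pi> x \<noteq> 0 \<Longrightarrow> inverse x \<in> Ov"
    and surj: "\<And>y. \<exists>x\<in>Ov. \<pi> x = y"
begin

lemma sum:
  "(\<And>a. a \<in> A \<Longrightarrow> f a \<in> Ov) \<Longrightarrow> (\<Sum>a\<in>A. f a) \<in> Ov \<and> \<pi> (\<Sum>a\<in>A. f a) = (\<Sum>a\<in>A. \<pi> (f a))"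
  by (induction A rule: infinite_finite_induct) (auto simp: zero add)

lemma inverse: "x \<in> Ov \<Longrightarrow> \<pi> x \<noteq> 0 \<Longrightarrow> \<pi> (inverse x) = inverse (\<pi> x)"
  using mult(2)[of x "inverse x"] unit[of x] zero one
  by (cases "x = 0") (auto simp: field_simps)

lemma uminus: "x \<in> Ov \<Longrightarrow> - x \<in> Ov \<and> \<pi> (- x) = - \<pi> x"
proof -
  assume x: "x \<in> Ov"
  \<comment> \<open>-1 is its own inverse, so both alternatives of \<open>valuation\<close>
    agree.\<close>
  have m: "- 1 \<in> Ov" using valuation[of "- 1"] by auto
  have "- 1 * x \<in> Ov" by (rule mult(1)[OF m x])
  then show ?thesis using add(2)[OF x, of "- x"] zero(2) by (simp add: add_eq_0_iff)
qed

lemma diff: "x \<in> Ov \<Longrightarrow> y \<in> Ov \<Longrightarrow> x - y \<in> Ov \<and> \<pi> (x - y) = \<pi> x - \<pi> y"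
  using add[of x "- y"] uminus[of y] by simp

text \<open>Divide by an entry of least valuation: all quotients lie in \<open>Ov\<close>, and that
  entry becomes 1. A local ring that is not a valuation ring need not offer such an entry.\<close>

lemma normalize:
  assumes "finite N" "n \<in> N" "v n \<noteq> 0"
  obtains c where "c \<noteq> 0" "\<And>n. n \<in> N \<Longrightarrow> c * v n \<in> Ov" "\<exists>n\<in>N. \<pi> (c * v n) \<noteq> 0"
proof -
  have "\<exists>n\<in>N. v n \<noteq> 0 \<Longrightarrow> \<exists>m\<in>N. v m \<noteq> 0 \<and> (\<forall>n\<in>N. inverse (v m) * v n \<in> Ov)"
    using assms(1)
  proof (induction N)
    case (insert a N)
    show ?case
    proof (cases "\<exists>n\<in>N. v n \<noteq> 0")
      case True
      then obtain m where m: "m \<in> N" "v m \<noteq> 0" "\<forall>n\<in>N. inverse (v m) * v n \<in> Ov"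
        using insert by blast
      show ?thesis
      proof (cases "inverse (v m) * v a \<in> Ov")
        case True
        with m show ?thesis by blast
      next
        case False
        then have a: "v a \<noteq> 0" using zero by auto
        then have "inverse (inverse (v m) * v a) \<in> Ov" using False m valuation[of "inverse (v m) * v a"] by auto
        then have am: "inverse (v a) * v m \<in> Ov" by (simp add: mult.commute)
        have "inverse (v a) * v n \<in> Ov" if "n \<in> N" for n
        proof -
          have "(inverse (v a) * v m) * (inverse (v m) * v n) \<in> Ov" using am m that mult(1) by blast
          moreover have "(inverse (v a) * v m) * (inverse (v m) * v n) = inverse (v a) * v n"
            using m(2) by (simp add: field_simps)
          ultimately show ?thesis by simp
        qed
        then show ?thesis using a one by auto
      qed
    next
      case False
      then show ?thesis using insert.prems zero one by auto
    qed
  qed simp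
  then obtain m where "m \<in> N" "v m \<noteq> 0" "\<forall>n\<in>N. inverse (v m) * v n \<in> Ov"
    using assms by blast
  with one show ?thesis by (intro that[of "inverse (v m)"]) (auto intro!: bexI[of _ m])
qed

text \<open>A basis of the specialized span lifts to a family whose minor at the pivots \<open>D\<close> is a unit, so
  the \<open>\<sigma> j\<close> can correct any solution to one vanishing on \<open>D\<close>. If that were nonzero, it could be rescaled to
  have a nonzero specialization, an element of the specialized span vanishing on its pivots.\<close>

lemma solution_space_lifting:
  fixes \<sigma> :: "'j \<Rightarrow> 'n \<Rightarrow> 'F" and c :: "'l \<Rightarrow> 'n \<Rightarrow> 'F"
  assumes N: "finite N"
    and \<sigma>: "\<And>j n. j \<in> J \<Longrightarrow> n \<in> N \<Longrightarrow> \<sigma> j n \<in> Ov"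
    and c: "\<And>l n. l \<in> L \<Longrightarrow> n \<in> N \<Longrightarrow> c l n \<in> Ov"
    and sol: "\<And>l j. l \<in> L \<Longrightarrow> j \<in> J \<Longrightarrow> (\<Sum>n\<in>N. c l n * \<sigma> j n) = 0"
    and special: "\<And>y. (\<And>l. l \<in> L \<Longrightarrow> (\<Sum>n\<in>N. \<pi> (c l n) * y n) = 0) \<Longrightarrow>
      \<exists>v\<in>lincombs J (\<lambda>j n. \<pi> (\<sigma> j n)). \<forall>n\<in>N. y n = v n"
    and x: "\<And>l. l \<in> L \<Longrightarrow> (\<Sum>n\<in>N. c l n * x n) = 0"
  shows "\<exists>v\<in>lincombs J \<sigma>. \<forall>n\<in>N. x n = v n"
proof -
  let ?V = "lincombs J (\<lambda>j n. \<pi> (\<sigma> j n))" and ?W = "lincombs J \<sigma>"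
  note V = fun_subspace_lincombs[of J "\<lambda>j n. \<pi> (\<sigma> j n)"] and W = fun_subspace_lincombs[of J \<sigma>]
  obtain D b where D: "D \<subseteq> N" and b: "\<And>d. d \<in> D \<Longrightarrow> b d \<in> ?V"
    and b\<delta>: "\<And>d d'. d \<in> D \<Longrightarrow> d' \<in> D \<Longrightarrow> b d d' = (if d = d' then 1 else 0)"
    and bex: "\<And>v n. v \<in> ?V \<Longrightarrow> n \<in> N \<Longrightarrow> v n = (\<Sum>d\<in>D. v d * b d n)"
    by (rule reduced_echelon_basis[OF V N]) (rule that)
  have finD: "finite D" using D N finite_subset by blast
  have "\<exists>\<beta>\<in>?W. \<forall>n\<in>N. \<beta> n \<in> Ov \<and> \<pi> (\<beta> n) = b d n" if d: "d \<in> D" for d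
  proof -
    obtain A a where A: "finite A" "A \<subseteq> J" "b d = (\<lambda>n. \<Sum>j\<in>A. a j * \<pi> (\<sigma> j n))"
      using b[OF d] by (auto simp: lincombs_def)
    have "\<forall>j. \<exists>x. x \<in> Ov \<and> \<pi> x = a j" using surj by blast
    from choice[OF this] obtain a' where a': "\<And>j. a' j \<in> Ov \<and> \<pi> (a' j) = a j" by blast
    have "(\<Sum>j\<in>A. a' j * \<sigma> j n) \<in> Ov \<and> \<pi> (\<Sum>j\<in>A. a' j * \<sigma> j n) = b d n" if "n \<in> N" for n
      using sum[of A "\<lambda>j. a' j * \<sigma> j n"] A a' \<sigma> that by (auto simp: mult subset_iff)
    then show ?thesis
      by (intro bexI[of _ "\<lambda>n. \<Sum>j\<in>A. a' j * \<sigma> j n"] ballI lincombsI) (use A in auto)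
  qed
  then obtain \<beta> where \<beta>: "\<And>d. d \<in> D \<Longrightarrow> \<beta> d \<in> ?W"
    "\<And>d n. d \<in> D \<Longrightarrow> n \<in> N \<Longrightarrow> \<beta> d n \<in> Ov" "\<And>d n. d \<in> D \<Longrightarrow> n \<in> N \<Longrightarrow> \<pi> (\<beta> d n) = b d n"
    by metis
  have Wsol: "(\<Sum>n\<in>N. c l n * w n) = 0" if l: "l \<in> L" and w: "w \<in> ?W" for l w
  proof -
    obtain A a where A: "finite A" "A \<subseteq> J" "w = (\<lambda>n. \<Sum>j\<in>A. a j * \<sigma> j n)"
      using w by (auto simp: lincombs_def)
    then show ?thesis using sol[OF l] by (auto simp: sum_mult_lincomb subset_iff intro!: sum.neutral)
  qed
  have vanish: "v n = 0"
    if v: "\<And>l. l \<in> L \<Longrightarrow> (\<Sum>n\<in>N. c l n * v n) = 0" "\<And>d. d \<in> D \<Longrightarrow> v d = 0" and n: "n \<in> N" for v n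
  proof (rule ccontr)
    assume "v n \<noteq> 0"
    then obtain s where s: "s \<noteq> 0" "\<And>n. n \<in> N \<Longrightarrow> s * v n \<in> Ov" "\<exists>n\<in>N. \<pi> (s * v n) \<noteq> 0"
      by (rule normalize[OF N n]) (rule that)
    have "(\<Sum>n\<in>N. \<pi> (c l n) * \<pi> (s * v n)) = 0" if l: "l \<in> L" for l
    proof -
      have "(\<Sum>n\<in>N. c l n * (s * v n)) = s * (\<Sum>n\<in>N. c l n * v n)"
        by (simp add: sum_distrib_left mult_ac)
      then have "\<pi> (\<Sum>n\<in>N. c l n * (s * v n)) = 0" using v(1)[OF l] zero by simp
      moreover have "\<pi> (\<Sum>n\<in>N. c l n * (s * v n)) = (\<Sum>n\<in>N. \<pi> (c l n * (s * v n)))"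
        by (rule sum[THEN conjunct2]) (use c l s in \<open>auto intro: mult\<close>)
      ultimately show ?thesis using c l s by (simp add: mult)
    qed
    then obtain y where y: "y \<in> ?V" "\<And>n. n \<in> N \<Longrightarrow> \<pi> (s * v n) = y n"
      using special[of "\<lambda>n. \<pi> (s * v n)"] by blast
    have "y d = 0" if "d \<in> D" for d using that v(2) D y(2)[of d] zero by auto
    then have "y n = 0" if "n \<in> N" for n using bex[OF y(1) that] by simp
    then show False using s(3) y(2) by auto
  qed
  obtain D' b' where D': "D' \<subseteq> D" and b': "\<And>d. d \<in> D' \<Longrightarrow> b' d \<in> ?W"
    and b'\<delta>: "\<And>d d'. d \<in> D' \<Longrightarrow> d' \<in> D' \<Longrightarrow> b' d d' = (if d = d' then 1 else 0)"
    and b'ex: "\<And>v n. v \<in> ?W \<Longrightarrow> n \<in> D \<Longrightarrow> v n = (\<Sum>d\<in>D'. v d * b' d n)"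
    by (rule reduced_echelon_basis[OF W finD]) (rule that)
  have finD': "finite D'" using D' finD finite_subset by blast
  have "D' = D"
  proof (rule ccontr)
    assume "D' \<noteq> D"
    then obtain d0 where d0: "d0 \<in> D" "d0 \<notin> D'" using D' by blast
    \<comment> \<open>With too few pivots, expressing coordinate d0 through the pivots would give a
      linear form on D that kills all of \<open>?W\<close>. Rescaled to a nonzero residue, it would
      kill the residues b of \<beta>; but these are dual to the coordinates in D.\<close>
    define lf where "lf = (\<lambda>d. if d = d0 then 1 else if d \<in> D' then - b' d d0 else 0)"
    have kill: "(\<Sum>d\<in>D. lf d * w d) = 0" if "w \<in> ?W" for w
    proof -
      have "(\<Sum>d\<in>D. lf d * w d) = (\<Sum>d\<in>insert d0 D'. lf d * w d)"
        by (rule sum.mono_neutral_right) (use finD d0 D' in \<open>auto simp: lf_def\<close>)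
      also have "\<dots> = w d0 + (\<Sum>d\<in>D'. lf d * w d)" using finD' d0 by (simp add: lf_def)
      also have "(\<Sum>d\<in>D'. lf d * w d) = (\<Sum>d\<in>D'. - (w d * b' d d0))"
        by (rule sum.cong) (use d0 in \<open>auto simp: lf_def\<close>)
      finally show ?thesis using b'ex[OF that d0(1)] by (simp add: sum_negf)
    qed
    have "lf d0 \<noteq> 0" by (simp add: lf_def)
    then obtain s where s: "s \<noteq> 0" "\<And>n. n \<in> D \<Longrightarrow> s * lf n \<in> Ov" "\<exists>n\<in>D. \<pi> (s * lf n) \<noteq> 0"
      by (rule normalize[OF finD d0(1)]) (rule that)
    then obtain d1 where d1: "d1 \<in> D" "\<pi> (s * lf d1) \<noteq> 0" by blast
    have "(\<Sum>d\<in>D. (s * lf d) * \<beta> d1 d) = s * (\<Sum>d\<in>D. lf d * \<beta> d1 d)"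
      by (simp add: sum_distrib_left mult_ac)
    then have "\<pi> (\<Sum>d\<in>D. (s * lf d) * \<beta> d1 d) = 0" using kill[OF \<beta>(1)[OF d1(1)]] zero by simp
    moreover have "\<pi> (\<Sum>d\<in>D. (s * lf d) * \<beta> d1 d) = (\<Sum>d\<in>D. \<pi> ((s * lf d) * \<beta> d1 d))"
      by (rule sum[THEN conjunct2]) (rule mult(1)[OF s(2) \<beta>(2)[OF d1(1)]], use D in auto)
    moreover have "\<dots> = (\<Sum>d\<in>D. if d = d1 then \<pi> (s * lf d1) else 0)"
      by (rule sum.cong) (use s \<beta> d1 D in \<open>auto simp: mult(2) b\<delta> subset_iff\<close>)
    ultimately show False using d1 finD by simp
  qed
  define w where "w = (\<lambda>n. \<Sum>d\<in>D. x d * b' d n)"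
  have w: "w \<in> ?W" unfolding w_def by (intro fun_subspace_sum W) (use b' \<open>D' = D\<close> in auto)
  have "x n = w n" if n: "n \<in> N" for n
  proof -
    have "x n - w n = 0"
    proof (rule vanish[where v = "\<lambda>n. x n - w n"])
      fix l assume "l \<in> L"
      then show "(\<Sum>n\<in>N. c l n * (x n - w n)) = 0"
        using x Wsol[OF _ w] by (simp add: right_diff_distrib sum_subtractf)
    next
      fix d assume d: "d \<in> D"
      have "w d = (\<Sum>d'\<in>D. if d' = d then x d' else 0)"
        unfolding w_def by (rule sum.cong) (use b'\<delta> \<open>D' = D\<close> d in auto)
      then show "x d - w d = 0" using finD d by simp
    qed (rule n)
    then show ?thesis by simp
  qed
  with w show ?thesis by blast
qed

end

lemma place_compose:
  assumes "place O1 \<pi>1" "place O2 \<pi>2"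
  shows "place {x \<in> O1. \<pi>1 x \<in> O2} (\<lambda>x. \<pi>2 (\<pi>1 x))"
proof -
  interpret p1: place O1 \<pi>1 by fact
  interpret p2: place O2 \<pi>2 by fact
  show ?thesis
  proof (unfold_locales, goal_cases)
    case (9 x)
    show ?case
    proof (cases "x \<in> O1")
      case True
      show ?thesis
      proof (cases "\<pi>1 x \<in> O2")
        case False
        then have nz: "\<pi>1 x \<noteq> 0" using p2.zero by auto
        then have "inverse (\<pi>1 x) \<in> O2" using False p2.valuation by blast
        then show ?thesis using True nz p1.unit[OF True] p1.inverse[OF True] by simp
      qed (use True in simp)
    next
      case False
      then have i: "inverse x \<in> O1" using p1.valuation[OF 9] by blast
      \<comment> \<open>The inverse of an element outside O1 lies in the maximal ideal of O1, and
        its residue 0 belongs to O2.\<close>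
      then have "\<pi>1 (inverse x) = 0" using p1.unit[OF i] False by auto
      then show ?thesis using i p2.zero by simp
    qed
  next
    case (10 x)
    then have "\<pi>1 x \<noteq> 0" using p2.zero by auto
    then show ?case using 10 p1.unit[of x] p1.inverse[of x] p2.unit[of "\<pi>1 x"] by simp
  next
    case (11 y)
    obtain z where "z \<in> O2" "\<pi>2 z = y" using p2.surj by blast
    moreover obtain x where "x \<in> O1" "\<pi>1 x = z" using p1.surj by blast
    ultimately show ?case by auto
  qed (auto simp: p1.zero p1.one p1.add p1.mult p2.zero p2.one p2.add p2.mult)
qed

section \<open>Evaluation at 1 as a place of a field of rational functions\<close>

definition regular1 :: "'a::idom poly fract set" where
  "regular1 = {x. \<exists>a b. poly b 1 \<noteq> 0 \<and> x = Fraction_Field.Fract a b}"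

definition value1 :: "('a::idom \<Rightarrow> 'k::field) \<Rightarrow> 'a poly fract \<Rightarrow> 'k" where
  "value1 h x = (SOME y. \<exists>a b. poly b 1 \<noteq> 0 \<and> x = Fraction_Field.Fract a b \<and> y = h (poly a 1) / h (poly b 1))"

text \<open>The value of a fraction at 1 is a quotient of two elements of the coefficient domain, so
  the residue field is its field of fractions and h the embedding. For p = 1 this embeds Q[q] into
  Q(q); for q = 1 it is the identity of Q.\<close>

locale residue_embedding =
  fixes h :: "'a::idom \<Rightarrow> 'k::field"
  assumes h0: "h 0 = 0" and h1: "h 1 = 1" and hadd: "\<And>x y. h (x + y) = h x + h y"
    and hmult: "\<And>x y. h (x * y) = h x * h y" and hinj: "\<And>x. h x = 0 \<Longrightarrow> x = 0"
    and hquot: "\<And>y. \<exists>a b. b \<noteq> 0 \<and> y = h a / h b"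
begin

lemma value1_Fract:
  assumes "poly b 1 \<noteq> 0"
  shows "value1 h (Fraction_Field.Fract a b) = h (poly a 1) / h (poly b 1)"
proof -
  have "y = h (poly a 1) / h (poly b 1)"
    if "poly d 1 \<noteq> 0" "Fraction_Field.Fract a b = Fraction_Field.Fract c d" "y = h (poly c 1) / h (poly d 1)" for y c d
  proof -
    have nz: "b \<noteq> 0" "d \<noteq> 0" using assms that by auto
    then have "poly a 1 * poly d 1 = poly c 1 * poly b 1"
      using that(2) by (simp add: eq_fract flip: poly_mult)
    then have "h (poly a 1) * h (poly d 1) = h (poly c 1) * h (poly b 1)" by (simp flip: hmult)
    moreover have "h (poly b 1) \<noteq> 0" "h (poly d 1) \<noteq> 0" using assms that hinj by auto
    ultimately show ?thesis unfolding that(3) by (subst frac_eq_eq) (simp_all add: mult.commute)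
  qed
  then show ?thesis unfolding value1_def by (intro some_equality) (use assms in blast)+
qed

lemma regular1_Fract: "poly b 1 \<noteq> 0 \<Longrightarrow> Fraction_Field.Fract a b \<in> regular1"
  by (auto simp: regular1_def)

lemma regular1_cases:
  assumes "x \<in> regular1"
  obtains a b where "poly b 1 \<noteq> 0" "b \<noteq> 0" "h (poly b 1) \<noteq> 0" "x = Fraction_Field.Fract a b"
proof -
  obtain a b where "poly b 1 \<noteq> 0" "x = Fraction_Field.Fract a b"
    using assms by (auto simp: regular1_def)
  then show ?thesis using hinj by (intro that[of b a]) auto
qed

lemma place_regular1: "place regular1 (value1 h)"
proof (unfold_locales, goal_cases)
  case 1
  show ?case by (subst Zero_fract_def) (rule regular1_Fract, simp)
next
  case 2
  have "(0 :: 'a poly fract) = Fraction_Field.Fract 0 1" by (rule Zero_fract_def)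
  then show ?case using value1_Fract[of 1 0] by (simp add: h0)
next
  case 3
  show ?case by (subst One_fract_def) (rule regular1_Fract, simp)
next
  case 4
  have "(1 :: 'a poly fract) = Fraction_Field.Fract 1 1" by (rule One_fract_def)
  then show ?case using value1_Fract[of 1 1] by (simp add: h1)
next
  case (5 x y)
  then show ?case by (elim regular1_cases) (simp add: regular1_Fract)
next
  case (6 x y)
  then show ?case by (elim regular1_cases) (simp add: value1_Fract hadd hmult field_simps)
next
  case (7 x y)
  then show ?case by (elim regular1_cases) (simp add: regular1_Fract)
next
  case (8 x y)
  then show ?case by (elim regular1_cases) (simp add: value1_Fract hadd hmult)
next
  case (9 x)
  obtain a b where ab: "x = Fraction_Field.Fract a b" "b \<noteq> 0" by (cases x) auto
  then have "a \<noteq> 0" using 9 by (auto simp: fract_collapse)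
  \<comment> \<open>Powers of X - 1 are split off from numerator and denominator; comparing the two
    exponents decides whether x or its inverse is regular at 1.\<close>
  let ?l = "[:- 1, 1:] :: 'a poly"
  obtain a' where a': "a = ?l ^ Polynomial.order 1 a * a'" "\<not> ?l dvd a'" using order_decomp[OF \<open>a \<noteq> 0\<close>] by blast
  obtain b' where b': "b = ?l ^ Polynomial.order 1 b * b'" "\<not> ?l dvd b'" using order_decomp[OF \<open>b \<noteq> 0\<close>] by blast
  have p: "poly a' 1 \<noteq> 0" "poly b' 1 \<noteq> 0" using a'(2) b'(2) by (simp_all add: poly_eq_0_iff_dvd)
  have l: "?l ^ k \<noteq> 0" for k by simp
  show ?case
  proof (cases "Polynomial.order 1 a \<ge> Polynomial.order 1 b")
    case True
    then obtain k where k: "Polynomial.order 1 a = Polynomial.order 1 b + k" using le_Suc_ex by blast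
    have "x = Fraction_Field.Fract (?l ^ Polynomial.order 1 b * (?l ^ k * a')) (?l ^ Polynomial.order 1 b * b')"
      unfolding ab(1) by (subst a'(1), subst b'(1)) (simp add: k power_add mult.assoc)
    then have "x = Fraction_Field.Fract (?l ^ k * a') b'"
      by (simp only: mult_fract_cancel[OF l])
    then show ?thesis using regular1_Fract[OF p(2)] by simp
  next
    case False
    then obtain k where k: "Polynomial.order 1 b = Polynomial.order 1 a + k" using le_Suc_ex nat_le_linear by blast
    have "inverse x = Fraction_Field.Fract (?l ^ Polynomial.order 1 a * (?l ^ k * b')) (?l ^ Polynomial.order 1 a * a')"
      unfolding ab(1) inverse_fract by (subst b'(1), subst a'(1)) (simp add: k power_add mult.assoc)
    then have "inverse x = Fraction_Field.Fract (?l ^ k * b') a'"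
      by (simp only: mult_fract_cancel[OF l])
    then show ?thesis using regular1_Fract[OF p(1)] by simp
  qed
next
  case (10 x)
  then obtain a b where ab: "poly b 1 \<noteq> 0" "b \<noteq> 0" "x = Fraction_Field.Fract a b"
    using regular1_cases by metis
  then have "poly a 1 \<noteq> 0" using 10(2) by (auto simp: value1_Fract h0)
  then show ?case using ab by (simp add: regular1_Fract)
next
  case (11 y)
  obtain a b where ab: "b \<noteq> 0" "y = h a / h b" using hquot by blast
  then show ?case
    by (intro bexI[of _ "Fraction_Field.Fract [:a:] [:b:]"]) (simp_all add: value1_Fract regular1_Fract)
qed

end

definition const_fract :: "'a::idom \<Rightarrow> 'a fract" where
  "const_fract a = Fraction_Field.Fract a 1"

interpretation emb_q: residue_embedding "const_fract :: rat poly \<Rightarrow> rat poly fract"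
proof
  show "\<exists>a b. b \<noteq> 0 \<and> y = const_fract a / const_fract b" for y :: "rat poly fract"
    by (cases y) (auto simp: const_fract_def)
qed (simp_all add: const_fract_def Zero_fract_def One_fract_def eq_fract)

interpretation emb_1: residue_embedding "\<lambda>x :: rat. x"
proof
  show "\<exists>a b. b \<noteq> 0 \<and> y = a / b" for y :: rat
    by (rule exI[of _ y], rule exI[of _ 1]) simp
qed simp_all

definition spec_ring :: "Qpq set" where
  "spec_ring = {x \<in> regular1. value1 const_fract x \<in> regular1}"

definition spec :: "Qpq \<Rightarrow> rat" where
  "spec x = value1 (\<lambda>x. x) (value1 const_fract x)"

interpretation sp: place spec_ring spec
  using place_compose[OF emb_q.place_regular1 emb_1.place_regular1]
  by (simp add: spec_ring_def spec_def[abs_def])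

lemma spec_pp: "pp \<in> spec_ring" "spec pp = 1"
  and spec_qq: "qq \<in> spec_ring" "spec qq = 1"
proof -
  have "value1 const_fract pp = 1" "pp \<in> regular1"
    by (simp_all add: pp_def emb_q.value1_Fract emb_q.regular1_Fract emb_q.h1)
  moreover have "(1 :: rat poly fract) \<in> regular1" "value1 (\<lambda>x. x) (1 :: rat poly fract) = 1"
    using place.one[OF emb_1.place_regular1] by auto
  ultimately show "pp \<in> spec_ring" "spec pp = 1" by (simp_all add: spec_ring_def spec_def)
  have "value1 const_fract qq = Fraction_Field.Fract [:0, 1:] 1" "qq \<in> regular1"
    by (simp_all add: qq_def emb_q.value1_Fract emb_q.regular1_Fract) (simp add: const_fract_def One_fract_def)
  then show "qq \<in> spec_ring" "spec qq = 1"
    by (simp_all add: spec_ring_def spec_def emb_1.value1_Fract emb_1.regular1_Fract)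
qed

text \<open>At p = 1 the numerator vanishes, while q - q^-1 is still a nonzero element of Q(q).
  Evaluating at q = 1 with p generic would produce a pole instead.\<close>

lemma spec_coeff_t:
  "(pp - inverse pp) / (qq - inverse qq) \<in> spec_ring" "spec ((pp - inverse pp) / (qq - inverse qq)) = 0"
proof -
  interpret p1: place regular1 "value1 (const_fract :: rat poly \<Rightarrow> _)" by (rule emb_q.place_regular1)
  interpret p2: place regular1 "value1 (\<lambda>x::rat. x)" by (rule emb_1.place_regular1)
  have p: "value1 const_fract pp = 1" "pp \<in> regular1"
    by (simp_all add: pp_def emb_q.value1_Fract emb_q.regular1_Fract emb_q.h1)
  have q: "value1 const_fract qq = Fraction_Field.Fract [:0, 1:] 1" "qq \<in> regular1"
    by (simp_all add: qq_def emb_q.value1_Fract emb_q.regular1_Fract) (simp add: const_fract_def One_fract_def)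
  have qi: "value1 const_fract qq \<noteq> 0"
    unfolding q by (simp add: Zero_fract_def eq_fract)
  have d: "qq - inverse qq \<in> regular1" "value1 const_fract (qq - inverse qq) \<noteq> 0"
    using p1.diff[of qq "inverse qq"] p1.unit[of qq] p1.inverse[of qq] q qi
    by (auto simp: eq_fract one_pCons Zero_fract_def)
  have n: "pp - inverse pp \<in> regular1" "value1 const_fract (pp - inverse pp) = 0"
    using p1.diff[of pp "inverse pp"] p1.unit[of pp] p1.inverse[of pp] p by auto
  have "value1 const_fract ((pp - inverse pp) / (qq - inverse qq)) = 0"
    "(pp - inverse pp) / (qq - inverse qq) \<in> regular1"
    using p1.mult[OF n(1) p1.unit[OF d]] n(2) by (simp_all add: divide_inverse)
  then show "(pp - inverse pp) / (qq - inverse qq) \<in> spec_ring" "spec ((pp - inverse pp) / (qq - inverse qq)) = 0"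
    using p2.zero by (simp_all add: spec_ring_def spec_def)
qed

lemma spec_qq_powi: "qq powi n \<in> spec_ring \<and> spec (qq powi n) = 1"
proof -
  have inv: "inverse qq \<in> spec_ring" "spec (inverse qq) = 1"
    using sp.unit[of qq] sp.inverse[of qq] spec_qq by auto
  have pow: "x ^ k \<in> spec_ring \<and> spec (x ^ k) = 1" if "x \<in> spec_ring" "spec x = 1" for x k
    by (induction k) (use that sp.one sp.mult in auto)
  show ?thesis using pow[OF spec_qq] pow[OF inv] by (simp add: power_int_def)
qed

section \<open>The specialization \<open>p = q = 1\<close>\<close>

text \<open>A matrix on \<open>V\<^sup>\<otimes>\<^sup>m\<close> is encoded as a function of the list of pairs \<open>(f(k), g(k))\<close>.
  Then \<open>ins Y R\<close> is the sum over \<open>k\<close> of the matrices acting by \<open>Y\<close> on the \<open>k\<close>-th factor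
  and by \<open>R\<close> on the others, and \<open>der I Z R\<close> is the product of the derivation
  \<open>\<Sum>\<^sub>k 1 \<otimes> \<dots> \<otimes> Z \<otimes> \<dots> \<otimes> 1\<close> with \<open>R\<close>.\<close>

type_synonym pmat = "(rat \<times> rat) list \<Rightarrow> rat"

fun ins :: "(rat \<times> rat \<Rightarrow> rat) \<Rightarrow> pmat \<Rightarrow> pmat" where
  "ins Y R [] = 0"
| "ins Y R (c # h) = Y c * R h + ins Y (\<lambda>h'. R (c # h')) h"

fun der :: "rat set \<Rightarrow> (rat \<times> rat \<Rightarrow> rat) \<Rightarrow> pmat \<Rightarrow> pmat" where
  "der I Z R [] = 0"
| "der I Z R (c # h) = (\<Sum>a\<in>I. Z (fst c, a) * R ((a, snd c) # h)) + der I Z (\<lambda>h'. R (c # h')) h"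

definition unit_mat :: pmat where
  "unit_mat h = (if \<forall>c\<in>set h. fst c = snd c then 1 else 0)"

lemma ins_lincomb: "ins Y (\<lambda>h. x * R h + y * S h) h = x * ins Y R h + y * ins Y S h"
  by (induction h arbitrary: R S) (simp_all add: algebra_simps)

lemma ins_sum: "ins Y (\<lambda>h. \<Sum>a\<in>A. x a * R a h) h = (\<Sum>a\<in>A. x a * ins Y (R a) h)"
  by (induction h arbitrary: R) (simp_all add: sum.distrib sum_distrib_left algebra_simps)

lemma ins_cong:
  "(\<And>h'. length h = Suc (length h') \<Longrightarrow> set h' \<subseteq> set h \<Longrightarrow> R h' = S h') \<Longrightarrow> ins Y R h = ins Y S h"
proof (induction h arbitrary: R S)
  case (Cons c h)
  have "R h = S h" by (rule Cons.prems) auto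
  moreover have "ins Y (\<lambda>h'. R (c # h')) h = ins Y (\<lambda>h'. S (c # h')) h"
    by (rule Cons.IH, rule Cons.prems) auto
  ultimately show ?case by simp
qed simp

lemma der_lincomb: "der I Z (\<lambda>h. x * R h + y * S h) h = x * der I Z R h + y * der I Z S h"
  by (induction h arbitrary: R S) (simp_all add: sum.distrib sum_distrib_left algebra_simps)

lemma der_sum: "der I Z (\<lambda>h. \<Sum>a\<in>A. x a * R a h) h = (\<Sum>a\<in>A. x a * der I Z (R a) h)"
proof (induction h arbitrary: R)
  case (Cons c h)
  have "(\<Sum>b\<in>I. Z (fst c, b) * (\<Sum>a\<in>A. x a * R a ((b, snd c) # h))) =
      (\<Sum>a\<in>A. x a * (\<Sum>b\<in>I. Z (fst c, b) * R a ((b, snd c) # h)))"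
    by (rule sum_mult_lincomb)
  then show ?case using Cons by (simp add: sum.distrib algebra_simps)
qed simp

lemma der_cong_mat:
  "(\<And>a b. a \<in> I \<Longrightarrow> b \<in> I \<Longrightarrow> Z (a, b) = Z' (a, b)) \<Longrightarrow> set h \<subseteq> I \<times> I \<Longrightarrow> der I Z R h = der I Z' R h"
  by (induction h arbitrary: R) (auto intro!: sum.cong)

lemma der_lincomb_mat: "der I (\<lambda>c. x * Z c + y * Z' c) R h = x * der I Z R h + y * der I Z' R h"
  by (induction h arbitrary: R) (simp_all add: sum.distrib sum_distrib_left algebra_simps)

lemma der_ident:
  "finite I \<Longrightarrow> set h \<subseteq> I \<times> I \<Longrightarrow> der I (\<lambda>(a, b). if a = b then 1 else 0) R h = of_nat (length h) * R h"
proof (induction h arbitrary: R)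
  case (Cons c h)
  obtain a b where c: "c = (a, b)" by (cases c)
  have "(\<Sum>x\<in>I. (if a = x then 1 else 0) * R ((x, b) # h)) = (\<Sum>x\<in>I. if x = a then R (c # h) else 0)"
    by (rule sum.cong) (auto simp: c)
  also have "\<dots> = R (c # h)" using Cons.prems c by simp
  finally show ?case using Cons by (simp add: c algebra_simps)
qed simp

lemma ins_zero [simp]: "ins Y (\<lambda>h. 0) h = 0"
  using ins_lincomb[of Y 0 "\<lambda>h. 0" 0 "\<lambda>h. 0" h] by simp

lemma der_zero [simp]: "der I Z (\<lambda>h. 0) h = 0"
  using der_lincomb[of I Z 0 "\<lambda>h. 0" 0 "\<lambda>h. 0" h] by simp

lemma ins_commute: "ins Y (ins Z R) h = ins Z (ins Y R) h"
proof (induction h arbitrary: R)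
  case (Cons c h)
  have "ins Y (\<lambda>h'. ins Z R (c # h')) h = Z c * ins Y R h + ins Y (ins Z (\<lambda>h'. R (c # h'))) h" for Y Z
    using ins_lincomb[of Y "Z c" R 1 "ins Z (\<lambda>h'. R (c # h'))" h] by simp
  then show ?case using Cons[of "\<lambda>h'. R (c # h')"] by simp
qed simp

definition mat_comp :: "rat set \<Rightarrow> (rat \<times> rat \<Rightarrow> rat) \<Rightarrow> (rat \<times> rat \<Rightarrow> rat) \<Rightarrow> rat \<times> rat \<Rightarrow> rat" where
  "mat_comp I Z Y = (\<lambda>(a, b). \<Sum>c\<in>I. Z (a, c) * Y (c, b))"

text \<open>The derivation hits either the factor occupied by Y, where it produces Z Y, or one of
  the other factors.\<close>

lemma der_ins: "der I Z (ins Y R) h = ins (mat_comp I Z Y) R h + ins Y (der I Z R) h"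
proof (induction h arbitrary: R)
  case (Cons c h)
  have 1: "der I Z (\<lambda>h'. ins Y R (c # h')) h =
      Y c * der I Z R h + (ins (mat_comp I Z Y) (\<lambda>h'. R (c # h')) h + ins Y (der I Z (\<lambda>h'. R (c # h'))) h)"
    using der_lincomb[of I Z "Y c" R 1 "ins Y (\<lambda>h'. R (c # h'))" h] by (simp add: Cons)
  have 2: "ins Y (\<lambda>h'. der I Z R (c # h')) h =
      (\<Sum>a\<in>I. Z (fst c, a) * ins Y (\<lambda>h'. R ((a, snd c) # h')) h) + ins Y (der I Z (\<lambda>h'. R (c # h'))) h"
    using ins_lincomb[of Y 1 "\<lambda>h'. \<Sum>a\<in>I. Z (fst c, a) * R ((a, snd c) # h')" 1 "der I Z (\<lambda>h'. R (c # h'))" h]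
    by (simp add: ins_sum)
  have 3: "(\<Sum>a\<in>I. Z (fst c, a) * ins Y R ((a, snd c) # h)) =
      mat_comp I Z Y c * R h + (\<Sum>a\<in>I. Z (fst c, a) * ins Y (\<lambda>h'. R ((a, snd c) # h')) h)"
    by (cases c) (simp add: mat_comp_def sum_distrib_left sum_distrib_right sum.distrib algebra_simps)
  show ?case using 1 2 3 by simp
qed simp

lemma der_unit_mat: "finite I \<Longrightarrow> set h \<subseteq> I \<times> I \<Longrightarrow> der I Z unit_mat h = ins Z unit_mat h"
proof (induction h)
  case (Cons c h)
  obtain a b where c: "c = (a, b)" by (cases c)
  have "(\<Sum>x\<in>I. Z (a, x) * unit_mat ((x, b) # h)) = (\<Sum>x\<in>I. if x = b then Z (a, b) * unit_mat h else 0)"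
    by (rule sum.cong) (auto simp: unit_mat_def)
  also have "\<dots> = Z (a, b) * unit_mat h" using Cons.prems c by simp
  finally have 1: "(\<Sum>x\<in>I. Z (a, x) * unit_mat ((x, b) # h)) = Z (a, b) * unit_mat h" .
  have u: "(\<lambda>h'. unit_mat (c # h')) = (\<lambda>h'. (if a = b then 1 else 0) * unit_mat h' + 0 * unit_mat h')"
    by (auto simp: unit_mat_def c)
  show ?case using 1 Cons unfolding c
    by (simp add: u[unfolded c] der_lincomb ins_lincomb)
qed simp

text \<open>Contributions of Z and Z' at different factors commute, so only those at a common factor
  survive, and they form the commutator.\<close>

lemma der_commutator:
  "der I Z (der I Z' R) h - der I Z' (der I Z R) h =
    der I (\<lambda>c. 1 * mat_comp I Z Z' c + (- 1) * mat_comp I Z' Z c) R h"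
proof (induction h arbitrary: R)
  case (Cons c h)
  have 1: "der I Z (\<lambda>h'. der I Z' R (c # h')) h =
      (\<Sum>a\<in>I. Z' (fst c, a) * der I Z (\<lambda>h'. R ((a, snd c) # h')) h) + der I Z (der I Z' (\<lambda>h'. R (c # h'))) h" for Z Z'
    using der_lincomb[of I Z 1 "\<lambda>h'. \<Sum>a\<in>I. Z' (fst c, a) * R ((a, snd c) # h')" 1 "der I Z' (\<lambda>h'. R (c # h'))" h]
    by (simp add: der_sum)
  have 2: "(\<Sum>a\<in>I. Z (fst c, a) * der I Z' R ((a, snd c) # h)) =
      (\<Sum>a\<in>I. mat_comp I Z Z' (fst c, a) * R ((a, snd c) # h)) +
      (\<Sum>a\<in>I. Z (fst c, a) * der I Z' (\<lambda>h'. R ((a, snd c) # h')) h)" for Z Z'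
  proof -
    have "(\<Sum>a\<in>I. Z (fst c, a) * (\<Sum>b\<in>I. Z' (a, b) * R ((b, snd c) # h))) =
        (\<Sum>a\<in>I. mat_comp I Z Z' (fst c, a) * R ((a, snd c) # h))"
      unfolding mat_comp_def sum_distrib_left sum_distrib_right split by (subst sum.swap) (simp add: mult_ac)
    then show ?thesis by (simp add: ring_distribs sum.distrib)
  qed
  have "der I Z (der I Z' R) (c # h) - der I Z' (der I Z R) (c # h) =
    (\<Sum>a\<in>I. mat_comp I Z Z' (fst c, a) * R ((a, snd c) # h)) -
    (\<Sum>a\<in>I. mat_comp I Z' Z (fst c, a) * R ((a, snd c) # h)) +
    (der I Z (der I Z' (\<lambda>h'. R (c # h'))) h - der I Z' (der I Z (\<lambda>h'. R (c # h'))) h)"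
    unfolding der.simps(2)[of I Z "der I Z' R"] der.simps(2)[of I Z' "der I Z R"] 1 2 by simp
  then show ?case unfolding Cons by (simp add: ring_distribs sum_subtractf)
qed simp

text \<open>The sum of an elementary matrix and its image under a \<mapsto> -a. These sums span the
  matrices that commute with this involution.\<close>

definition pair_mat :: "rat \<Rightarrow> rat \<Rightarrow> rat \<times> rat \<Rightarrow> rat" where
  "pair_mat a b = (\<lambda>c. (if c = (a, b) then 1 else 0) + (if c = (- a, - b) then 1 else 0))"

lemma pair_mat_uminus: "pair_mat (- a) (- b) = pair_mat a b"
  by (auto simp: pair_mat_def)

text \<open>The associative algebra generated by the derivations from G, with products written as
  applied to the identity matrix. The rule \<open>cong\<close> discards lists that do not index an
  entry on the m-th tensor power.\<close>

inductive_set derivation_span :: "rat set \<Rightarrow> nat \<Rightarrow> (rat \<times> rat \<Rightarrow> rat) set \<Rightarrow> pmat set"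
  for I :: "rat set" and m :: nat and G :: "(rat \<times> rat \<Rightarrow> rat) set" where
  unit: "unit_mat \<in> derivation_span I m G"
| lincomb: "R \<in> derivation_span I m G \<Longrightarrow> S \<in> derivation_span I m G \<Longrightarrow>
    (\<lambda>h. x * R h + y * S h) \<in> derivation_span I m G"
| der: "Z \<in> G \<Longrightarrow> R \<in> derivation_span I m G \<Longrightarrow> der I Z R \<in> derivation_span I m G"
| cong: "R \<in> derivation_span I m G \<Longrightarrow>
    (\<And>h. length h = m \<Longrightarrow> set h \<subseteq> I \<times> I \<Longrightarrow> R h = S h) \<Longrightarrow> S \<in> derivation_span I m G"

section \<open>Derivations that preserve the generated algebra\<close>

locale symmetric_index =
  fixes I :: "rat set" and m :: nat and G :: "(rat \<times> rat \<Rightarrow> rat) set"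
  assumes finite_I: "finite I" and uminus_I: "\<And>a. a \<in> I \<Longrightarrow> - a \<in> I" and nonzero_I: "0 \<notin> I"
begin

abbreviation "DS \<equiv> derivation_span I m G"

text \<open>The stable matrices form a Lie algebra that contains G and the identity, since the
  derivation by the identity is multiplication by m. The aim is to find all matrices commuting with
  a \<mapsto> -a in it.\<close>

definition stable :: "(rat \<times> rat \<Rightarrow> rat) \<Rightarrow> bool" where
  "stable Z \<longleftrightarrow> (\<forall>R\<in>DS. der I Z R \<in> DS)"

lemma stable_gen: "Z \<in> G \<Longrightarrow> stable Z"
  by (simp add: stable_def derivation_span.der)

lemma stable_lincomb:
  assumes "stable Z" "stable Z'"
  shows "stable (\<lambda>c. x * Z c + y * Z' c)"
  unfolding stable_def
proof
  fix R assume R: "R \<in> DS"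
  have "(\<lambda>h. x * der I Z R h + y * der I Z' R h) \<in> DS"
    by (rule derivation_span.lincomb) (use assms R in \<open>auto simp: stable_def\<close>)
  then show "der I (\<lambda>c. x * Z c + y * Z' c) R \<in> DS"
    by (rule derivation_span.cong) (simp add: der_lincomb_mat)
qed

lemma stable_cong:
  assumes "stable Z" "\<And>a b. a \<in> I \<Longrightarrow> b \<in> I \<Longrightarrow> Z (a, b) = Z' (a, b)"
  shows "stable Z'"
  unfolding stable_def
proof
  fix R assume "R \<in> DS"
  then have "der I Z R \<in> DS" using assms(1) by (simp add: stable_def)
  then show "der I Z' R \<in> DS"
    by (rule derivation_span.cong) (rule der_cong_mat[of I Z Z'], rule assms(2))
qed

lemma stable_ident: "stable (\<lambda>(a, b). if a = b then 1 else 0)"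
  unfolding stable_def
proof
  fix R assume "R \<in> DS"
  then have "(\<lambda>h. of_nat m * R h + 0 * R h) \<in> DS" by (intro derivation_span.lincomb)
  then show "der I (\<lambda>(a, b). if a = b then 1 else 0) R \<in> DS"
    by (rule derivation_span.cong) (simp add: der_ident[OF finite_I])
qed

lemma stable_commutator:
  assumes "stable Z" "stable Z'"
    and "\<And>a b. a \<in> I \<Longrightarrow> b \<in> I \<Longrightarrow> mat_comp I Z Z' (a, b) - mat_comp I Z' Z (a, b) = Y (a, b)"
  shows "stable Y"
proof (rule stable_cong)
  show "stable (\<lambda>c. 1 * mat_comp I Z Z' c + (- 1) * mat_comp I Z' Z c)"
    unfolding stable_def
  proof
    fix R assume R: "R \<in> DS"
    then have "der I Z (der I Z' R) \<in> DS" "der I Z' (der I Z R) \<in> DS"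
      using assms by (auto simp: stable_def)
    then have "(\<lambda>h. 1 * der I Z (der I Z' R) h + (- 1) * der I Z' (der I Z R) h) \<in> DS"
      by (rule derivation_span.lincomb)
    then show "der I (\<lambda>c. 1 * mat_comp I Z Z' c + (- 1) * mat_comp I Z' Z c) R \<in> DS"
      by (rule derivation_span.cong) (subst der_commutator[symmetric], simp)
  qed
qed (use assms(3) in simp)

lemma stable_sum:
  assumes "\<And>a. a \<in> A \<Longrightarrow> stable (Z a)"
  shows "stable (\<lambda>c. \<Sum>a\<in>A. x a * Z a c)"
  using assms
proof (induction A rule: infinite_finite_induct)
  case (insert a A)
  then have "stable (\<lambda>c. x a * Z a c + 1 * (\<Sum>a\<in>A. x a * Z a c))"
    by (intro stable_lincomb) auto
  with insert show ?case by simp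
next
  case (infinite A)
  then show ?case using stable_lincomb[OF stable_ident stable_ident, of 0 0] by simp
next
  case empty
  then show ?case using stable_lincomb[OF stable_ident stable_ident, of 0 0] by simp
qed

text \<open>They multiply like elementary matrices. As b is nonzero, b and -b are different and each
  term of one factor meets exactly one term of the other.\<close>

lemma mat_comp_pair_mat:
  assumes "b \<in> I"
  shows "mat_comp I (pair_mat a b) (pair_mat b d) (x, y) = pair_mat a d (x, y)"
proof -
  have b: "b \<noteq> 0" "- b \<in> I" using assms nonzero_I uminus_I by auto
  have "mat_comp I (pair_mat a b) (pair_mat b d) (x, y) =
      (\<Sum>c\<in>I. (if c = b then (if x = a then pair_mat b d (b, y) else 0) else 0) +
        (if c = - b then (if x = - a then pair_mat b d (- b, y) else 0) else 0))"
    unfolding mat_comp_def split by (rule sum.cong) (auto simp: pair_mat_def)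
  also have "\<dots> = (if x = a then pair_mat b d (b, y) else 0) + (if x = - a then pair_mat b d (- b, y) else 0)"
    using finite_I assms b by (simp add: sum.distrib)
  also have "\<dots> = pair_mat a d (x, y)"
    using b by (auto simp: pair_mat_def)
  finally show ?thesis .
qed

lemma mat_comp_pair_mat_zero:
  assumes "d \<noteq> a" "d \<noteq> - a"
  shows "mat_comp I (pair_mat b d) (pair_mat a c) (x, y) = 0"
  unfolding mat_comp_def split by (rule sum.neutral) (use assms in \<open>auto simp: pair_mat_def\<close>)

lemma stable_pair_mat_trans:
  assumes "stable (pair_mat a b)" "stable (pair_mat b d)" "b \<in> I" "d \<noteq> a" "d \<noteq> - a"
  shows "stable (pair_mat a d)"
  by (rule stable_commutator[OF assms(1,2)])
    (simp add: mat_comp_pair_mat mat_comp_pair_mat_zero assms)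

lemma stable_pair_mat_diff:
  assumes "stable (pair_mat a b)" "stable (pair_mat b a)" "a \<in> I" "b \<in> I"
  shows "stable (\<lambda>c. pair_mat a a c - pair_mat b b c)"
  by (rule stable_commutator[OF assms(1,2)]) (simp add: mat_comp_pair_mat assms)

text \<open>Since \<open>pair_mat a b\<close> is also \<open>pair_mat (- a) (- b)\<close>, it can be
  composed with \<open>pair_mat b (- a)\<close> on either side, and both products survive in the
  commutator.\<close>

lemma stable_pair_mat_diff_uminus:
  assumes "stable (pair_mat a b)" "stable (pair_mat b (- a))" "a \<in> I" "b \<in> I"
  shows "stable (\<lambda>c. pair_mat a (- a) c - pair_mat b (- b) c)"
proof (rule stable_commutator[OF assms(1,2)])
  fix x y
  have "mat_comp I (pair_mat b (- a)) (pair_mat (- a) (- b)) (x, y) = pair_mat b (- b) (x, y)"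
    by (rule mat_comp_pair_mat[OF uminus_I[OF assms(3)]])
  then show "mat_comp I (pair_mat a b) (pair_mat b (- a)) (x, y) - mat_comp I (pair_mat b (- a)) (pair_mat a b) (x, y) =
      pair_mat a (- a) (x, y) - pair_mat b (- b) (x, y)"
    by (simp add: mat_comp_pair_mat assms pair_mat_uminus)
qed

end

text \<open>The operators on V to which e_i, f_i and t specialize at p = q = 1.\<close>

definition iota_mats :: "nat \<Rightarrow> (rat \<times> rat \<Rightarrow> rat) set" where
  "iota_mats r = {pair_mat (lower i) (upper i) | i. 1 \<le> i \<and> i \<le> int r} \<union>
    {pair_mat (upper i) (lower i) | i. 1 \<le> i \<and> i \<le> int r} \<union> {pair_mat (lower 0) (upper 0)}"

locale iota_index = symmetric_index "index_set r" m "iota_mats r" for r m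
begin

lemma lower_mem: "1 \<le> j \<Longrightarrow> j \<le> int r + 1 \<Longrightarrow> lower j \<in> index_set r"
  by (auto simp: index_set_eq_lower)

lemma stable_step:
  assumes "1 \<le> i" "i \<le> int r"
  shows "stable (pair_mat (lower i) (lower (i + 1)))" "stable (pair_mat (lower (i + 1)) (lower i))"
proof -
  have "pair_mat (lower i) (lower (i + 1)) \<in> iota_mats r" "pair_mat (lower (i + 1)) (lower i) \<in> iota_mats r"
    using assms by (auto simp: iota_mats_def upper_eq_lower)
  then show "stable (pair_mat (lower i) (lower (i + 1)))" "stable (pair_mat (lower (i + 1)) (lower i))"
    using stable_gen by blast+
qed

lemma stable_up:
  assumes "1 \<le> j"
  shows "j + 1 + int n \<le> int r + 1 \<Longrightarrow> stable (pair_mat (lower j) (lower (j + 1 + int n)))"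
proof (induction n)
  case 0
  then show ?case
    using assms by (simp add: stable_step)
next
  case (Suc n)
  have "stable (pair_mat (lower (j + 1 + int n)) (lower (j + 1 + int n + 1)))"
    using Suc.prems assms by (intro stable_step) auto
  from stable_pair_mat_trans[OF _ this, of "lower j"]
  have "stable (pair_mat (lower j) (lower (j + 1 + int n + 1)))"
    using Suc assms by (auto simp: lower_mem uminus_lower)
  then show ?case by (simp add: add_ac)
qed

lemma stable_down:
  assumes "1 \<le> j"
  shows "j + 1 + int n \<le> int r + 1 \<Longrightarrow> stable (pair_mat (lower (j + 1 + int n)) (lower j))"
proof (induction n)
  case 0
  then show ?case
    using assms by (simp add: stable_step)
next
  case (Suc n)
  have "stable (pair_mat (lower (j + 1 + int n + 1)) (lower (j + 1 + int n)))"
    using Suc.prems assms by (intro stable_step) auto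
  from stable_pair_mat_trans[OF this, of "lower j"]
  have "stable (pair_mat (lower (j + 1 + int n + 1)) (lower j))"
    using Suc assms by (auto simp: lower_mem uminus_lower)
  then show ?case by (simp add: add_ac)
qed

lemma stable_positive:
  assumes "1 \<le> j" "j \<le> int r + 1" "1 \<le> k" "k \<le> int r + 1" "j \<noteq> k"
  shows "stable (pair_mat (lower j) (lower k))"
proof (cases "j < k")
  case True
  then show ?thesis using stable_up[of j "nat (k - j - 1)"] assms by simp
next
  case False
  then show ?thesis using stable_down[of k "nat (j - k - 1)"] assms by simp
qed

lemma stable_t: "stable (pair_mat (lower 1) (- lower 1))"
proof -
  have "stable (pair_mat (lower 0) (upper 0))" by (rule stable_gen) (simp add: iota_mats_def)
  moreover have "lower 0 = - lower 1" "upper 0 = - (- lower 1)" by (simp_all add: uminus_lower upper_eq_lower)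
  ultimately show ?thesis by (simp only: pair_mat_uminus)
qed

text \<open>The sign can be changed only at index 1/2, by t. So the path goes from
  \<open>lower j\<close> to \<open>lower 1\<close>, on to \<open>- lower 1\<close>, and from there
  to \<open>- lower k\<close>.\<close>

lemma stable_mixed:
  assumes "1 \<le> j" "j \<le> int r + 1" "1 \<le> k" "k \<le> int r + 1" "j \<noteq> k"
  shows "stable (pair_mat (lower j) (- lower k))"
proof -
  have 1: "stable (pair_mat (lower j) (- lower 1))"
  proof (cases "j = 1")
    case False
    show ?thesis
      by (rule stable_pair_mat_trans[OF stable_positive stable_t]) (use False assms in \<open>auto intro!: lower_mem simp: uminus_lower\<close>)
  qed (simp add: stable_t)
  show ?thesis
  proof (cases "k = 1")
    case False
    have "stable (pair_mat (- lower 1) (- lower k))"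
      using stable_positive[of 1 k] assms False by (simp add: pair_mat_uminus)
    moreover have "- lower 1 \<in> index_set r" by (intro uminus_I lower_mem) auto
    ultimately show ?thesis
      by (rule stable_pair_mat_trans[OF 1]) (use assms in \<open>auto simp: uminus_lower\<close>)
  qed (use 1 in simp)
qed

lemma stable_diag_uminus:
  assumes "1 \<le> j" "j \<le> int r + 1"
  shows "stable (pair_mat (lower j) (- lower j))"
proof (cases "j = 1")
  case False
  have "stable (\<lambda>c. pair_mat (lower j) (- lower j) c - pair_mat (lower 1) (- lower 1) c)"
    by (rule stable_pair_mat_diff_uminus) (use assms False in \<open>auto intro!: stable_positive stable_mixed lower_mem\<close>)
  from stable_lincomb[OF this stable_t, of 1 1] show ?thesis by simp
qed (simp add: stable_t)

lemma stable_diag_diff: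
  assumes "1 \<le> j" "j \<le> int r + 1" "1 \<le> k" "k \<le> int r + 1"
  shows "stable (\<lambda>c. pair_mat (lower j) (lower j) c - pair_mat (lower k) (lower k) c)"
proof (cases "j = k")
  case True
  then show ?thesis using stable_lincomb[OF stable_ident stable_ident, of 0 0] by simp
next
  case False
  show ?thesis
    by (rule stable_pair_mat_diff) (use assms False in \<open>auto intro!: stable_positive lower_mem\<close>)
qed

text \<open>Commutators give only differences of diagonal matrices. The missing direction is the
  identity: the sum of all differences with \<open>lower j\<close>, plus the identity, is r + 1
  times the desired matrix.\<close>

lemma stable_diag:
  assumes "1 \<le> j" "j \<le> int r + 1"
  shows "stable (pair_mat (lower j) (lower j))"
proof -
  let ?K = "{1..int r + 1}"
  let ?D = "\<lambda>k c. pair_mat (lower j) (lower j) c - pair_mat (lower k) (lower k) c"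
  have "stable (\<lambda>c. \<Sum>k\<in>?K. 1 * ?D k c)"
    by (rule stable_sum) (use assms in \<open>auto intro: stable_diag_diff\<close>)
  from stable_lincomb[OF stable_ident this, of "1 / of_int (int r + 1)" "1 / of_int (int r + 1)"]
  show ?thesis
  proof (rule stable_cong)
    fix a b assume a: "a \<in> index_set r" and b: "b \<in> index_set r"
    obtain i where i: "a = lower i" "- int r \<le> i" "i \<le> int r + 1" using a by (auto simp: index_set_eq_lower)
    have sum1: "(\<Sum>k\<in>?K. pair_mat (lower k) (lower k) (a, b)) = (if a = b then 1 else 0)"
    proof -
      have "(\<Sum>k\<in>?K. pair_mat (lower k) (lower k) (a, b)) =
        (\<Sum>k\<in>?K. if k = (if i \<ge> 1 then i else 1 - i) then (if a = b then 1 else 0) else 0)"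
      proof (rule sum.cong)
        fix k assume "k \<in> ?K"
        moreover obtain i' where "b = lower i'" using b by (auto simp: index_set_eq_lower)
        ultimately show "pair_mat (lower k) (lower k) (a, b) =
            (if k = (if i \<ge> 1 then i else 1 - i) then (if a = b then 1 else 0) else 0)"
          by (simp add: pair_mat_def i(1) uminus_lower)
      qed simp
      also have "\<dots> = (if a = b then 1 else 0)" using i by auto
      finally show ?thesis .
    qed
    have "(\<Sum>k\<in>?K. 1 * ?D k (a, b)) = of_int (int r + 1) * pair_mat (lower j) (lower j) (a, b) - (if a = b then 1 else 0)"
      by (simp only: mult_1 sum_subtractf sum1) simp
    moreover have "(of_int (int r + 1) :: rat) \<noteq> 0" by linarith
    ultimately show "1 / of_int (int r + 1) * (case (a, b) of (a, b) \<Rightarrow> if a = b then 1 else 0) +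
        1 / of_int (int r + 1) * (\<Sum>k\<in>?K. 1 * ?D k (a, b)) = pair_mat (lower j) (lower j) (a, b)"
      by (simp only: split right_diff_distrib) (simp del: of_int_add)
  qed
qed

lemma stable_pair_mat:
  assumes "a \<in> index_set r" "b \<in> index_set r"
  shows "stable (pair_mat a b)"
proof -
  have *: "\<exists>j. 1 \<le> j \<and> j \<le> int r + 1 \<and> (a = lower j \<or> a = - lower j)" if a: "a \<in> index_set r" for a
  proof -
    obtain i where i: "a = lower i" "- int r \<le> i" "i \<le> int r + 1" using a by (auto simp: index_set_eq_lower)
    show ?thesis
      by (rule exI[of _ "if i \<ge> 1 then i else 1 - i"]) (use i in \<open>auto simp: uminus_lower\<close>)
  qed
  obtain j k where j: "1 \<le> j" "j \<le> int r + 1" "a = lower j \<or> a = - lower j"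
    and k: "1 \<le> k" "k \<le> int r + 1" "b = lower k \<or> b = - lower k"
    using *[OF assms(1)] *[OF assms(2)] by blast
  have "pair_mat (- lower j) (lower k) = pair_mat (lower j) (- lower k)"
    using pair_mat_uminus[of "lower j" "- lower k"] by simp
  moreover have "stable (pair_mat (lower j) (lower k))" "stable (pair_mat (lower j) (- lower k))"
    using j k by (cases "j = k"; auto intro: stable_diag stable_diag_uminus stable_positive stable_mixed)+
  ultimately show ?thesis using j(3) k(3) by (auto simp: pair_mat_uminus)
qed

end

section \<open>Operators commuting with the Weyl group\<close>

context iota_index begin

abbreviation "X \<equiv> index_set r \<times> index_set r"

text \<open>Equivalently, Y commutes with the involution a \<mapsto> -a of the basis of V.\<close>

definition even_mat :: "(rat \<times> rat \<Rightarrow> rat) \<Rightarrow> bool" where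
  "even_mat Y \<longleftrightarrow> (\<forall>a\<in>index_set r. \<forall>b\<in>index_set r. Y (- a, - b) = Y (a, b))"

lemma uminus_bij: "bij_betw uminus (index_set r) (index_set r)"
  by (rule bij_betwI[where g = uminus]) (auto intro: uminus_I)

lemma even_mat_comp: "even_mat Z \<Longrightarrow> even_mat Y \<Longrightarrow> even_mat (mat_comp (index_set r) Z Y)"
  unfolding even_mat_def mat_comp_def split
proof (intro ballI)
  fix a b assume Z: "\<forall>a\<in>index_set r. \<forall>b\<in>index_set r. Z (- a, - b) = Z (a, b)"
    and Y: "\<forall>a\<in>index_set r. \<forall>b\<in>index_set r. Y (- a, - b) = Y (a, b)"
    and ab: "a \<in> index_set r" "b \<in> index_set r"
  have "(\<Sum>c\<in>index_set r. Z (- a, c) * Y (c, - b)) = (\<Sum>c\<in>index_set r. Z (- a, - c) * Y (- c, - b))"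
    by (rule sum.reindex_bij_betw[OF uminus_bij, symmetric])
  also have "\<dots> = (\<Sum>c\<in>index_set r. Z (a, c) * Y (c, b))"
    by (rule sum.cong) (use Z Y ab in auto)
  finally show "(\<Sum>c\<in>index_set r. Z (- a, c) * Y (c, - b)) = (\<Sum>c\<in>index_set r. Z (a, c) * Y (c, b))" .
qed

lemma sum_pair_mat:
  assumes "d \<in> X"
  shows "(\<Sum>c\<in>X. pair_mat (fst c) (snd c) d * F c) = F d + F (- fst d, - snd d)"
proof -
  have m: "(- fst d, - snd d) \<in> X" using assms uminus_I by auto
  have "(\<Sum>c\<in>X. pair_mat (fst c) (snd c) d * F c) =
      (\<Sum>c\<in>X. (if c = d then F d else 0) + (if c = (- fst d, - snd d) then F (- fst d, - snd d) else 0))"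
    by (rule sum.cong) (cases d, auto simp: pair_mat_def)
  also have "\<dots> = F d + F (- fst d, - snd d)"
    using assms m finite_I by (simp add: sum.distrib)
  finally show ?thesis .
qed

lemma stable_even_mat:
  assumes "even_mat Y"
  shows "stable Y"
proof (rule stable_cong)
  \<comment> \<open>The factor 1/2 appears because c and its negative give the same
    \<open>pair_mat\<close>.\<close>
  show "stable (\<lambda>d. \<Sum>c\<in>X. (Y c / 2) * pair_mat (fst c) (snd c) d)"
    by (rule stable_sum) (auto intro: stable_pair_mat)
  fix a b assume "a \<in> index_set r" "b \<in> index_set r"
  then show "(\<Sum>c\<in>X. (Y c / 2) * pair_mat (fst c) (snd c) (a, b)) = Y (a, b)"
    using sum_pair_mat[of "(a, b)" "\<lambda>c. Y c / 2"] assms by (simp add: mult.commute even_mat_def)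
qed

text \<open>Spanned by symmetrized products: n even matrices are placed at distinct factors in all
  possible ways, with the identity elsewhere. Agreement is required for lists of every length, since
  \<open>ins\<close> evaluates its argument at shorter lists.\<close>

inductive_set sym_span :: "nat \<Rightarrow> pmat set" for n :: nat where
  basis: "length Ys = n \<Longrightarrow> (\<And>Y. Y \<in> set Ys \<Longrightarrow> even_mat Y) \<Longrightarrow> foldr ins Ys unit_mat \<in> sym_span n"
| lincomb: "R \<in> sym_span n \<Longrightarrow> S \<in> sym_span n \<Longrightarrow> (\<lambda>h. x * R h + y * S h) \<in> sym_span n"
| agree: "R \<in> sym_span n \<Longrightarrow> (\<And>h. set h \<subseteq> X \<Longrightarrow> R h = S h) \<Longrightarrow> S \<in> sym_span n"

lemma sym_span_zero: "(\<lambda>h. 0) \<in> sym_span n"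
proof -
  have "foldr ins (replicate n (\<lambda>c. 0)) unit_mat \<in> sym_span n"
    by (rule sym_span.basis) (auto simp: even_mat_def)
  from sym_span.lincomb[OF this this, of 0 0] show ?thesis by simp
qed

lemma sym_span_sum:
  "(\<And>a. a \<in> A \<Longrightarrow> R a \<in> sym_span n) \<Longrightarrow> (\<lambda>h. \<Sum>a\<in>A. x a * R a h) \<in> sym_span n"
proof (induction A rule: infinite_finite_induct)
  case (insert a A)
  then have "(\<lambda>h. x a * R a h + 1 * (\<Sum>a\<in>A. x a * R a h)) \<in> sym_span n"
    by (intro sym_span.lincomb) auto
  with insert show ?case by simp
qed (simp_all add: sym_span_zero)

lemma sym_span_ins: "R \<in> sym_span n \<Longrightarrow> even_mat Y \<Longrightarrow> ins Y R \<in> sym_span (Suc n)"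
proof (induction rule: sym_span.induct)
  case (basis Ys)
  then have "foldr ins (Y # Ys) unit_mat \<in> sym_span (Suc n)"
    by (intro sym_span.basis) auto
  then show ?case by simp
next
  case (lincomb R S x y)
  then have "(\<lambda>h. x * ins Y R h + y * ins Y S h) \<in> sym_span (Suc n)"
    by (intro sym_span.lincomb) auto
  then show ?case by (simp add: ins_lincomb[symmetric])
next
  case (agree R S)
  then have "ins Y R \<in> sym_span (Suc n)" by simp
  then show ?case by (rule sym_span.agree) (intro ins_cong agree.hyps(2), blast)
qed

text \<open>Multiplying by a derivation inserts one more factor, up to products with the same
  number of factors.\<close>

lemma der_foldr_ins:
  assumes "even_mat Z"
  shows "(\<And>Y. Y \<in> set Ys \<Longrightarrow> even_mat Y) \<Longrightarrow>
    (\<lambda>h. der (index_set r) Z (foldr ins Ys unit_mat) h - ins Z (foldr ins Ys unit_mat) h) \<in> sym_span (length Ys)"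
proof (induction Ys)
  case Nil
  show ?case
    by (rule sym_span.agree[OF sym_span_zero]) (simp add: der_unit_mat)
next
  case (Cons Y Ys)
  let ?S = "foldr ins Ys unit_mat" and ?I = "index_set r"
  let ?R = "\<lambda>h. der ?I Z ?S h - ins Z ?S h"
  have Y: "even_mat Y" and Ys: "\<And>Y. Y \<in> set Ys \<Longrightarrow> even_mat Y" using Cons.prems by auto
  have 1: "ins Y ?R \<in> sym_span (Suc (length Ys))"
    by (rule sym_span_ins[OF Cons.IH[OF Ys] Y])
  have 2: "ins (mat_comp ?I Z Y) ?S \<in> sym_span (Suc (length Ys))"
    by (rule sym_span_ins[OF sym_span.basis even_mat_comp[OF assms Y]]) (use Ys in auto)
  have "(\<lambda>h. 1 * ins (mat_comp ?I Z Y) ?S h + 1 * ins Y ?R h) \<in> sym_span (Suc (length Ys))"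
    by (rule sym_span.lincomb[OF 2 1])
  moreover have "1 * ins (mat_comp ?I Z Y) ?S h + 1 * ins Y ?R h =
      der ?I Z (foldr ins (Y # Ys) unit_mat) h - ins Z (foldr ins (Y # Ys) unit_mat) h" for h
    using ins_lincomb[of Y 1 "der ?I Z ?S" "- 1" "ins Z ?S" h] by (simp add: der_ins ins_commute[of Z Y])
  ultimately show ?case by (simp only: list.size add_Suc_right add_0_right)
qed

text \<open>Induction along the filtration by the number of inserted factors: \<open>ins Y\<close>
  differs from the derivation by Y only in an element with fewer factors, and derivations preserve
  \<open>DS\<close>.\<close>

lemma sym_span_subset: "R \<in> sym_span n \<Longrightarrow> R \<in> DS"
proof (induction n arbitrary: R)
  case 0
  then show ?case
    by (induction rule: sym_span.induct) (auto intro: derivation_span.intros)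
next
  case (Suc n)
  from Suc.prems show ?case
  proof (induction rule: sym_span.induct)
    case (basis Ys)
    then obtain Y Ys' where Ys: "Ys = Y # Ys'" "length Ys' = n" by (cases Ys) auto
    let ?S = "foldr ins Ys' unit_mat" and ?I = "index_set r"
    have Y: "even_mat Y" and Ys': "\<And>Y. Y \<in> set Ys' \<Longrightarrow> even_mat Y" using basis Ys by auto
    have "?S \<in> DS" by (rule Suc.IH, rule sym_span.basis) (use Ys Ys' in auto)
    then have "der ?I Y ?S \<in> DS" using stable_even_mat[OF Y] by (simp add: stable_def)
    moreover have "(\<lambda>h. der ?I Y ?S h - ins Y ?S h) \<in> DS"
      using der_foldr_ins[OF Y, of Ys'] Ys Ys' by (intro Suc.IH) simp
    ultimately have "(\<lambda>h. 1 * der ?I Y ?S h + (- 1) * (der ?I Y ?S h - ins Y ?S h)) \<in> DS"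
      by (rule derivation_span.lincomb)
    then show ?case by (simp add: Ys)
  next
    case (lincomb R S x y)
    then show ?case by (intro derivation_span.lincomb)
  next
    case (agree R S)
    show ?case by (rule derivation_span.cong[OF agree.IH agree.hyps(2)])
  qed
qed

text \<open>Invariance of the entries when the Weyl group acts on row and column index
  simultaneously. As the group permutes the basis, this means commuting with the group.\<close>

definition invariant :: "nat \<Rightarrow> pmat \<Rightarrow> bool" where
  "invariant n T \<longleftrightarrow>
    (\<forall>xs c d ys. length (xs @ c # d # ys) = n \<longrightarrow> set (xs @ c # d # ys) \<subseteq> X \<longrightarrow>
      T (xs @ c # d # ys) = T (xs @ d # c # ys)) \<and>
    (\<forall>a b h. length ((a, b) # h) = n \<longrightarrow> set ((a, b) # h) \<subseteq> X \<longrightarrow> T ((a, b) # h) = T ((- a, - b) # h))"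

lemma invariant_swap:
  "invariant n T \<Longrightarrow> length ys + 2 = n \<Longrightarrow> c \<in> X \<Longrightarrow> d \<in> X \<Longrightarrow> set ys \<subseteq> X \<Longrightarrow> T (c # d # ys) = T (d # c # ys)"
  unfolding invariant_def by (drule conjunct1, drule spec[of _ "[]"], drule spec[of _ c], drule spec[of _ d], drule spec[of _ ys]) simp

lemma invariant_sign:
  "invariant n T \<Longrightarrow> length h + 1 = n \<Longrightarrow> a \<in> index_set r \<Longrightarrow> b \<in> index_set r \<Longrightarrow> set h \<subseteq> X \<Longrightarrow>
    T ((a, b) # h) = T ((- a, - b) # h)"
  unfolding invariant_def by simp

text \<open>The only sign change at hand concerns the first pair, so the one at the second pair is
  obtained by conjugating with a swap.\<close>

lemma invariant_Cons:
  assumes T: "invariant (Suc n) T" and c: "c \<in> X"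
  shows "invariant n (\<lambda>h. T (c # h))"
  unfolding invariant_def
proof (intro conjI allI impI)
  fix xs d e ys assume *: "length (xs @ d # e # ys) = n" "set (xs @ d # e # ys) \<subseteq> X"
  show "T (c # xs @ d # e # ys) = T (c # xs @ e # d # ys)"
    using T[unfolded invariant_def, THEN conjunct1, THEN spec[of _ "c # xs"], THEN spec[of _ d],
        THEN spec[of _ e], THEN spec[of _ ys]] * c by simp
next
  fix a b h assume *: "length ((a, b) # h) = n" "set ((a, b) # h) \<subseteq> X"
  then have ab: "(a, b) \<in> X" "(- a, - b) \<in> X" "set h \<subseteq> X" using uminus_I by auto
  have "T (c # (a, b) # h) = T ((a, b) # c # h)"
    using invariant_swap[OF T _ c ab(1,3)] * by simp
  also have "\<dots> = T ((- a, - b) # c # h)"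
    using invariant_sign[OF T, of "c # h" a b] * ab c by simp
  also have "\<dots> = T (c # (- a, - b) # h)"
    using invariant_swap[OF T _ c ab(2,3)] * by simp
  finally show "T (c # (a, b) # h) = T (c # (- a, - b) # h)" .
qed

text \<open>Taking out any one of the pairs of h and putting it in front, with either sign, leaves T
  unchanged. There are \<open>length h\<close> positions and two signs.\<close>

lemma invariant_sum_ins:
  "invariant (length h) T \<Longrightarrow> set h \<subseteq> X \<Longrightarrow>
    (\<Sum>c\<in>X. ins (pair_mat (fst c) (snd c)) (\<lambda>h'. T (c # h')) h) = 2 * of_nat (length h) * T h"
proof (induction h arbitrary: T)
  case (Cons d h)
  obtain a b where d: "d = (a, b)" by (cases d)
  have dX: "d \<in> X" "set h \<subseteq> X" using Cons.prems by auto
  let ?M = "\<lambda>c. pair_mat (fst c) (snd c)"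
  have "(\<Sum>c\<in>X. ?M c d * T (c # h)) = T (d # h) + T ((- fst d, - snd d) # h)"
    by (rule sum_pair_mat[OF dX(1), of "\<lambda>c. T (c # h)"])
  also have "\<dots> = 2 * T (d # h)"
    using invariant_sign[OF Cons.prems(1), of h a b] dX d by simp
  finally have 1: "(\<Sum>c\<in>X. ?M c d * T (c # h)) = 2 * T (d # h)" .
  have "(\<Sum>c\<in>X. ins (?M c) (\<lambda>h'. T (c # d # h')) h) = (\<Sum>c\<in>X. ins (?M c) (\<lambda>h'. T (d # c # h')) h)"
  proof (intro sum.cong refl ins_cong)
    fix c h' assume "c \<in> X" "length h = Suc (length h')" "set h' \<subseteq> set h"
    then show "T (c # d # h') = T (d # c # h')"
      using dX by (intro invariant_swap[OF Cons.prems(1)]) auto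
  qed
  also have "\<dots> = 2 * of_nat (length h) * T (d # h)"
    by (rule Cons.IH[where T = "\<lambda>h. T (d # h)"]) (use Cons.prems dX invariant_Cons[of "length h" T d] in auto)
  finally show ?case using 1 by (simp add: sum.distrib algebra_simps)
qed simp

lemma invariant_in_sym_span:
  "invariant n T \<Longrightarrow> \<exists>R\<in>sym_span n. \<forall>h. length h = n \<longrightarrow> set h \<subseteq> X \<longrightarrow> T h = R h"
proof (induction n arbitrary: T)
  case 0
  have "foldr ins [] unit_mat \<in> sym_span 0" by (rule sym_span.basis) auto
  from sym_span.lincomb[OF this this, of "T []" 0] have "(\<lambda>h. T [] * unit_mat h) \<in> sym_span 0" by simp
  then show ?case by (rule bexI[rotated]) (simp add: unit_mat_def)
next
  case (Suc n)
  have "\<forall>c. \<exists>R. c \<in> X \<longrightarrow> R \<in> sym_span n \<and> (\<forall>h. length h = n \<longrightarrow> set h \<subseteq> X \<longrightarrow> T (c # h) = R h)"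
    using Suc.IH[OF invariant_Cons[OF Suc.prems]] by blast
  from choice[OF this] obtain R where R: "\<And>c. c \<in> X \<Longrightarrow> R c \<in> sym_span n"
    "\<And>c h. c \<in> X \<Longrightarrow> length h = n \<Longrightarrow> set h \<subseteq> X \<Longrightarrow> T (c # h) = R c h" by blast
  let ?M = "\<lambda>c. pair_mat (fst c) (snd c)"
  \<comment> \<open>Expansion of T along its first factor, averaged over all positions and both
    signs; characteristic 0 permits the division.\<close>
  let ?S = "\<lambda>h. \<Sum>c\<in>X. (1 / (2 * of_nat (Suc n))) * ins (?M c) (R c) h"
  have even: "even_mat (?M c)" for c
    by (auto simp: even_mat_def pair_mat_def prod_eq_iff)
  have "?S \<in> sym_span (Suc n)"
    by (rule sym_span_sum) (intro sym_span_ins R even)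
  moreover have "T h = ?S h" if h: "length h = Suc n" "set h \<subseteq> X" for h
  proof -
    have "(\<Sum>c\<in>X. ins (?M c) (R c) h) = (\<Sum>c\<in>X. ins (?M c) (\<lambda>h'. T (c # h')) h)"
      by (intro sum.cong refl ins_cong R(2)[symmetric]) (use h in auto)
    also have "\<dots> = 2 * of_nat (Suc n) * T h"
      using invariant_sum_ins[of h T] Suc.prems h by simp
    finally show ?thesis by (simp add: sum_divide_distrib[symmetric] del: of_nat_Suc)
  qed
  ultimately show ?case by (intro bexI[of _ ?S]) simp
qed

lemma invariant_in_derivation_span:
  assumes "invariant m T"
  shows "T \<in> DS"
proof -
  obtain R where R: "R \<in> sym_span m" "\<forall>h. length h = m \<longrightarrow> set h \<subseteq> X \<longrightarrow> T h = R h"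
    using invariant_in_sym_span[OF assms] by (elim bexE)
  show ?thesis
    by (rule derivation_span.cong[OF sym_span_subset[OF R(1)]]) (use R(2) in simp)
qed

end

lemma iota_index: "iota_index r"
  by unfold_locales (auto simp: uminus_index_set index_set_nonzero)

section \<open>Matrices of endomorphisms of the tensor space\<close>

definition mat :: "(tensor \<Rightarrow> tensor) \<Rightarrow> rat list \<times> rat list \<Rightarrow> Qpq" where
  "mat T = (\<lambda>(f, g). Poly_Mapping.lookup (T (basis_vec g)) f)"

lemma mat_apply: "mat T (f, g) = Poly_Mapping.lookup (T (basis_vec g)) f"
  by (simp add: mat_def)

lemma End_ring_linear:
  assumes "\<phi> \<in> carrier (End_ring r m)"
  shows "v \<in> tensor_space r m \<Longrightarrow> \<phi> v \<in> tensor_space r m"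
    "u \<in> tensor_space r m \<Longrightarrow> v \<in> tensor_space r m \<Longrightarrow> \<phi> (u + v) = \<phi> u + \<phi> v"
    "v \<in> tensor_space r m \<Longrightarrow> \<phi> (scale c v) = scale c (\<phi> v)"
  using assms by (auto simp: End_ring_simps)

lemma End_ring_expansion:
  assumes \<phi>: "\<phi> \<in> carrier (End_ring r m)" and v: "v \<in> tensor_space r m"
  shows "\<phi> v = lin_extend (\<lambda>g. \<phi> (basis_vec g)) v"
proof -
  have 0: "\<phi> 0 = 0" using End_ring_linear(3)[OF \<phi>, of 0 0] by (simp add: tensor_space_zero)
  have sum: "sum F A \<in> tensor_space r m \<and> \<phi> (sum F A) = (\<Sum>a\<in>A. \<phi> (F a))"
    if "finite A" "\<And>a. a \<in> A \<Longrightarrow> F a \<in> tensor_space r m" for F and A :: "rat list set"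
    using that
    by (induction A rule: finite_induct) (auto simp: End_ring_linear[OF \<phi>] 0 tensor_space_zero tensor_space_add)
  have keys: "Poly_Mapping.keys v \<subseteq> tensor_index r m" using v by (simp add: tensor_space_eq)
  have "\<phi> v = \<phi> (\<Sum>b\<in>Poly_Mapping.keys v. scale (Poly_Mapping.lookup v b) (basis_vec b))"
    by (subst basis_vec_expansion[of v]) (rule refl)
  also have "\<dots> = (\<Sum>b\<in>Poly_Mapping.keys v. \<phi> (scale (Poly_Mapping.lookup v b) (basis_vec b)))"
    using keys by (intro sum[THEN conjunct2]) (auto intro!: tensor_space_scale simp: tensor_space_basis)
  also have "\<dots> = lin_extend (\<lambda>g. \<phi> (basis_vec g)) v"
    unfolding lin_extend_def using keys
    by (intro sum.cong refl End_ring_linear(3)[OF \<phi>]) (auto simp: tensor_space_basis)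
  finally show ?thesis .
qed

lemma lookup_End_ring:
  assumes "\<phi> \<in> carrier (End_ring r m)" "v \<in> tensor_space r m"
  shows "Poly_Mapping.lookup (\<phi> v) f = (\<Sum>k\<in>tensor_index r m. mat \<phi> (f, k) * Poly_Mapping.lookup v k)"
  unfolding End_ring_expansion[OF assms] mat_apply
  using assms(2) by (subst lin_extend_superset[of "tensor_index r m"]) (auto simp: tensor_space_eq lookup_sum mult.commute)

lemma lookup_outside: "v \<in> tensor_space r m \<Longrightarrow> f \<notin> tensor_index r m \<Longrightarrow> Poly_Mapping.lookup v f = 0"
  by (auto simp: tensor_space_eq in_keys_iff)

lemma End_ring_eqI:
  assumes \<phi>: "\<phi> \<in> carrier (End_ring r m)" and \<psi>: "\<psi> \<in> carrier (End_ring r m)"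
    and eq: "\<And>f g. f \<in> tensor_index r m \<Longrightarrow> g \<in> tensor_index r m \<Longrightarrow> mat \<phi> (f, g) = mat \<psi> (f, g)"
  shows "\<phi> = \<psi>"
proof
  fix v
  show "\<phi> v = \<psi> v"
  proof (cases "v \<in> tensor_space r m")
    case True
    show ?thesis
    proof (rule poly_mapping_eqI)
      fix f
      show "Poly_Mapping.lookup (\<phi> v) f = Poly_Mapping.lookup (\<psi> v) f"
        using True eq lookup_outside[of _ r m f] End_ring_linear(1)[OF \<phi> True] End_ring_linear(1)[OF \<psi> True]
        by (cases "f \<in> tensor_index r m") (auto simp: lookup_End_ring[OF \<phi>] lookup_End_ring[OF \<psi>])
    qed
  next
    case False
    then show ?thesis using \<phi> \<psi> by (auto simp: End_ring_simps PiE_iff extensional_def)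
  qed
qed

lemma mat_compose:
  assumes "\<phi> \<in> carrier (End_ring r m)" "\<psi> (basis_vec g) \<in> tensor_space r m"
  shows "Poly_Mapping.lookup (\<phi> (\<psi> (basis_vec g))) f = mat_mult (tensor_index r m) (mat \<phi>) (mat \<psi>) (f, g)"
  by (simp add: lookup_End_ring[OF assms] mat_mult_apply mat_apply)

definition H_end :: "nat \<Rightarrow> nat \<Rightarrow> nat \<Rightarrow> tensor \<Rightarrow> tensor" where
  "H_end r m i = restrict (H_act i) (tensor_space r m)"

lemma H_end_carrier: "i < m \<Longrightarrow> H_end r m i \<in> carrier (End_ring r m)"
  unfolding H_end_def by (intro restrict_in_End_ring linear_H_act H_act_tensor_space)

lemma mat_H_end: "g \<in> tensor_index r m \<Longrightarrow> mat (H_end r m i) (f, g) = Poly_Mapping.lookup (hecke_basis i g) f"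
  by (simp add: mat_apply H_end_def tensor_space_basis H_act_basis)

text \<open>Turns commutation with H_i into finitely many linear equations between the entries of
  \<phi>, a form that can be specialized.\<close>

lemma commutes_H_act_iff:
  assumes \<phi>: "\<phi> \<in> carrier (End_ring r m)" and i: "i < m"
  shows "(\<forall>v\<in>tensor_space r m. \<phi> (H_act i v) = H_act i (\<phi> v)) \<longleftrightarrow>
    (\<forall>f\<in>tensor_index r m. \<forall>g\<in>tensor_index r m.
      mat_mult (tensor_index r m) (mat \<phi>) (mat (H_end r m i)) (f, g) =
      mat_mult (tensor_index r m) (mat (H_end r m i)) (mat \<phi>) (f, g))" (is "?L \<longleftrightarrow> ?R")
proof -
  let ?M = "tensor_space r m"
  note h = H_end_carrier[OF i, of r]
  have c: "compose ?M \<phi> (H_end r m i) \<in> carrier (End_ring r m)" "compose ?M (H_end r m i) \<phi> \<in> carrier (End_ring r m)"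
    using monoid.m_closed[OF ring.is_monoid[OF ring_End_ring[of r m]]] \<phi> h by (auto simp: End_ring_simps(2))
  have "?L \<longleftrightarrow> compose ?M \<phi> (H_end r m i) = compose ?M (H_end r m i) \<phi>"
    using End_ring_linear(1)[OF \<phi>] by (auto simp: compose_def fun_eq_iff H_end_def restrict_def)
  also have "\<dots> \<longleftrightarrow> (\<forall>f\<in>tensor_index r m. \<forall>g\<in>tensor_index r m.
      mat (compose ?M \<phi> (H_end r m i)) (f, g) = mat (compose ?M (H_end r m i) \<phi>) (f, g))"
    using End_ring_eqI[OF c] by auto
  also have "\<dots> \<longleftrightarrow> ?R"
  proof (intro ball_cong refl)
    fix f g assume g: "g \<in> tensor_index r m"
    then have b: "basis_vec g \<in> ?M" by (simp add: tensor_space_basis)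
    show "(mat (compose ?M \<phi> (H_end r m i)) (f, g) = mat (compose ?M (H_end r m i) \<phi>) (f, g)) \<longleftrightarrow>
      (mat_mult (tensor_index r m) (mat \<phi>) (mat (H_end r m i)) (f, g) =
      mat_mult (tensor_index r m) (mat (H_end r m i)) (mat \<phi>) (f, g))"
      unfolding mat_apply compose_eq[OF b]
      by (simp only: mat_compose[where \<psi> = "H_end r m i", OF \<phi> End_ring_linear(1)[OF h b]]
        mat_compose[where \<psi> = \<phi>, OF h End_ring_linear(1)[OF \<phi> b]])
  qed
  finally show ?thesis .
qed

lemma End_hecke_iff:
  "\<phi> \<in> carrier (End_hecke r m) \<longleftrightarrow> \<phi> \<in> carrier (End_ring r m) \<and>
    (\<forall>i<m. \<forall>v\<in>tensor_space r m. \<phi> (H_act i v) = H_act i (\<phi> v))" (is "?L \<longleftrightarrow> ?R")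
proof
  assume L: ?L
  then have \<phi>: "\<phi> \<in> carrier (End_ring r m)" by (simp add: End_hecke_def)
  have "\<phi> (H_act i v) = H_act i (\<phi> v)" if i: "i < m" and v: "v \<in> tensor_space r m" for i v
  proof -
    have g: "gen i \<in> carrier (free_algebra {..<m})" using i by (intro free_algebra_closed) simp
    then have "hecke_class m (gen i) \<in> carrier (hecke_alg m)"
      by (simp add: hecke_alg_def carrier_presented_algebra)
    then have "\<phi> (\<Psi> r m (hecke_class m (gen i)) v) = \<Psi> r m (hecke_class m (gen i)) (\<phi> v)"
      using L v by (simp add: End_hecke_def)
    then show ?thesis using v End_ring_linear(1)[OF \<phi> v] by (simp add: \<Psi>_class[OF g] H_op_def)
  qed
  with \<phi> show ?R by blast
next
  assume R: ?R
  then have \<phi>: "\<phi> \<in> carrier (End_ring r m)" by blast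
  have "\<phi> (\<Psi> r m h v) = \<Psi> r m h (\<phi> v)" if h: "h \<in> carrier (hecke_alg m)" and v: "v \<in> tensor_space r m" for h v
  proof -
    obtain y where y: "y \<in> carrier (free_algebra {..<m})" "h = hecke_class m y"
      using h by (auto simp: hecke_alg_def carrier_presented_algebra)
    have "\<phi> (right_action H_act y v) = right_action H_act y (\<phi> v)"
      by (rule left_right_actions_commute[OF _ _ _ y(1) v]) (use R in \<open>auto simp: End_ring_linear[OF \<phi>]\<close>)
    then show ?thesis using v End_ring_linear(1)[OF \<phi> v] by (simp add: y(2) \<Psi>_class[OF y(1)] H_op_def)
  qed
  with \<phi> show ?L by (simp add: End_hecke_def)
qed

section \<open>Specialization of the generators\<close>

lemma linear_functional_eq:
  fixes \<phi> \<psi> :: "('b \<Rightarrow>\<^sub>0 Qpq) \<Rightarrow> Qpq"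
  assumes "\<And>u v. \<phi> (u + v) = \<phi> u + \<phi> v" "\<And>c v. \<phi> (scale c v) = c * \<phi> v"
    "\<And>u v. \<psi> (u + v) = \<psi> u + \<psi> v" "\<And>c v. \<psi> (scale c v) = c * \<psi> v"
    "\<And>b. \<phi> (basis_vec b) = \<psi> (basis_vec b)"
  shows "\<phi> v = \<psi> v"
proof -
  \<comment> \<open>A functional is viewed as a map into the free space on one basis vector, so that
    the result for linear maps applies.\<close>
  have "(\<lambda>v. scale (\<phi> v) (basis_vec ())) v = (\<lambda>v. scale (\<psi> v) (basis_vec ())) v"
    by (rule linear_map_eq_on[where v = v]) (auto simp: linear_map_def assms scale_add_left)
  then have "Poly_Mapping.lookup (scale (\<phi> v) (basis_vec ())) () = Poly_Mapping.lookup (scale (\<psi> v) (basis_vec ())) ()"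
    by simp
  then show ?thesis by (simp add: lookup_basis_vec)
qed

text \<open>The coefficient of u_a in the first tensor factor. It allows coordinates of U v to be
  computed along the row index, for arbitrary v.\<close>

definition slice :: "rat \<Rightarrow> tensor \<Rightarrow> tensor" where
  "slice a = lin_extend (\<lambda>g. case g of [] \<Rightarrow> 0 | b # g' \<Rightarrow> if b = a then basis_vec g' else 0)"

lemma linear_slice: "linear_map (slice a)"
  unfolding slice_def by (rule linear_lin_extend)

lemma slice_basis:
  "slice a (basis_vec g) = (case g of [] \<Rightarrow> 0 | b # g' \<Rightarrow> if b = a then basis_vec g' else 0)"
  by (simp add: slice_def)

lemma lookup_slice: "Poly_Mapping.lookup (slice a v) f = Poly_Mapping.lookup v (a # f)"
  by (rule linear_functional_eq[where v = v])
    (auto simp: linear_map_add[OF linear_slice] linear_map_scale[OF linear_slice] lookup_add slice_basis lookup_basis_vec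
      split: list.split)

lemma slice_cons: "slice a (cons_tensor b w) = (if a = b then w else 0)"
proof -
  have "linear_map (\<lambda>w. slice a (cons_tensor b w))"
    by (rule linear_map_compose[OF linear_slice linear_cons_tensor])
  moreover have "linear_map (\<lambda>w. if a = b then w else 0 :: tensor)"
    by (simp add: linear_map_def)
  ultimately show ?thesis
    by (rule linear_map_eq_on[where v = w]) (simp add: cons_tensor_basis slice_def)
qed

lemma lookup_cons_tensor: "Poly_Mapping.lookup (cons_tensor b w) (a # f) = (if a = b then Poly_Mapping.lookup w f else 0)"
  "Poly_Mapping.lookup (cons_tensor b w) [] = 0"
proof -
  show "Poly_Mapping.lookup (cons_tensor b w) (a # f) = (if a = b then Poly_Mapping.lookup w f else 0)"
    unfolding lookup_slice[symmetric] slice_cons by simp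
  show "Poly_Mapping.lookup (cons_tensor b w) [] = 0"
    by (rule linear_functional_eq[where v = w])
      (auto simp: cons_tensor_add cons_tensor_scale lookup_add cons_tensor_basis lookup_basis_vec)
qed

lemma lookup_Kinvgen: "Poly_Mapping.lookup (U_act (Kinvgen i) v) f = qq powi (- weight i f) * Poly_Mapping.lookup v f"
  by (rule linear_functional_eq[where v = v])
    (auto simp: U_act_add U_act_scale lookup_add U_act_basis lookup_basis_vec algebra_simps)

lemma lookup_U_act_Nil:
  "Poly_Mapping.lookup (U_act (Egen i) v) [] = 0" "Poly_Mapping.lookup (U_act (Fgen i) v) [] = 0"
proof -
  have "Poly_Mapping.lookup (U_basis (Egen i) b) [] = 0" "Poly_Mapping.lookup (U_basis (Fgen i) b) [] = 0" for b
    by (cases b; auto simp: lookup_add lookup_cons_tensor lookup_basis_vec)+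
  then show "Poly_Mapping.lookup (U_act (Egen i) v) [] = 0" "Poly_Mapping.lookup (U_act (Fgen i) v) [] = 0"
    by (simp_all add: U_act_def lookup_lin_extend)
qed

text \<open>The rule of \<open>U_act_cons\<close> transposed. Apart from the power of q, this is the
  recursion that defines \<open>der\<close>.\<close>

lemma lookup_Egen_Cons:
  "Poly_Mapping.lookup (U_act (Egen i) v) (a # f) = Poly_Mapping.lookup (U_act (Egen i) (slice a v)) f +
    (if a = lower i then qq powi (- weight i f) * Poly_Mapping.lookup v (upper i # f) else 0)"
proof (rule linear_functional_eq[where v = v])
  fix g :: "rat list"
  show "Poly_Mapping.lookup (U_act (Egen i) (basis_vec g)) (a # f) = Poly_Mapping.lookup (U_act (Egen i) (slice a (basis_vec g))) f +
    (if a = lower i then qq powi (- weight i f) * Poly_Mapping.lookup (basis_vec g) (upper i # f) else 0)"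
  proof (cases g)
    case Nil
    then show ?thesis by (simp add: U_act_basis slice_def lookup_basis_vec)
  next
    case (Cons b g')
    then show ?thesis
      by (auto simp: cons_tensor_basis[symmetric] U_act_cons slice_cons lookup_add lookup_cons_tensor lookup_Kinvgen)
  qed
qed (auto simp: linear_map_add[OF linear_slice] linear_map_scale[OF linear_slice] U_act_add U_act_scale lookup_add algebra_simps)

lemma lookup_Fgen_Cons:
  "Poly_Mapping.lookup (U_act (Fgen i) v) (a # f) =
    (if a = upper i then Poly_Mapping.lookup v (lower i # f) else 0) +
    qq powi alpha i a * Poly_Mapping.lookup (U_act (Fgen i) (slice a v)) f"
proof (rule linear_functional_eq[where v = v])
  fix g :: "rat list"
  show "Poly_Mapping.lookup (U_act (Fgen i) (basis_vec g)) (a # f) =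
    (if a = upper i then Poly_Mapping.lookup (basis_vec g) (lower i # f) else 0) +
    qq powi alpha i a * Poly_Mapping.lookup (U_act (Fgen i) (slice a (basis_vec g))) f"
  proof (cases g)
    case Nil
    then show ?thesis by (simp add: U_act_basis slice_def lookup_basis_vec)
  next
    case (Cons b g')
    then show ?thesis
      by (auto simp: cons_tensor_basis[symmetric] U_act_cons slice_cons lookup_add lookup_cons_tensor)
  qed
qed (auto simp: linear_map_add[OF linear_slice] linear_map_scale[OF linear_slice] U_act_add U_act_scale lookup_add algebra_simps)

definition integral :: "tensor \<Rightarrow> bool" where
  "integral v \<longleftrightarrow> (\<forall>f. Poly_Mapping.lookup v f \<in> spec_ring)"

text \<open>A vector becomes a function of lists of pairs through the row indices alone. The column
  indices are carried along, so \<open>der\<close>, which changes only first components, applies to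
  it.\<close>

definition reduction :: "tensor \<Rightarrow> pmat" where
  "reduction v h = spec (Poly_Mapping.lookup v (map fst h))"

definition elem_mat :: "rat \<Rightarrow> rat \<Rightarrow> rat \<times> rat \<Rightarrow> rat" where
  "elem_mat a b = (\<lambda>c. if c = (a, b) then 1 else 0)"

lemma integral_slice: "integral v \<Longrightarrow> integral (slice a v)"
  by (simp add: integral_def lookup_slice)

lemma reduction_slice: "reduction (slice (fst c) v) = (\<lambda>h. reduction v (c # h))"
  by (simp add: reduction_def lookup_slice fun_eq_iff)

lemma reduction_Kinvgen:
  assumes "integral v"
  shows "integral (U_act (Kinvgen i) v)" "reduction (U_act (Kinvgen i) v) = reduction v"
  using assms spec_qq_powi
  by (auto simp: integral_def lookup_Kinvgen sp.mult reduction_def fun_eq_iff)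

lemma sum_elem_mat:
  assumes "finite I" "b \<in> I"
  shows "(\<Sum>a'\<in>I. elem_mat a b (c, a') * F a') = (if c = a then F b else 0)"
proof -
  have "(\<Sum>a'\<in>I. elem_mat a b (c, a') * F a') = (\<Sum>a'\<in>I. if a' = b then (if c = a then F b else 0) else 0)"
    by (rule sum.cong) (auto simp: elem_mat_def)
  then show ?thesis using assms by simp
qed

text \<open>All powers of q, that is the actions of the K's, reduce to 1, so the coproduct of E_i
  becomes that of a derivation.\<close>

lemma reduction_Egen:
  assumes "i \<in> node_set r"
  shows "integral v \<Longrightarrow> Poly_Mapping.lookup (U_act (Egen i) v) (map fst h) \<in> spec_ring \<and>
    reduction (U_act (Egen i) v) h = der (index_set r) (elem_mat (lower i) (upper i)) (reduction v) h"
proof (induction h arbitrary: v)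
  case Nil
  show ?case by (simp add: reduction_def lookup_U_act_Nil sp.zero)
next
  case (Cons c h)
  let ?x = "Poly_Mapping.lookup (U_act (Egen i) (slice (fst c) v)) (map fst h)"
  let ?y = "if fst c = lower i then qq powi (- weight i (map fst h)) * Poly_Mapping.lookup v (upper i # map fst h) else 0"
  have x: "?x \<in> spec_ring" "spec ?x = der (index_set r) (elem_mat (lower i) (upper i)) (\<lambda>h. reduction v (c # h)) h"
    using Cons.IH[OF integral_slice[OF Cons.prems], of "fst c"] by (auto simp: reduction_def[of "U_act (Egen i) _"] reduction_slice)
  have y: "?y \<in> spec_ring" "spec ?y = (if fst c = lower i then reduction v ((upper i, snd c) # h) else 0)"
    using spec_qq_powi[of "- weight i (map fst h)"] Cons.prems by (auto simp: sp.zero sp.mult integral_def reduction_def)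
  have "Poly_Mapping.lookup (U_act (Egen i) v) (map fst (c # h)) = ?x + ?y" by (simp add: lookup_Egen_Cons)
  then show ?case
    using x y sp.add[OF x(1) y(1)] lower_upper_in_index_set[OF assms]
    by (simp add: reduction_def[of "U_act (Egen i) v"] sum_elem_mat)
qed

lemma reduction_Fgen:
  assumes "i \<in> node_set r"
  shows "integral v \<Longrightarrow> Poly_Mapping.lookup (U_act (Fgen i) v) (map fst h) \<in> spec_ring \<and>
    reduction (U_act (Fgen i) v) h = der (index_set r) (elem_mat (upper i) (lower i)) (reduction v) h"
proof (induction h arbitrary: v)
  case Nil
  show ?case by (simp add: reduction_def lookup_U_act_Nil sp.zero)
next
  case (Cons c h)
  let ?z = "Poly_Mapping.lookup (U_act (Fgen i) (slice (fst c) v)) (map fst h)"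
  let ?x = "qq powi alpha i (fst c) * ?z"
  let ?y = "if fst c = upper i then Poly_Mapping.lookup v (lower i # map fst h) else 0"
  have z: "?z \<in> spec_ring" "spec ?z = der (index_set r) (elem_mat (upper i) (lower i)) (\<lambda>h. reduction v (c # h)) h"
    using Cons.IH[OF integral_slice[OF Cons.prems], of "fst c"] by (auto simp: reduction_def[of "U_act (Fgen i) _"] reduction_slice)
  then have x: "?x \<in> spec_ring" "spec ?x = der (index_set r) (elem_mat (upper i) (lower i)) (\<lambda>h. reduction v (c # h)) h"
    using spec_qq_powi[of "alpha i (fst c)"] by (auto simp: sp.mult)
  have y: "?y \<in> spec_ring" "spec ?y = (if fst c = upper i then reduction v ((lower i, snd c) # h) else 0)"
    using Cons.prems by (auto simp: sp.zero integral_def reduction_def)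
  have "Poly_Mapping.lookup (U_act (Fgen i) v) (map fst (c # h)) = ?y + ?x" by (simp add: lookup_Fgen_Cons)
  then show ?case
    using x y sp.add[OF y(1) x(1)] lower_upper_in_index_set[OF assms]
    by (simp add: reduction_def[of "U_act (Fgen i) v"] sum_elem_mat)
qed

lemma integralI: "(\<And>h :: (rat \<times> rat) list. Poly_Mapping.lookup v (map fst h) \<in> spec_ring) \<Longrightarrow> integral v"
  unfolding integral_def
proof
  fix f assume "\<And>h :: (rat \<times> rat) list. Poly_Mapping.lookup v (map fst h) \<in> spec_ring"
  from this[of "map (\<lambda>a. (a, a)) f"] show "Poly_Mapping.lookup v f \<in> spec_ring" by (simp add: comp_def)
qed

lemma reduction_EF:
  assumes "i \<in> node_set r" "integral v"
  shows "integral (U_act (Egen i) v)" "integral (U_act (Fgen i) v)"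
    "reduction (U_act (Egen i) v) = der (index_set r) (elem_mat (lower i) (upper i)) (reduction v)"
    "reduction (U_act (Fgen i) v) = der (index_set r) (elem_mat (upper i) (lower i)) (reduction v)"
  using reduction_Egen[OF assms] reduction_Fgen[OF assms] by (auto intro: integralI)

lemma reduction_add:
  assumes "integral u" "integral v"
  shows "integral (u + v)" "reduction (u + v) h = reduction u h + reduction v h"
  using assms by (simp_all add: integral_def reduction_def lookup_add sp.add)

lemma reduction_scale:
  assumes "c \<in> spec_ring" "integral v"
  shows "integral (scale c v)" "reduction (scale c v) h = spec c * reduction v h"
  using assms by (simp_all add: integral_def reduction_def sp.mult)

definition specializes_to :: "nat \<Rightarrow> qgen free_alg \<Rightarrow> (rat \<times> rat \<Rightarrow> rat) \<Rightarrow> bool" where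
  "specializes_to r x Z \<longleftrightarrow> (\<forall>v. integral v \<longrightarrow> integral (left_action U_act x v) \<and>
    reduction (left_action U_act x v) = der (index_set r) Z (reduction v))"

lemma der_pair_mat:
  "der I (pair_mat a b) R h = der I (elem_mat a b) R h + der I (elem_mat (- a) (- b)) R h"
proof -
  have "pair_mat a b = (\<lambda>c. 1 * elem_mat a b c + 1 * elem_mat (- a) (- b) c)"
    by (auto simp: pair_mat_def elem_mat_def)
  then show ?thesis by (simp only: der_lincomb_mat)
qed

lemma uminus_lower_upper: "- lower i = upper (- i)" "- upper i = lower (- i)"
  by (simp_all add: lower_def upper_def)

lemma iota_mats_specialization:
  assumes "Z \<in> iota_mats r"
  shows "\<exists>x\<in>Ui_gens r. specializes_to r x Z"
proof -
  have q: "qq \<in> spec_ring" "spec qq = 1" by (fact spec_qq)+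
  consider (e) i where "1 \<le> i" "i \<le> int r" "Z = pair_mat (lower i) (upper i)"
    | (f) i where "1 \<le> i" "i \<le> int r" "Z = pair_mat (upper i) (lower i)"
    | (t) "Z = pair_mat (lower 0) (upper 0)"
    using assms by (auto simp: iota_mats_def)
  then show ?thesis
  proof cases
    case (e i)
    then have n: "i \<in> node_set r" "- i \<in> node_set r" by (auto simp: node_set_def)
    have "EE i + FF (- i) * KKinv i \<in> Ui_gens r" using e by (auto simp: Ui_gens_def)
    moreover have "specializes_to r (EE i + FF (- i) * KKinv i) Z"
      unfolding specializes_to_def e(3)
      by (auto simp: action_add left_action_U_mult reduction_add reduction_EF[OF n(1)] reduction_EF[OF n(2)]
          reduction_Kinvgen der_pair_mat uminus_lower_upper)
    ultimately show ?thesis by blast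
  next
    case (f i)
    then have n: "i \<in> node_set r" "- i \<in> node_set r" by (auto simp: node_set_def)
    have "EE (- i) + KKinv (- i) * FF i \<in> Ui_gens r" using f by (auto simp: Ui_gens_def)
    moreover have "specializes_to r (EE (- i) + KKinv (- i) * FF i) Z"
      unfolding specializes_to_def f(3)
      by (auto simp: action_add left_action_U_mult reduction_add reduction_EF[OF n(1)] reduction_EF[OF n(2)]
          reduction_Kinvgen der_pair_mat uminus_lower_upper)
    ultimately show ?thesis by blast
  next
    case t
    have n: "0 \<in> node_set r" by (auto simp: node_set_def)
    let ?t = "EE 0 + scalar qq * (FF 0 * KKinv 0) + scalar ((pp - inverse pp) / (qq - inverse qq)) * KKinv 0"
    have "?t \<in> Ui_gens r" by (simp add: Ui_gens_def)
    moreover have "specializes_to r ?t Z"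
      unfolding specializes_to_def t
      by (auto simp: action_add left_action_U_mult reduction_add reduction_scale reduction_EF[OF n] reduction_Kinvgen
          der_pair_mat uminus_lower_upper q spec_coeff_t)
    ultimately show ?thesis by blast
  qed
qed

section \<open>Words in the generators and their specializations\<close>

definition word_act :: "qgen free_alg list \<Rightarrow> tensor \<Rightarrow> tensor" where
  "word_act xs v = foldr (left_action U_act) xs v"

text \<open>The k_i are left out, as they specialize to the identity and not to a
  derivation.\<close>

definition spec_words :: "nat \<Rightarrow> qgen free_alg list set" where
  "spec_words r = {xs. \<forall>x\<in>set xs. x \<in> Ui_gens r \<and> (\<exists>Z. specializes_to r x Z)}"

definition word_reduction :: "qgen free_alg list \<Rightarrow> pmat" where
  "word_reduction xs h = reduction (word_act xs (basis_vec (map snd h))) h"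

lemma integral_basis_vec: "integral (basis_vec f)"
  by (simp add: integral_def lookup_basis_vec sp.zero sp.one)

lemma integral_word_act: "xs \<in> spec_words r \<Longrightarrow> integral v \<Longrightarrow> integral (word_act xs v)"
  by (induction xs) (auto simp: word_act_def spec_words_def specializes_to_def)

lemma der_cong_snd:
  "(\<And>h'. map snd h' = map snd h \<Longrightarrow> set (map fst h') \<subseteq> I \<Longrightarrow> R h' = S h') \<Longrightarrow> set (map fst h) \<subseteq> I \<Longrightarrow>
    der I Z R h = der I Z S h"
proof (induction h arbitrary: R S)
  case (Cons c h)
  have "der I Z (\<lambda>h'. R (c # h')) h = der I Z (\<lambda>h'. S (c # h')) h"
    using Cons.prems(2) by (intro Cons.IH Cons.prems(1)) auto
  moreover have "R ((a, snd c) # h) = S ((a, snd c) # h)" if "a \<in> I" for a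
    using Cons.prems(2) that by (intro Cons.prems(1)) auto
  ultimately show ?case by simp
qed simp

lemma derivation_span_words:
  assumes "R \<in> derivation_span (index_set r) m (iota_mats r)"
  shows "\<exists>v\<in>lincombs (spec_words r) word_reduction. \<forall>h. length h = m \<longrightarrow>
    set h \<subseteq> index_set r \<times> index_set r \<longrightarrow> R h = v h"
  using assms
proof (induction rule: derivation_span.induct)
  case unit
  have "(\<lambda>h. \<Sum>xs\<in>{[]}. 1 * word_reduction xs h) \<in> lincombs (spec_words r) word_reduction"
    by (rule lincombsI) (auto simp: spec_words_def)
  moreover have "unit_mat h = word_reduction [] h" for h
    by (induction h) (auto simp: unit_mat_def word_reduction_def reduction_def word_act_def lookup_basis_vec sp.zero sp.one)
  ultimately show ?case by (intro bexI) auto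
next
  case (lincomb R S x y)
  then obtain u v where u: "u \<in> lincombs (spec_words r) word_reduction"
      "\<forall>h. length h = m \<longrightarrow> set h \<subseteq> index_set r \<times> index_set r \<longrightarrow> R h = u h"
    and v: "v \<in> lincombs (spec_words r) word_reduction"
      "\<forall>h. length h = m \<longrightarrow> set h \<subseteq> index_set r \<times> index_set r \<longrightarrow> S h = v h"
    by (elim bexE)
  show ?case
    by (rule bexI[OF _ fun_subspace_lincomb2[OF fun_subspace_lincombs u(1) v(1), of x y]]) (use u(2) v(2) in auto)
next
  case (der Z R)
  obtain x where x: "x \<in> Ui_gens r" "specializes_to r x Z"
    using iota_mats_specialization[OF der.hyps(1)] by blast
  obtain v where v: "v \<in> lincombs (spec_words r) word_reduction"
      "\<forall>h. length h = m \<longrightarrow> set h \<subseteq> index_set r \<times> index_set r \<longrightarrow> R h = v h"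
    using der.IH by (elim bexE)
  obtain A a where A: "finite A" "A \<subseteq> spec_words r" "v = (\<lambda>h. \<Sum>xs\<in>A. a xs * word_reduction xs h)"
    using v(1) by (auto simp: lincombs_def)
  have "word_reduction (x # xs) \<in> lincombs (spec_words r) word_reduction" if "xs \<in> A" for xs
  proof -
    have "x # xs \<in> spec_words r" using that A(2) x by (auto simp: spec_words_def)
    then have "(\<lambda>h. \<Sum>ys\<in>{x # xs}. 1 * word_reduction ys h) \<in> lincombs (spec_words r) word_reduction"
      by (intro lincombsI) auto
    then show ?thesis by simp
  qed
  then have "(\<lambda>h. \<Sum>xs\<in>A. a xs * word_reduction (x # xs) h) \<in> lincombs (spec_words r) word_reduction"
    by (rule fun_subspace_sum[OF fun_subspace_lincombs])
  moreover have "der (index_set r) Z R h = (\<Sum>xs\<in>A. a xs * word_reduction (x # xs) h)"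
    if h: "length h = m" "set h \<subseteq> index_set r \<times> index_set r" for h
  proof -
    let ?w = "\<lambda>xs. word_act xs (basis_vec (map snd h))"
    \<comment> \<open>Only first components vary under \<open>der\<close>. The column
      \<open>map snd h\<close> therefore stays fixed, and all values involved are coordinates of the
      single vectors \<open>?w xs\<close>.\<close>
    have "der (index_set r) Z R h = der (index_set r) Z (\<lambda>h'. \<Sum>xs\<in>A. a xs * reduction (?w xs) h') h"
    proof (rule der_cong_snd)
      fix h' assume h': "map snd h' = map snd h" "set (map fst h') \<subseteq> index_set r"
      then have "length h' = m" "snd ` set h' = snd ` set h"
        using h(1) map_eq_imp_length_eq[OF h'(1)] by (auto simp flip: set_map)
      moreover from this have "set h' \<subseteq> index_set r \<times> index_set r"
        using h(2) h'(2) by (fastforce simp: subset_iff image_iff set_eq_iff)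
      ultimately have "R h' = v h'" using v(2) by blast
      then show "R h' = (\<Sum>xs\<in>A. a xs * reduction (?w xs) h')"
        by (simp add: A(3) word_reduction_def h'(1))
    qed (use h in auto)
    also have "\<dots> = (\<Sum>xs\<in>A. a xs * der (index_set r) Z (reduction (?w xs)) h)"
      by (rule der_sum)
    also have "\<dots> = (\<Sum>xs\<in>A. a xs * word_reduction (x # xs) h)"
    proof (rule sum.cong[OF refl])
      fix xs assume "xs \<in> A"
      then have "integral (?w xs)" using A(2) integral_basis_vec by (intro integral_word_act) auto
      then have "reduction (left_action U_act x (?w xs)) = der (index_set r) Z (reduction (?w xs))"
        using x(2) by (simp add: specializes_to_def)
      then show "a xs * der (index_set r) Z (reduction (?w xs)) h = a xs * word_reduction (x # xs) h"
        by (simp add: word_reduction_def word_act_def)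
    qed
    finally show ?thesis .
  qed
  ultimately show ?case by (intro bexI[of _ "\<lambda>h. \<Sum>xs\<in>A. a xs * word_reduction (x # xs) h"]) auto
next
  case (cong R S)
  then show ?case by auto
qed

section \<open>Endomorphisms commuting with the Hecke algebra\<close>

lemma word_act_mult: "word_act xs v = left_action U_act (prod_list xs) v"
  by (induction xs) (simp_all add: word_act_def left_action_U_mult)

lemma prod_list_Ui_gens_carrier:
  "set xs \<subseteq> Ui_gens r \<Longrightarrow> prod_list xs \<in> carrier (free_algebra (U_gens r))"
  by (induction xs) (auto intro: free_algebra_closed Ui_gens_carrier)

lemma Ui_alg_closed:
  "x \<in> carrier (free_algebra (U_gens r)) \<Longrightarrow> y \<in> carrier (free_algebra (U_gens r)) \<Longrightarrow>
    U_class r x \<in> carrier (Ui_alg r) \<Longrightarrow> U_class r y \<in> carrier (Ui_alg r) \<Longrightarrow>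
    U_class r (x + y) \<in> carrier (Ui_alg r) \<and> U_class r (x * y) \<in> carrier (Ui_alg r)"
  "U_class r (scalar c) \<in> carrier (Ui_alg r)"
  "x \<in> Ui_gens r \<Longrightarrow> U_class r x \<in> carrier (Ui_alg r)"
  "U_class r 1 \<in> carrier (Ui_alg r)"
proof -
  assume x: "x \<in> carrier (free_algebra (U_gens r))" and y: "y \<in> carrier (free_algebra (U_gens r))"
    and u: "U_class r x \<in> carrier (Ui_alg r)" "U_class r y \<in> carrier (Ui_alg r)"
  have "U_class r (x + y) = U_class r x \<oplus>\<^bsub>U_alg r\<^esub> U_class r y"
    "U_class r (x * y) = U_class r x \<otimes>\<^bsub>U_alg r\<^esub> U_class r y"
    using ring_hom_add[OF U_class_hom x y] ring_hom_mult[OF U_class_hom x y] by simp_all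
  then show "U_class r (x + y) \<in> carrier (Ui_alg r) \<and> U_class r (x * y) \<in> carrier (Ui_alg r)"
    using u unfolding carrier_Ui_alg by (simp add: generate_ring.eng_add generate_ring.eng_mult)
next
  show "U_class r (scalar c) \<in> carrier (Ui_alg r)"
    unfolding carrier_Ui_alg by (rule generate_ring.incl) auto
  show "U_class r 1 \<in> carrier (Ui_alg r)"
    using ring_hom_one[OF U_class_hom] generate_ring.one[of "U_alg r"] unfolding carrier_Ui_alg by simp
  show "U_class r x \<in> carrier (Ui_alg r)" if "x \<in> Ui_gens r"
    unfolding carrier_Ui_alg using that by (intro generate_ring.incl) auto
qed

lemma prod_list_in_Ui_alg: "set xs \<subseteq> Ui_gens r \<Longrightarrow> U_class r (prod_list xs) \<in> carrier (Ui_alg r)"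
  by (induction xs)
    (auto simp: Ui_alg_closed(3,4) intro!: Ui_alg_closed(1)[THEN conjunct2] Ui_gens_carrier prod_list_Ui_gens_carrier)

lemma lincomb_in_Ui_alg:
  assumes "finite A" "\<And>xs. xs \<in> A \<Longrightarrow> set xs \<subseteq> Ui_gens r"
  shows "(\<Sum>xs\<in>A. scalar (a xs) * prod_list xs) \<in> carrier (free_algebra (U_gens r)) \<and>
    U_class r (\<Sum>xs\<in>A. scalar (a xs) * prod_list xs) \<in> carrier (Ui_alg r)"
  using assms
proof (induction A rule: finite_induct)
  case empty
  have "U_class r (scalar 0) \<in> carrier (Ui_alg r)" by (rule Ui_alg_closed)
  then show ?case by (simp add: scalar_def free_algebra_closed)
next
  case (insert xs A)
  have xs: "prod_list xs \<in> carrier (free_algebra (U_gens r))" "U_class r (prod_list xs) \<in> carrier (Ui_alg r)"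
    using insert.prems by (auto intro: prod_list_in_Ui_alg prod_list_Ui_gens_carrier)
  have s: "scalar (a xs) * prod_list xs \<in> carrier (free_algebra (U_gens r))"
    "U_class r (scalar (a xs) * prod_list xs) \<in> carrier (Ui_alg r)"
    using xs Ui_alg_closed(1)[OF _ xs(1) Ui_alg_closed(2) xs(2)] by (auto intro: free_algebra_closed)
  have IH: "(\<Sum>xs\<in>A. scalar (a xs) * prod_list xs) \<in> carrier (free_algebra (U_gens r))"
    "U_class r (\<Sum>xs\<in>A. scalar (a xs) * prod_list xs) \<in> carrier (Ui_alg r)"
    using insert by auto
  then show ?case
    using insert.hyps free_algebra_closed(1)[OF s(1) IH(1)] Ui_alg_closed(1)[OF s(1) IH(1) s(2) IH(2)] by simp
qed

lemma word_act_commutes: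
  assumes "set xs \<subseteq> Ui_gens r" "m \<ge> 1" "i < m" "v \<in> tensor_space r m"
  shows "word_act xs v \<in> tensor_space r m \<and> word_act xs (H_act i v) = H_act i (word_act xs v)"
  using assms(1)
proof (induction xs)
  case (Cons x xs)
  then have x: "x \<in> Ui_gens r" "x \<in> carrier (free_algebra (U_gens r))" using Ui_gens_carrier by auto
  have IH: "word_act xs v \<in> tensor_space r m" "word_act xs (H_act i v) = H_act i (word_act xs v)"
    using Cons by auto
  have "left_action U_act x (H_act i (word_act xs v)) = H_act i (left_action U_act x (word_act xs v))"
    using left_action_Ui_gens_H_act_0[OF x(1) IH(1) assms(2)] left_action_H_act[OF _ assms(3) IH(1) x(2)]
    by (cases "i = 0") auto
  then show ?case
    using left_action_tensor_rep(2)[OF x(2) IH(1) assms(2)] IH by (simp add: word_act_def)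
qed (use assms in \<open>simp add: word_act_def\<close>)

lemma weyl_act_same: "f ! (i - 1) = f ! i \<Longrightarrow> i \<noteq> 0 \<Longrightarrow> weyl_act f i = f"
  by (simp add: weyl_act_def) (metis list_update_id)

text \<open>At p = q = 1 the Hecke algebra acts through the Weyl group: the correction terms vanish,
  and for equal entries the eigenvalue q^-1 becomes 1.\<close>

lemma spec_hecke_basis:
  "Poly_Mapping.lookup (hecke_basis i g) f \<in> spec_ring \<and>
    spec (Poly_Mapping.lookup (hecke_basis i g) f) = (if weyl_act g i = f then 1 else 0)"
proof -
  have p: "inverse pp \<in> spec_ring" "spec (inverse pp) = 1" "pp \<in> spec_ring" "spec pp = 1"
    using sp.unit[of pp] sp.inverse[of pp] spec_pp by auto
  have q: "inverse qq \<in> spec_ring" "spec (inverse qq) = 1" "qq \<in> spec_ring" "spec qq = 1"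
    using sp.unit[of qq] sp.inverse[of qq] spec_qq by auto
  have b: "Poly_Mapping.lookup (basis_vec a) c \<in> spec_ring"
    "spec (Poly_Mapping.lookup (basis_vec a) c) = (if a = c then 1 else 0)" for a c :: "rat list"
    by (auto simp: lookup_basis_vec sp.zero sp.one)
  show ?thesis
    using sp.diff[OF p(1,3)] sp.diff[OF q(1,3)] p q weyl_act_same[of g i]
    by (auto simp: hecke_basis_def lookup_add sp.add sp.mult b)
qed

lemma weyl_act_append: "weyl_act (xs @ a # b # ys) (Suc (length xs)) = xs @ b # a # ys"
  by (simp add: weyl_act_def nth_append list_update_append)

lemma weyl_act_Cons_0: "weyl_act (a # f) 0 = (- a) # f"
  by (simp add: weyl_act_def)

lemma weyl_act_involution:
  assumes "f \<in> tensor_index r m" "i < m"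
  shows "weyl_act (weyl_act f i) i = f"
proof (cases i)
  case 0
  then obtain a f' where "f = a # f'" using assms by (cases f) (auto simp: tensor_index_def)
  then show ?thesis using 0 by (simp add: weyl_act_Cons_0)
next
  case (Suc k)
  then have l: "length f = m" "Suc k < m" using assms by (auto simp: tensor_index_def)
  define xs where "xs = take k f"
  have "f = xs @ f ! k # f ! Suc k # drop (Suc (Suc k)) f" "length xs = k"
    using l by (auto simp: xs_def Cons_nth_drop_Suc)
  then show ?thesis using Suc weyl_act_append by metis
qed

text \<open>Writes an entry of h x - x h as a linear form in the entries of x, with the coefficients
  displayed, as \<open>solution_space_lifting\<close> requires.\<close>

lemma commutator_sum:
  fixes h x :: "'i \<times> 'i \<Rightarrow> 'k::comm_ring_1"
  assumes "finite I" "f \<in> I" "g \<in> I"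
  shows "(\<Sum>n\<in>I \<times> I. ((if snd n = g then h (f, fst n) else 0) - (if fst n = f then h (snd n, g) else 0)) * x n) =
    mat_mult I h x (f, g) - mat_mult I x h (f, g)"
proof -
  have "(\<Sum>n\<in>I \<times> I. ((if snd n = g then h (f, fst n) else 0) - (if fst n = f then h (snd n, g) else 0)) * x n) =
      (\<Sum>a\<in>I. \<Sum>b\<in>I. if b = g then h (f, a) * x (a, g) else 0) -
      (\<Sum>a\<in>I. if a = f then \<Sum>b\<in>I. h (b, g) * x (f, b) else 0)"
    unfolding sum.cartesian_product' sum_subtractf[symmetric]
    by (rule sum.cong[OF refl]) (auto simp: left_diff_distrib sum_subtractf intro!: sum.cong)
  then show ?thesis using assms by (simp add: mat_mult_apply mult.commute)
qed

lemma commuting_invariant: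
  fixes y :: "rat list \<times> rat list \<Rightarrow> rat"
  assumes m: "m \<ge> 1" and comm: "\<And>i f g. i < m \<Longrightarrow> f \<in> tensor_index r m \<Longrightarrow> g \<in> tensor_index r m \<Longrightarrow>
      y (weyl_act f i, g) = y (f, weyl_act g i)"
  shows "iota_index.invariant r m (\<lambda>h. y (map fst h, map snd h))"
proof -
  interpret iota_index r m by (rule iota_index)
  have inv: "y (weyl_act f i, weyl_act g i) = y (f, g)"
    if "i < m" "f \<in> tensor_index r m" "g \<in> tensor_index r m" for i f g
    using comm[of i "weyl_act f i" g] that weyl_act_involution[OF that(2,1)] weyl_act_tensor_index[OF that(2,1)]
    by simp
  show ?thesis
    unfolding invariant_def
  proof (intro conjI allI impI)
    fix xs c d ys assume *: "length (xs @ c # d # ys) = m" "set (xs @ c # d # ys) \<subseteq> X"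
    have "map fst (xs @ c # d # ys) \<in> tensor_index r m" "map snd (xs @ c # d # ys) \<in> tensor_index r m"
      using * by (auto simp: tensor_index_def)
    from inv[OF _ this, of "Suc (length xs)"] show "y (map fst (xs @ c # d # ys), map snd (xs @ c # d # ys)) =
        y (map fst (xs @ d # c # ys), map snd (xs @ d # c # ys))"
      using * weyl_act_append[of "map fst xs" "fst c"] weyl_act_append[of "map snd xs" "snd c"] by simp
  next
    fix a b h assume *: "length ((a, b) # h) = m" "set ((a, b) # h) \<subseteq> X"
    have "map fst ((a, b) # h) \<in> tensor_index r m" "map snd ((a, b) # h) \<in> tensor_index r m"
      using * by (auto simp: tensor_index_def)
    from inv[OF _ this, of 0] show "y (map fst ((a, b) # h), map snd ((a, b) # h)) =
        y (map fst ((- a, - b) # h), map snd ((- a, - b) # h))"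
      using m by (simp add: weyl_act_Cons_0)
  qed
qed

lemma special_commutant:
  fixes y :: "rat list \<times> rat list \<Rightarrow> rat"
  assumes m: "m \<ge> 1"
    and comm: "\<And>i f g. i < m \<Longrightarrow> f \<in> tensor_index r m \<Longrightarrow> g \<in> tensor_index r m \<Longrightarrow>
      (\<Sum>n\<in>tensor_index r m \<times> tensor_index r m.
        spec ((if snd n = g then mat (H_end r m i) (f, fst n) else 0) - (if fst n = f then mat (H_end r m i) (snd n, g) else 0)) * y n) = 0"
  shows "\<exists>v\<in>lincombs (spec_words r) (\<lambda>xs n. spec (mat (word_act xs) n)).
    \<forall>n\<in>tensor_index r m \<times> tensor_index r m. y n = v n"
proof -
  let ?I = "tensor_index r m"
  interpret iota_index r m by (rule iota_index)
  have "y (weyl_act f i, g) = y (f, weyl_act g i)" if i: "i < m" and f: "f \<in> ?I" and g: "g \<in> ?I" for i f g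
  proof -
    define h where "h = (\<lambda>n. if weyl_act (snd n) i = fst n then 1 else 0 :: rat)"
    have "spec ((if snd n = g then mat (H_end r m i) (f, fst n) else 0) - (if fst n = f then mat (H_end r m i) (snd n, g) else 0)) =
        (if snd n = g then h (f, fst n) else 0) - (if fst n = f then h (snd n, g) else 0)" if "n \<in> ?I \<times> ?I" for n
    proof -
      have *: "mat (H_end r m i) (a, b) \<in> spec_ring \<and> spec (mat (H_end r m i) (a, b)) = h (a, b)" if "b \<in> ?I" for a b
        using spec_hecke_basis[of i b a] that by (simp add: mat_H_end h_def)
      show ?thesis
        using *[of "fst n" f] *[of g "snd n"] that g by (auto simp: sp.diff sp.zero sp.uminus)
    qed
    then have "(\<Sum>n\<in>?I \<times> ?I. ((if snd n = g then h (f, fst n) else 0) - (if fst n = f then h (snd n, g) else 0)) * y n) = 0"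
      using comm[OF i f g] by simp
    then have "mat_mult ?I h y (f, g) = mat_mult ?I y h (f, g)"
      unfolding commutator_sum[OF finite_tensor_index f g] by simp
    moreover have "mat_mult ?I h y (f, g) = y (weyl_act f i, g)"
    proof -
      have "mat_mult ?I h y (f, g) = (\<Sum>a\<in>?I. if a = weyl_act f i then y (weyl_act f i, g) else 0)"
        unfolding mat_mult_apply
        by (rule sum.cong) (use weyl_act_involution[OF _ i] f in \<open>auto simp: h_def\<close>)
      then show ?thesis using weyl_act_tensor_index[OF f i] by simp
    qed
    moreover have "mat_mult ?I y h (f, g) = y (f, weyl_act g i)"
    proof -
      have "mat_mult ?I y h (f, g) = (\<Sum>a\<in>?I. if a = weyl_act g i then y (f, weyl_act g i) else 0)"
        unfolding mat_mult_apply by (rule sum.cong) (auto simp: h_def)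
      then show ?thesis using weyl_act_tensor_index[OF g i] by simp
    qed
    ultimately show ?thesis by simp
  qed
  from invariant_in_derivation_span[OF commuting_invariant[OF m this]]
  obtain v where v: "v \<in> lincombs (spec_words r) word_reduction"
    "\<forall>h. length h = m \<longrightarrow> set h \<subseteq> X \<longrightarrow> y (map fst h, map snd h) = v h"
    using derivation_span_words[of "\<lambda>h. y (map fst h, map snd h)" r m] by blast
  obtain A a where A: "finite A" "A \<subseteq> spec_words r" "v = (\<lambda>h. \<Sum>xs\<in>A. a xs * word_reduction xs h)"
    using v(1) by (auto simp: lincombs_def)
  have "y n = (\<Sum>xs\<in>A. a xs * spec (mat (word_act xs) n))" if n: "n \<in> ?I \<times> ?I" for n
  proof -
    obtain f g where fg: "n = (f, g)" "f \<in> ?I" "g \<in> ?I" using n by auto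
    then have l: "length f = length g" "length f = m" by (auto simp: tensor_index_def)
    have "set (zip f g) \<subseteq> X" using fg by (auto simp: tensor_index_def elim!: in_set_zipE)
    then have "y (f, g) = v (zip f g)" using v(2)[THEN spec[of _ "zip f g"]] l by simp
    then show ?thesis using l by (simp add: A(3) fg(1) word_reduction_def reduction_def mat_apply)
  qed
  then show ?thesis using lincombsI[OF A(1,2), of a "\<lambda>xs n. spec (mat (word_act xs) n)"] by (intro bexI) auto
qed

lemma End_hecke_subset_\<Phi>:
  assumes m: "m \<ge> 1" and \<phi>: "\<phi> \<in> carrier (End_hecke r m)"
  shows "\<phi> \<in> \<Phi> r m ` carrier (Ui_alg r)"
proof -
  let ?I = "tensor_index r m" and ?M = "tensor_space r m"
  \<comment> \<open>One equation for each generator H_i and each entry (f, g) of the commutator;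
    \<open>?c\<close> holds its coefficients.\<close>
  let ?L = "{(i, f, g). i < m \<and> f \<in> ?I \<and> g \<in> ?I}"
  let ?c = "\<lambda>(i, f, g) n. (if snd n = g then mat (H_end r m i) (f, fst n) else 0) -
    (if fst n = f then mat (H_end r m i) (snd n, g) else 0)"
  have \<phi>E: "\<phi> \<in> carrier (End_ring r m)" and \<phi>H: "\<And>i v. i < m \<Longrightarrow> v \<in> ?M \<Longrightarrow> \<phi> (H_act i v) = H_act i (\<phi> v)"
    using \<phi> by (auto simp: End_hecke_iff)
  have solves: "(\<Sum>n\<in>?I \<times> ?I. ?c (i, f, g) n * mat \<psi> n) = 0"
    if "\<psi> \<in> carrier (End_ring r m)" "\<And>v. v \<in> ?M \<Longrightarrow> \<psi> (H_act i v) = H_act i (\<psi> v)" "i < m" "f \<in> ?I" "g \<in> ?I" for \<psi> i f g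
    using commutes_H_act_iff[OF that(1,3)] that by (simp add: commutator_sum)
  have "\<exists>v\<in>lincombs (spec_words r) (\<lambda>xs n. mat (word_act xs) n). \<forall>n\<in>?I \<times> ?I. mat \<phi> n = v n"
  proof (rule sp.solution_space_lifting[where L = ?L and c = ?c])
    show "mat (word_act xs) n \<in> spec_ring" if "xs \<in> spec_words r" for xs n
      using integral_word_act[OF that integral_basis_vec] by (cases n) (simp add: mat_apply integral_def)
  next
    fix l n assume "l \<in> ?L" "n \<in> ?I \<times> ?I"
    moreover have "mat (H_end r m i) (a, b) \<in> spec_ring" if "b \<in> ?I" for i a b
      using spec_hecke_basis[of i b a] that by (simp add: mat_H_end)
    ultimately show "?c l n \<in> spec_ring" by (auto simp: sp.diff sp.zero sp.uminus)
  next
    fix l xs assume l: "l \<in> ?L" and xs: "xs \<in> spec_words r"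
    then obtain i f g where ifg: "l = (i, f, g)" "i < m" "f \<in> ?I" "g \<in> ?I" by auto
    have xsU: "set xs \<subseteq> Ui_gens r" using xs by (auto simp: spec_words_def)
    \<comment> \<open>The word itself is defined on all tensors; its restriction is the element of
      \<open>End_ring\<close> with the same entries.\<close>
    define \<psi> where "\<psi> = restrict (word_act xs) ?M"
    have "\<psi> \<in> carrier (End_ring r m)"
      unfolding \<psi>_def word_act_mult[abs_def]
      using word_act_commutes[OF xsU m ifg(2)]
      by (intro restrict_in_End_ring linear_left_action_U) (auto simp: word_act_mult)
    then have "(\<Sum>n\<in>?I \<times> ?I. ?c (i, f, g) n * mat \<psi> n) = 0"
      using word_act_commutes[OF xsU m ifg(2)] H_act_tensor_space[OF ifg(2)] ifg
      by (intro solves) (auto simp: \<psi>_def)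
    moreover have "mat \<psi> n = mat (word_act xs) n" if "n \<in> ?I \<times> ?I" for n
      using that by (auto simp: mat_def \<psi>_def tensor_space_basis)
    ultimately show "(\<Sum>n\<in>?I \<times> ?I. ?c l n * mat (word_act xs) n) = 0"
      by (simp add: ifg(1))
  next
    fix y :: "rat list \<times> rat list \<Rightarrow> rat"
    assume y: "\<And>l. l \<in> ?L \<Longrightarrow> (\<Sum>n\<in>?I \<times> ?I. spec (?c l n) * y n) = 0"
    show "\<exists>v\<in>lincombs (spec_words r) (\<lambda>xs n. spec (mat (word_act xs) n)). \<forall>n\<in>?I \<times> ?I. y n = v n"
    proof (rule special_commutant[OF m])
      fix i f g assume "i < m" "f \<in> ?I" "g \<in> ?I"
      then show "(\<Sum>n\<in>?I \<times> ?I. spec ((if snd n = g then mat (H_end r m i) (f, fst n) else 0) -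
          (if fst n = f then mat (H_end r m i) (snd n, g) else 0)) * y n) = 0"
        using y[of "(i, f, g)"] by simp
    qed
  next
    fix l assume "l \<in> ?L"
    then show "(\<Sum>n\<in>?I \<times> ?I. ?c l n * mat \<phi> n) = 0"
      using solves[OF \<phi>E \<phi>H] by (auto simp del: mult_eq_0_iff)
  qed simp
  then obtain A a where A: "finite A" "A \<subseteq> spec_words r"
    "\<And>n. n \<in> ?I \<times> ?I \<Longrightarrow> mat \<phi> n = (\<Sum>xs\<in>A. a xs * mat (word_act xs) n)"
    by (auto simp: lincombs_def)
  define z where "z = (\<Sum>xs\<in>A. scalar (a xs) * prod_list xs)"
  have z: "z \<in> carrier (free_algebra (U_gens r))" "U_class r z \<in> carrier (Ui_alg r)"
    using lincomb_in_Ui_alg[OF A(1), of r a] A(2) by (auto simp: z_def spec_words_def)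
  have zact: "left_action U_act z v = (\<Sum>xs\<in>A. scale (a xs) (word_act xs v))" for v
    unfolding z_def using A(1)
    by (induction A rule: finite_induct) (simp_all add: action_add left_action_U_mult word_act_mult)
  have "\<phi> = U_op r m z"
  proof (rule End_ring_eqI[OF \<phi>E])
    show "U_op r m z \<in> carrier (End_ring r m)" using ring_hom_closed[OF U_op_hom[OF m] z(1)] .
    fix f g assume "f \<in> ?I" "g \<in> ?I"
    then show "mat \<phi> (f, g) = mat (U_op r m z) (f, g)"
      using A(3)[of "(f, g)"] by (simp add: mat_apply U_op_def tensor_space_basis zact lookup_sum)
  qed
  then show ?thesis using \<Phi>_class[OF m z(1)] z(2) by (intro image_eqI[of _ _ "U_class r z"]) simp_all
qed

section \<open>Endomorphisms commuting with the coideal subalgebra\<close>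

text \<open>Off the diagonal, H_i has the entries of the permutation matrix of s_i, and s_i is an
  involution.\<close>

lemma hecke_basis_symmetric:
  assumes "f \<in> tensor_index r m" "g \<in> tensor_index r m" "i < m"
  shows "Poly_Mapping.lookup (hecke_basis i g) f = Poly_Mapping.lookup (hecke_basis i f) g"
proof (cases "f = g")
  case False
  have "weyl_act g i = f \<longleftrightarrow> weyl_act f i = g"
    using weyl_act_involution[OF assms(1,3)] weyl_act_involution[OF assms(2,3)] by auto
  moreover have "Poly_Mapping.lookup (hecke_basis i g) f = (if weyl_act g i = f then 1 else 0)"
    if "f \<noteq> g" for f g
    using that weyl_act_same[of g i]
    by (cases "i = 0") (auto simp: hecke_basis_def lookup_add lookup_basis_vec)
  ultimately show ?thesis using False by auto
qed simp

definition mat_endo :: "nat \<Rightarrow> nat \<Rightarrow> (rat list \<times> rat list \<Rightarrow> Qpq) \<Rightarrow> tensor \<Rightarrow> tensor" where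
  "mat_endo r m C = restrict (lin_extend (\<lambda>g. \<Sum>f\<in>tensor_index r m. scale (C (f, g)) (basis_vec f))) (tensor_space r m)"

lemma tensor_space_sum: "(\<And>a. a \<in> A \<Longrightarrow> F a \<in> tensor_space r m) \<Longrightarrow> sum F A \<in> tensor_space r m"
  by (induction A rule: infinite_finite_induct) (auto simp: tensor_space_zero tensor_space_add)

lemma mat_endo_carrier: "mat_endo r m C \<in> carrier (End_ring r m)"
  unfolding mat_endo_def
  by (intro restrict_in_End_ring linear_lin_extend tensor_space_lin_extend tensor_space_sum tensor_space_scale)
    (simp add: tensor_space_basis)

lemma mat_mat_endo:
  assumes "f \<in> tensor_index r m" "g \<in> tensor_index r m"
  shows "mat (mat_endo r m C) (f, g) = C (f, g)"
  using assms by (simp add: mat_apply mat_endo_def tensor_space_basis lookup_sum lookup_basis_vec if_distrib cong: if_cong)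

lemma mat_mult_cong:
  assumes "\<And>i j. i \<in> I \<Longrightarrow> j \<in> I \<Longrightarrow> A (i, j) = A' (i, j)" "\<And>i j. i \<in> I \<Longrightarrow> j \<in> I \<Longrightarrow> B (i, j) = B' (i, j)"
    "i \<in> I" "k \<in> I"
  shows "mat_mult I A B (i, k) = mat_mult I A' B' (i, k)"
  unfolding mat_mult_apply by (rule sum.cong) (use assms in auto)

lemma End_Ui_subset_\<Psi>:
  assumes m: "m \<ge> 1" and \<phi>: "\<phi> \<in> carrier (End_Ui r m)"
  shows "\<phi> \<in> \<Psi> r m ` carrier (hecke_alg m)"
proof -
  let ?I = "tensor_index r m" and ?M = "tensor_space r m"
  let ?F = "free_algebra {..<m}"
  let ?G = "(\<lambda>i. mat (H_end r m i)) ` {..<m}"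
  \<comment> \<open>Membership concerns only entries indexed by the tensor space, so V is closed
    under addition of functions that are arbitrary elsewhere.\<close>
  define V where "V = {v. \<exists>y\<in>carrier ?F. \<forall>f\<in>?I. \<forall>g\<in>?I. v (f, g) = mat (right_action H_act y) (f, g)}"
  have \<phi>E: "\<phi> \<in> carrier (End_ring r m)"
    and \<phi>U: "\<And>u v. u \<in> carrier (Ui_alg r) \<Longrightarrow> v \<in> ?M \<Longrightarrow> \<phi> (\<Phi> r m u v) = \<Phi> r m u (\<phi> v)"
    using \<phi> by (auto simp: End_Ui_def)
  have VI: "v \<in> V" if "y \<in> carrier ?F" "\<And>f g. f \<in> ?I \<Longrightarrow> g \<in> ?I \<Longrightarrow> v (f, g) = mat (right_action H_act y) (f, g)" for v y
    using that unfolding V_def by blast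
  have "\<exists>v\<in>V. \<forall>f\<in>?I. \<forall>g\<in>?I. mat \<phi> (f, g) = v (f, g)"
  proof (rule bicommutant[where e = "\<lambda>(f, g). if f = g then 1 else 0" and G = ?G])
    show "fun_subspace V"
      unfolding fun_subspace_def
    proof (intro conjI ballI allI)
      show "(\<lambda>_. 0) \<in> V" by (rule VI[of 0]) (auto simp: free_algebra_closed mat_apply)
    next
      fix u v assume "u \<in> V" "v \<in> V"
      then obtain y z where "y \<in> carrier ?F" "\<forall>f\<in>?I. \<forall>g\<in>?I. u (f, g) = mat (right_action H_act y) (f, g)"
        "z \<in> carrier ?F" "\<forall>f\<in>?I. \<forall>g\<in>?I. v (f, g) = mat (right_action H_act z) (f, g)"
        unfolding V_def by blast
      then show "(\<lambda>n. u n + v n) \<in> V"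
        by (intro VI[of "y + z"]) (auto simp: free_algebra_closed mat_apply action_add lookup_add)
    next
      fix c v assume "v \<in> V"
      then obtain z where "z \<in> carrier ?F" "\<forall>f\<in>?I. \<forall>g\<in>?I. v (f, g) = mat (right_action H_act z) (f, g)"
        unfolding V_def by blast
      then show "(\<lambda>n. c * v n) \<in> V"
        by (intro VI[of "z * scalar c"]) (auto simp: free_algebra_closed mat_apply right_action_H_mult)
    qed
  next
    show "(\<lambda>(f, g). if f = g then 1 else 0) \<in> V"
      by (rule VI[of 1]) (auto simp: free_algebra_closed mat_apply lookup_basis_vec)
  next
    fix h f g assume "h \<in> ?G" "f \<in> ?I" "g \<in> ?I"
    then show "h (f, g) = h (g, f)"
      using hecke_basis_symmetric[of f r m g] by (auto simp: mat_H_end)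
  next
    fix h v assume "h \<in> ?G" "v \<in> V"
    then obtain i y where i: "i < m" "h = mat (H_end r m i)"
      and y: "y \<in> carrier ?F" "\<forall>f\<in>?I. \<forall>g\<in>?I. v (f, g) = mat (right_action H_act y) (f, g)"
      unfolding V_def by blast
    show "mat_mult ?I h v \<in> V"
    \<comment> \<open>A right action reverses products: multiplying matrices by H_i from the left
      means appending the generator on the right.\<close>
    proof (rule VI[of "y * gen i"])
      show "y * gen i \<in> carrier ?F" using y i by (intro free_algebra_closed) auto
      fix f g assume fg: "f \<in> ?I" "g \<in> ?I"
      then have b: "right_action H_act y (basis_vec g) \<in> ?M"
        by (intro right_action_tensor_space[OF y(1)]) (simp add: tensor_space_basis)
      have "mat (right_action H_act (y * gen i)) (f, g) = Poly_Mapping.lookup (H_end r m i (right_action H_act y (basis_vec g))) f"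
        using b by (simp add: mat_apply right_action_H_mult H_end_def)
      also have "\<dots> = mat_mult ?I h (mat (right_action H_act y)) (f, g)"
        unfolding i(2) by (rule mat_compose[where \<psi> = "right_action H_act y", OF H_end_carrier[OF i(1)] b])
      also have "\<dots> = mat_mult ?I h v (f, g)"
        by (rule mat_mult_cong) (use y(2) fg in auto)
      finally show "mat_mult ?I h v (f, g) = mat (right_action H_act (y * gen i)) (f, g)" by simp
    qed
  next
    fix C assume C: "\<And>h f g. h \<in> ?G \<Longrightarrow> f \<in> ?I \<Longrightarrow> g \<in> ?I \<Longrightarrow> mat_mult ?I C h (f, g) = mat_mult ?I h C (f, g)"
    let ?C = "mat_endo r m C"
    have CC: "mat_mult ?I (mat ?C) B (f, g) = mat_mult ?I C B (f, g)" "mat_mult ?I B (mat ?C) (f, g) = mat_mult ?I B C (f, g)"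
      if "f \<in> ?I" "g \<in> ?I" for B f g
      by (rule mat_mult_cong; use that in \<open>simp add: mat_mat_endo\<close>)+
    have "?C \<in> carrier (End_hecke r m)"
      unfolding End_hecke_iff
    proof (intro conjI allI impI mat_endo_carrier)
      fix i assume i: "i < m"
      show "\<forall>v\<in>?M. ?C (H_act i v) = H_act i (?C v)"
        unfolding commutes_H_act_iff[OF mat_endo_carrier i] using C i CC by simp
    qed
    \<comment> \<open>By the first centralizer equality every C that commutes with the Hecke
      operators comes from the coideal subalgebra, and \<phi> commutes with that by
      assumption.\<close>
    then obtain u where u: "u \<in> carrier (Ui_alg r)" "?C = \<Phi> r m u"
      using End_hecke_subset_\<Phi>[OF m] by blast
    show "\<forall>f\<in>?I. \<forall>g\<in>?I. mat_mult ?I (mat \<phi>) C (f, g) = mat_mult ?I C (mat \<phi>) (f, g)"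
    proof (intro ballI)
      fix f g assume fg: "f \<in> ?I" "g \<in> ?I"
      then have b: "basis_vec g \<in> ?M" by (simp add: tensor_space_basis)
      have "mat_mult ?I (mat \<phi>) (mat ?C) (f, g) = Poly_Mapping.lookup (\<phi> (?C (basis_vec g))) f"
        by (rule mat_compose[where \<psi> = ?C, OF \<phi>E End_ring_linear(1)[OF mat_endo_carrier b], symmetric])
      also have "\<phi> (?C (basis_vec g)) = ?C (\<phi> (basis_vec g))"
        unfolding u(2) by (rule \<phi>U[OF u(1) b])
      also have "Poly_Mapping.lookup (?C (\<phi> (basis_vec g))) f = mat_mult ?I (mat ?C) (mat \<phi>) (f, g)"
        by (rule mat_compose[where \<psi> = \<phi>, OF mat_endo_carrier End_ring_linear(1)[OF \<phi>E b]])
      finally show "mat_mult ?I (mat \<phi>) C (f, g) = mat_mult ?I C (mat \<phi>) (f, g)"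
        using CC fg by simp
    qed
  qed simp_all
  then obtain y where y: "y \<in> carrier ?F" "\<And>f g. f \<in> ?I \<Longrightarrow> g \<in> ?I \<Longrightarrow> mat \<phi> (f, g) = mat (right_action H_act y) (f, g)"
    unfolding V_def by auto
  have "\<phi> = H_op r m y"
  proof (rule End_ring_eqI[OF \<phi>E])
    show "H_op r m y \<in> carrier (End_ring r m)"
      using ring_hom_closed[OF H_op_hom y(1)] by (simp add: opposite_ring_def)
    fix f g assume "f \<in> ?I" "g \<in> ?I"
    then show "mat \<phi> (f, g) = mat (H_op r m y) (f, g)"
      using y(2)[of f g] by (simp add: mat_apply H_op_def tensor_space_basis)
  qed
  moreover have "hecke_class m y \<in> carrier (hecke_alg m)"
    using y(1) by (simp add: hecke_alg_def carrier_presented_algebra)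
  ultimately show ?thesis using \<Psi>_class[OF y(1)] by (intro image_eqI[of _ _ "hecke_class m y"]) simp_all
qed

theorem theorem2p6:
  fixes r m :: nat
  assumes "m \<ge> 1"
  shows "\<Phi> r m \<in> ring_hom (Ui_alg r) (End_ring r m) \<and>
    \<Psi> r m \<in> ring_hom (hecke_alg m) (opposite_ring (End_ring r m)) \<and>
    (\<forall>u \<in> carrier (Ui_alg r). \<forall>h \<in> carrier (hecke_alg m). \<forall>v \<in> tensor_space r m.
      \<Phi> r m u (\<Psi> r m h v) = \<Psi> r m h (\<Phi> r m u v)) \<and>
    (End_ring r m)\<lparr>carrier := \<Phi> r m ` carrier (Ui_alg r)\<rparr> = End_hecke r m \<and>
    opposite_ring (End_Ui r m) =
      (opposite_ring (End_ring r m))\<lparr>carrier := \<Psi> r m ` carrier (hecke_alg m)\<rparr>"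
proof (intro conjI ballI)
  show \<Phi>: "\<Phi> r m \<in> ring_hom (Ui_alg r) (End_ring r m)" by (rule \<Phi>_hom[OF assms])
  show \<Psi>: "\<Psi> r m \<in> ring_hom (hecke_alg m) (opposite_ring (End_ring r m))" by (rule \<Psi>_hom)
  show comm: "\<Phi> r m u (\<Psi> r m h v) = \<Psi> r m h (\<Phi> r m u v)"
    if "u \<in> carrier (Ui_alg r)" "h \<in> carrier (hecke_alg m)" "v \<in> tensor_space r m" for u h v
    by (rule \<Phi>_\<Psi>_commute[OF assms that])
  have "\<Phi> r m ` carrier (Ui_alg r) = carrier (End_hecke r m)"
    using End_hecke_subset_\<Phi>[OF assms] ring_hom_closed[OF \<Phi>] comm by (auto simp: End_hecke_def)
  then show "(End_ring r m)\<lparr>carrier := \<Phi> r m ` carrier (Ui_alg r)\<rparr> = End_hecke r m"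
    by (simp add: End_hecke_def)
  have "\<Psi> r m ` carrier (hecke_alg m) = carrier (End_Ui r m)"
    using End_Ui_subset_\<Psi>[OF assms] ring_hom_closed[OF \<Psi>] comm by (auto simp: End_Ui_def opposite_ring_def)
  then show "opposite_ring (End_Ui r m) =
      (opposite_ring (End_ring r m))\<lparr>carrier := \<Psi> r m ` carrier (hecke_alg m)\<rparr>"
    by (simp add: End_Ui_def opposite_ring_def)
qed

end
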